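(* Let $0<\alpha\le\pi/4$ and let $\mathcal N_\alpha$ be the qutrit-to-qutrit channel $\mathcal N_\alpha(\rho)=E_0\rho E_0^\dagger+E_1\rho E_1^\dagger$ with $E_0=\sin\alpha\,|0\rangle\langle1|+|1\rangle\langle2|$ and $E_1=\cos\alpha\,|2\rangle\langle1|+|1\rangle\langle0|$. Then $$C(\mathcal N_\alpha)=C_{\mathrm{NS}\cap\mathrm{PPT}}(\mathcal N_\alpha)=C_\beta(\mathcal N_\alpha)=1.$$
   Context: $\log$ is base 2. For a channel $\mathcal N$ from $\mathcal L(A')$ to $\mathcal L(B)$ (finite-dimensional, $A\cong A'$), $J_{\mathcal N}=\sum_{i,j}|i\rangle\langle j|_A\otimes\mathcal N(|i\rangle\langle j|_{A'})$ is its Choi matrix and $T_B$ the partial transpose on $B$. Define $$\beta(\mathcal N)=\min\{\operatorname{Tr}S_B:\ -R_{AB}\le J_{\mathcal N}^{T_B}\le R_{AB},\ -\mathbb 1_A\otimes S_B\le R_{AB}^{T_B}\le\mathbb 1_A\otimes S_B\}$$ (over Hermitian operators) and $C_\beta=\log\beta$. $C(\mathcal N)=\sup_{n\ge1}\chi(\mathcal N^{\otimes n})/n$ is the classical capacity, where $\chi(\mathcal N)=\max_{\{(p_i,\rho_i)\}}H(\sum_ip_i\mathcal N(\rho_i))-\sum_ip_iH(\mathcal N(\rho_i))$ and $H$ is the von Neumann entropy. Codes. A code for $m$ messages over $\mathcal N$ is a bipartite map $\Pi$ from $\mathcal L(A_i\otimes B_i)$ to $\mathcal L(A_o\otimes B_o)$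 with $A_i=B_o=\mathbb C^m$, $A_o$ the input and $B_i$ the output system of $\mathcal N$. With $Z=Z_{A_iB_iA_oB_o}$ its Choi matrix (fewer subscripts denote marginals), $\Pi$ is an NS$\cap$PPT (no-signalling and PPT-preserving) code if $Z\ge0$, $Z_{A_iB_i}=\mathbb 1_{A_iB_i}$, $Z^{T_{B_iB_o}}\ge0$, $Z_{A_iB_iB_o}=\frac{\mathbb 1_{A_i}}{d_{A_i}}\otimes Z_{B_iB_o}$, $Z_{A_iB_iA_o}=\frac{\mathbb 1_{B_i}}{d_{B_i}}\otimes Z_{A_iA_o}$. The resulting channel $\mathcal M=\Pi\circ\mathcal N$ has Choi matrix $J_{\mathcal M}=\operatorname{Tr}_{A_oB_i}[(J_{\mathcal N}^T\otimes\mathbb 1_{A_iB_o})Z]$. $f_{\mathrm{NS}\cap\mathrm{PPT}}(\mathcal N,m)$ is the supremum over such codes of $\frac1m\sum_{k=1}^m\operatorname{Tr}(\mathcal M(|k\rangle\langle k|)|k\rangle\langle k|)$, and $C_{\mathrm{NS}\cap\mathrm{PPT}}(\mathcal N)=\sup\{r:\lim_{n\to\infty}f_{\mathrm{NS}\cap\mathrm{PPT}}(\mathcal N^{\otimes n},2^{rn})=1\}$, with $2^{rn}$ read as $\lfloor2^{rn}\rfloor$ when not an integer. *)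

theory Defs
  imports
    Complex_Main
    "Jordan_Normal_Form.Char_Poly"
    "Jordan_Normal_Form.Schur_Decomposition"
begin

text \<open>
  Operators on \<open>\<complex>^d\<close> are matrices in \<open>carrier_mat d d\<close>. The product basis vector \<open>|i\<rangle> \<otimes> |k\<rangle>\<close> of
  \<open>\<complex>^d \<otimes> \<complex>^e\<close> has index \<open>i * e + k\<close>.
\<close>

definition ketbra :: "nat \<Rightarrow> nat \<Rightarrow> nat \<Rightarrow> complex mat" where
  "ketbra d i j = mat d d (\<lambda>(r, s). if r = i \<and> s = j then 1 else 0)"

definition tr :: "complex mat \<Rightarrow> complex" where
  "tr A = (\<Sum>i<dim_row A. A $$ (i, i))"

definition sum_mat :: "nat \<Rightarrow> ('i \<Rightarrow> complex mat) \<Rightarrow> 'i set \<Rightarrow> complex mat" where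
  "sum_mat d F I = mat d d (\<lambda>rs. \<Sum>i\<in>I. F i $$ rs)"

definition kron :: "complex mat \<Rightarrow> complex mat \<Rightarrow> complex mat" (infixr "\<otimes>\<^sub>K" 75) where
  "A \<otimes>\<^sub>K B = mat (dim_row A * dim_row B) (dim_col A * dim_col B)
     (\<lambda>(r, s). A $$ (r div dim_row B, s div dim_col B) * B $$ (r mod dim_row B, s mod dim_col B))"

definition hermitian :: "nat \<Rightarrow> complex mat \<Rightarrow> bool" where
  "hermitian d A \<longleftrightarrow> A \<in> carrier_mat d d \<and> mat_adjoint A = A"

text \<open>On \<open>complex\<close>, \<open>0 \<le> z\<close> means that \<open>z\<close> is real and non-negative.\<close>

definition psd :: "nat \<Rightarrow> complex mat \<Rightarrow> bool" where
  "psd d A \<longleftrightarrow> hermitian d A \<and> (\<forall>v\<in>carrier_vec d. 0 \<le> (A *\<^sub>v v) \<bullet>c v)"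

definition loewner_le :: "nat \<Rightarrow> complex mat \<Rightarrow> complex mat \<Rightarrow> bool" where
  "loewner_le d A B \<longleftrightarrow> A \<in> carrier_mat d d \<and> B \<in> carrier_mat d d \<and> psd d (B - A)"

definition density :: "nat \<Rightarrow> complex mat \<Rightarrow> bool" where
  "density d \<rho> \<longleftrightarrow> psd d \<rho> \<and> tr \<rho> = 1"

definition ptranspose :: "nat \<Rightarrow> nat \<Rightarrow> complex mat \<Rightarrow> complex mat" where \<comment> \<open>transposes the second factor of \<open>\<complex>^a \<otimes> \<complex>^b\<close>\<close>
  "ptranspose a b X = mat (a * b) (a * b)
     (\<lambda>(r, s). X $$ ((r div b) * b + s mod b, (s div b) * b + r mod b))"

definition ptrace :: "nat \<Rightarrow> nat \<Rightarrow> nat \<Rightarrow> complex mat \<Rightarrow> complex mat" where \<comment> \<open>traces out the middle factor of \<open>\<complex>^a \<otimes> \<complex>^b \<otimes> \<complex>^c\<close>\<close>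
  "ptrace a b c X = mat (a * c) (a * c)
     (\<lambda>(r, s). \<Sum>t<b. X $$ (((r div c) * b + t) * c + r mod c, ((s div c) * b + t) * c + s mod c))"

text \<open>
  A linear map from \<open>carrier_mat a a\<close> to \<open>carrier_mat b b\<close> is given by a function on matrices
  together with the dimensions \<open>a\<close> and \<open>b\<close>; only its values on \<open>carrier_mat a a\<close> matter.
\<close>

type_synonym superop = "complex mat \<Rightarrow> complex mat"

definition choi :: "nat \<Rightarrow> nat \<Rightarrow> superop \<Rightarrow> complex mat" where
  "choi a b \<N> = sum_mat (a * b) (\<lambda>(i, j). ketbra a i j \<otimes>\<^sub>K \<N> (ketbra a i j)) ({..<a} \<times> {..<a})"

definition of_choi :: "nat \<Rightarrow> nat \<Rightarrow> complex mat \<Rightarrow> superop" where \<comment> \<open>\<open>\<rho> \<mapsto> Tr\<^sub>A [(\<rho>\<^sup>T \<otimes> 1) J]\<close>\<close>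
  "of_choi a b J \<rho> = ptrace 1 a b ((\<rho>\<^sup>T \<otimes>\<^sub>K 1\<^sub>m b) * J)"

text \<open>The linear extension of \<open>X \<otimes> Y \<mapsto> \<N> X \<otimes> \<M> Y\<close>, evaluated by expanding in matrix units.\<close>

definition superop_tensor :: "nat \<Rightarrow> nat \<Rightarrow> superop \<Rightarrow> nat \<Rightarrow> nat \<Rightarrow> superop \<Rightarrow> superop" where
  "superop_tensor a b \<N> a' b' \<M> X = sum_mat (b * b')
     (\<lambda>(i, j, k, l). X $$ (i * a' + k, j * a' + l) \<cdot>\<^sub>m (\<N> (ketbra a i j) \<otimes>\<^sub>K \<M> (ketbra a' k l)))
     ({..<a} \<times> {..<a} \<times> {..<a'} \<times> {..<a'})"

fun superop_power :: "nat \<Rightarrow> nat \<Rightarrow> superop \<Rightarrow> nat \<Rightarrow> superop" where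
  "superop_power a b \<N> 0 = (\<lambda>X. X)"
| "superop_power a b \<N> (Suc n) = superop_tensor a b \<N> (a ^ n) (b ^ n) (superop_power a b \<N> n)"

text \<open>
  \<open>- Tr (\<rho> log \<rho>)\<close> through the eigenvalues, counted with multiplicity; in HOL \<open>log 2 0 = 0\<close>,
  so zero eigenvalues contribute zero.
\<close>

definition vn_entropy :: "complex mat \<Rightarrow> real" where
  "vn_entropy \<rho> = - (\<Sum>x\<in>{x. eigenvalue \<rho> x}. real (order x (char_poly \<rho>)) * (Re x * log 2 (Re x)))"

text \<open>
  The maxima, suprema and minima below are \<open>Sup\<close> and \<open>Inf\<close> of sets of reals that, for a channel,
  are non-empty and bounded.
\<close>

definition holevo :: "nat \<Rightarrow> nat \<Rightarrow> superop \<Rightarrow> real" where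
  "holevo a b \<N> = Sup {vn_entropy (sum_mat b (\<lambda>i. complex_of_real (p i) \<cdot>\<^sub>m \<N> (\<rho> i)) {..<k})
        - (\<Sum>i<k. p i * vn_entropy (\<N> (\<rho> i))) | (k :: nat) (p :: nat \<Rightarrow> real) (\<rho> :: nat \<Rightarrow> complex mat).
      (\<forall>i<k. 0 \<le> p i \<and> density a (\<rho> i)) \<and> (\<Sum>i<k. p i) = 1}"

definition classical_capacity :: "nat \<Rightarrow> nat \<Rightarrow> superop \<Rightarrow> real" where
  "classical_capacity a b \<N> = Sup {holevo (a ^ n) (b ^ n) (superop_power a b \<N> n) / real n | n. n \<ge> 1}"

definition beta :: "nat \<Rightarrow> nat \<Rightarrow> superop \<Rightarrow> real" where
  "beta a b \<N> = Inf {Re (tr S) | S R. hermitian b S \<and> hermitian (a * b) R \<and>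
      loewner_le (a * b) (- R) (ptranspose a b (choi a b \<N>)) \<and>
      loewner_le (a * b) (ptranspose a b (choi a b \<N>)) R \<and>
      loewner_le (a * b) (- (1\<^sub>m a \<otimes>\<^sub>K S)) (ptranspose a b R) \<and>
      loewner_le (a * b) (ptranspose a b R) (1\<^sub>m a \<otimes>\<^sub>K S)}"

definition C_beta :: "nat \<Rightarrow> nat \<Rightarrow> superop \<Rightarrow> real" where
  "C_beta a b \<N> = log 2 (beta a b \<N>)"

text \<open>
  The factors of the Choi matrix \<open>Z\<close> of a code are ordered as \<open>A\<^sub>i \<otimes> A\<^sub>o \<otimes> B\<^sub>i \<otimes> B\<^sub>o\<close>, of dimensions
  \<open>m\<close>, \<open>a\<close>, \<open>b\<close>, \<open>m\<close>. With this order each no-signalling condition is an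
  equation with a Kronecker product, and \<open>B\<^sub>i \<otimes> B\<^sub>o\<close> is a tail that \<^const>\<open>ptranspose\<close> can transpose.
\<close>

definition ns_ppt_code :: "nat \<Rightarrow> nat \<Rightarrow> nat \<Rightarrow> complex mat \<Rightarrow> bool" where
  "ns_ppt_code a b m Z \<longleftrightarrow>
    (let Z_AiAoBi = ptrace (m * a * b) m 1 Z;
         Z_AiBiBo = ptrace m a (b * m) Z;
         Z_AiBi = ptrace m a b Z_AiAoBi;
         Z_AiAo = ptrace (m * a) b 1 Z_AiAoBi;
         Z_BiBo = ptrace 1 m (b * m) Z_AiBiBo
     in psd (m * a * b * m) Z \<and>
        Z_AiBi = 1\<^sub>m (m * b) \<and>
        psd (m * a * b * m) (ptranspose (m * a) (b * m) Z) \<and>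
        Z_AiBiBo = ((1 / of_nat m) \<cdot>\<^sub>m 1\<^sub>m m) \<otimes>\<^sub>K Z_BiBo \<and>
        Z_AiAoBi = Z_AiAo \<otimes>\<^sub>K ((1 / of_nat b) \<cdot>\<^sub>m 1\<^sub>m b))"

definition code_channel :: "nat \<Rightarrow> nat \<Rightarrow> superop \<Rightarrow> nat \<Rightarrow> complex mat \<Rightarrow> superop" where
  "code_channel a b \<N> m Z =
     of_choi m m (ptrace m (a * b) m ((1\<^sub>m m \<otimes>\<^sub>K (choi a b \<N>)\<^sup>T \<otimes>\<^sub>K 1\<^sub>m m) * Z))"

definition f_ns_ppt :: "nat \<Rightarrow> nat \<Rightarrow> superop \<Rightarrow> nat \<Rightarrow> real" where
  "f_ns_ppt a b \<N> m = Sup {1 / real m * (\<Sum>k<m. Re (tr (code_channel a b \<N> m Z (ketbra m k k) * ketbra m k k)))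
      | Z. ns_ppt_code a b m Z}"

text \<open>Rates are non-negative, so that the number of messages is at least one.\<close>

definition C_ns_ppt :: "nat \<Rightarrow> nat \<Rightarrow> superop \<Rightarrow> real" where
  "C_ns_ppt a b \<N> = Sup {r. 0 \<le> r \<and>
      (\<lambda>n. f_ns_ppt (a ^ n) (b ^ n) (superop_power a b \<N> n) (nat \<lfloor>2 powr (r * real n)\<rfloor>)) \<longlonglongrightarrow> 1}"

definition E0 :: "real \<Rightarrow> complex mat" where
  "E0 \<alpha> = complex_of_real (sin \<alpha>) \<cdot>\<^sub>m ketbra 3 0 1 + ketbra 3 1 2"

definition E1 :: "real \<Rightarrow> complex mat" where
  "E1 \<alpha> = complex_of_real (cos \<alpha>) \<cdot>\<^sub>m ketbra 3 2 1 + ketbra 3 1 0"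

definition N_chan :: "real \<Rightarrow> superop" where
  "N_chan \<alpha> \<rho> = E0 \<alpha> * \<rho> * mat_adjoint (E0 \<alpha>) + E1 \<alpha> * \<rho> * mat_adjoint (E1 \<alpha>)"

end

theory Submission
  imports Defs
begin

text \<open>
  Let \<open>s = sin \<alpha>\<close>, \<open>c = cos \<alpha>\<close>. The pair \<open>S = diag(s\<^sup>2, 1, c\<^sup>2)\<close>, \<open>R = |J\<^sup>T\<^sup>B|\<close> is feasible for \<open>\<beta>\<close>, so
  \<open>\<beta> \<le> 2\<close>; comparing diagonal entries gives \<open>J\<^sub>a\<^sub>b\<^sub>,\<^sub>a\<^sub>b \<le> S\<^sub>b\<^sub>b\<close> and hence \<open>\<beta> \<ge> 2\<close>. Tensor powers of a feasible
  pair are feasible for the tensor powers of the channel.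

  A feasible pair bounds both capacities. The success probability of an NS and PPT code
  with \<open>m\<close> messages is at most \<open>Tr S / m\<close>. Moreover every output state satisfies \<open>\<N> \<rho> \<le> S\<close>, so its
  divergence from \<open>S / Tr S\<close> is at most \<open>log Tr S\<close>, which bounds the Holevo quantity without any coding
  theorem; because \<open>S\<close> is diagonal, scalar inequalities for \<open>ln\<close> replace the operator monotonicity of the
  logarithm. Both bounds are attained because the inputs \<open>|0\<rangle>\<close> and \<open>|1\<rangle>\<close> have orthogonal outputs.
\<close>

section \<open>Matrices on product spaces\<close>

text \<open>The inputs |0> and |1> have outputs |1><1| and diag(s^2, 0, c^2), whose sum is
  \<open>S\<close>. These two outputs therefore supply the diagonal entries that force Tr S >= 2,
  the zero-error code for two messages, and the ensemble that reaches Holevo information 1. The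
  obstacle in both converses is that the constraints on \<open>J\<close> and on \<open>R\<close> sit
  on opposite sides of a partial transpose, which respects neither positivity nor the order. The
  chain J^T_B <= R, then R^T_B <= 1 (x) S, can be followed only along tests that stay positive when
  transposed on B: product vectors in the Holevo bound, blocks of a PPT code in the coding bound.
  Positivity is handled through Gram representations, A_rs = sum_i w_i(r) cnj(w_i(s)). They survive
  reindexing, entrywise products, restriction to blocks and contraction. The spectral theorem serves
  to obtain them and to turn entropies into sums over eigenvalues.\<close>

lemma pair_less:
  fixes a b i k :: nat
  assumes "i < a" "k < b"
  shows "i * b + k < a * b"
proof -
  have "i * b + k < Suc i * b" using assms by simp
  also have "\<dots> \<le> a * b" using assms by (intro mult_le_mono1) auto
  finally show ?thesis .
qed

lemma sum_lessThan_mult: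
  fixes f :: "nat \<Rightarrow> 'a::comm_monoid_add"
  shows "(\<Sum>t<a * b. f t) = (\<Sum>i<a. \<Sum>k<b. f (i * b + k))"
proof -
  have "(\<Sum>t<a * b. f t) = (\<Sum>i<a. sum f {i * b..<i * b + b})"
    by (simp add: sum.nat_group)
  also have "\<dots> = (\<Sum>i<a. \<Sum>k<b. f (i * b + k))"
  proof (rule sum.cong[OF refl])
    fix i
    show "sum f {i * b..<i * b + b} = (\<Sum>k<b. f (i * b + k))"
      by (rule sum.reindex_bij_witness[of _ "\<lambda>k. i * b + k" "\<lambda>k. k - i * b"]) auto
  qed
  finally show ?thesis .
qed

text \<open>Decomposing indices with this rule lets entry formulas be stated at
  \<open>i * b + k\<close>, after which \<open>div\<close> and \<open>mod\<close> simplify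
  away.\<close>

lemma pair_cases:
  fixes a b r :: nat
  assumes "r < a * b"
  obtains i k where "i < a" "k < b" "r = i * b + k"
proof
  have "b > 0" using assms by (cases b) auto
  then show "r div b < a" "r mod b < b" "r = r div b * b + r mod b"
    using assms by (auto simp: less_mult_imp_div_less)
qed

section \<open>Entries of Kronecker products, partial transposes, partial traces and Choi
  matrices\<close>

lemma ketbra_index: "r < d \<Longrightarrow> s < d \<Longrightarrow> ketbra d i j $$ (r, s) = (if r = i \<and> s = j then 1 else 0)"
  by (simp add: ketbra_def)

lemma ketbra_carrier [simp]: "ketbra d i j \<in> carrier_mat d d"
  by (simp add: ketbra_def)

lemma kron_carrier [simp]:
  "A \<in> carrier_mat a b \<Longrightarrow> B \<in> carrier_mat c d \<Longrightarrow> A \<otimes>\<^sub>K B \<in> carrier_mat (a * c) (b * d)"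
  by (auto simp: kron_def)

lemma kron_index:
  assumes "A \<in> carrier_mat a c" "B \<in> carrier_mat b d" "i < a" "k < b" "j < c" "l < d"
  shows "(A \<otimes>\<^sub>K B) $$ (i * b + k, j * d + l) = A $$ (i, j) * B $$ (k, l)"
  using assms pair_less[of i a k b] pair_less[of j c l d] by (auto simp: kron_def)

lemma ptranspose_carrier [simp]: "ptranspose a b X \<in> carrier_mat (a * b) (a * b)"
  by (simp add: ptranspose_def)

lemma ptranspose_index:
  assumes "i < a" "k < b" "j < a" "l < b"
  shows "ptranspose a b X $$ (i * b + k, j * b + l) = X $$ (i * b + l, j * b + k)"
  using assms pair_less[of i a k b] pair_less[of j a l b] by (auto simp: ptranspose_def)

lemma ptrace_carrier [simp]: "ptrace a b c X \<in> carrier_mat (a * c) (a * c)"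
  by (simp add: ptrace_def)

lemma ptrace_index:
  assumes "i < a" "k < c" "j < a" "l < c"
  shows "ptrace a b c X $$ (i * c + k, j * c + l)
    = (\<Sum>t<b. X $$ ((i * b + t) * c + k, (j * b + t) * c + l))"
  using assms pair_less[of i a k c] pair_less[of j a l c] by (auto simp: ptrace_def)

lemma choi_carrier [simp]: "choi a b \<N> \<in> carrier_mat (a * b) (a * b)"
  by (simp add: choi_def sum_mat_def)

text \<open>Only values on matrix units are constrained, because \<open>choi\<close> and
  \<open>superop_tensor\<close> evaluate a map nowhere else.\<close>

definition superop_dims :: "nat \<Rightarrow> nat \<Rightarrow> superop \<Rightarrow> bool" where
  "superop_dims a b \<N> \<longleftrightarrow> (\<forall>i<a. \<forall>j<a. \<N> (ketbra a i j) \<in> carrier_mat b b)"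

lemma superop_dimsD:
  "superop_dims a b \<N> \<Longrightarrow> i < a \<Longrightarrow> j < a \<Longrightarrow> \<N> (ketbra a i j) \<in> carrier_mat b b"
  by (simp add: superop_dims_def)

lemma choi_index:
  assumes N: "superop_dims a b \<N>"
    and "i < a" "k < b" "j < a" "l < b"
  shows "choi a b \<N> $$ (i * b + k, j * b + l) = \<N> (ketbra a i j) $$ (k, l)"
proof -
  have "choi a b \<N> $$ (i * b + k, j * b + l)
      = (\<Sum>(i', j')\<in>{..<a} \<times> {..<a}. (ketbra a i' j' \<otimes>\<^sub>K \<N> (ketbra a i' j')) $$ (i * b + k, j * b + l))"
    using assms pair_less[of i a k b] pair_less[of j a l b]
    by (auto simp: choi_def sum_mat_def intro!: sum.cong)
  also have "\<dots> = (\<Sum>p\<in>{..<a} \<times> {..<a}. if p = (i, j) then \<N> (ketbra a i j) $$ (k, l) else 0)"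
    using assms by (intro sum.cong) (auto simp: kron_index[OF ketbra_carrier superop_dimsD[OF N]] ketbra_index split: if_split_asm)
  also have "\<dots> = \<N> (ketbra a i j) $$ (k, l)"
    using assms by simp
  finally show ?thesis .
qed

section \<open>Adjoints, positive semidefinite matrices and quadratic forms\<close>

lemma mat_adjoint_carrier [simp]: "A \<in> carrier_mat n m \<Longrightarrow> mat_adjoint A \<in> carrier_mat m n"
  by (auto simp: mat_adjoint_def mat_of_rows_def)

lemma mat_adjoint_index:
  fixes A :: "complex mat"
  assumes "A \<in> carrier_mat n m" "i < m" "j < n"
  shows "mat_adjoint A $$ (i, j) = cnj (A $$ (j, i))"
  using assms by (auto simp: mat_adjoint_def mat_of_rows_def)

lemma hermitian_iff:
  "hermitian d A \<longleftrightarrow> A \<in> carrier_mat d d \<and> (\<forall>r<d. \<forall>s<d. A $$ (r, s) = cnj (A $$ (s, r)))"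
proof (cases "A \<in> carrier_mat d d")
  case True
  have "mat_adjoint A = A \<longleftrightarrow> (\<forall>r<d. \<forall>s<d. mat_adjoint A $$ (r, s) = A $$ (r, s))"
    using mat_eq_iff[of "mat_adjoint A" A] carrier_matD[OF mat_adjoint_carrier[OF True]] carrier_matD[OF True]
    by simp
  also have "\<dots> \<longleftrightarrow> (\<forall>r<d. \<forall>s<d. A $$ (r, s) = cnj (A $$ (s, r)))"
    by (simp add: mat_adjoint_index[OF True] eq_commute)
  finally show ?thesis using True by (simp add: hermitian_def)
qed (simp add: hermitian_def)

lemma psd_carrier: "psd d A \<Longrightarrow> A \<in> carrier_mat d d"
  by (simp add: psd_def hermitian_def)

lemma mult_cnj_nonneg: "0 \<le> z * cnj z"
  by (simp add: complex_mult_cnj less_eq_complex_def)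

text \<open>The vector is a function of which only the values below \<open>d\<close> matter, so test
  vectors can be written with \<open>r div b\<close> and \<open>r mod b\<close> and carry no
  dimension conditions.\<close>

definition quad :: "nat \<Rightarrow> complex mat \<Rightarrow> (nat \<Rightarrow> complex) \<Rightarrow> complex" where
  "quad d A x = (\<Sum>r<d. \<Sum>s<d. cnj (x r) * A $$ (r, s) * x s)"

lemma psd_iff_quad: "psd d A \<longleftrightarrow> hermitian d A \<and> (\<forall>x. 0 \<le> quad d A x)"
proof -
  have eq: "(A *\<^sub>v v) \<bullet>c v = quad d A (($) v)" if "A \<in> carrier_mat d d" "v \<in> carrier_vec d" for v
    using that
    by (auto simp: quad_def scalar_prod_def mult_mat_vec_def sum_distrib_left sum_distrib_right
        atLeast0LessThan ac_simps intro!: sum.cong)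
  have "0 \<le> quad d A x" if "psd d A" for x
  proof -
    have "quad d A x = quad d A (($) (vec d x))"
      by (auto simp: quad_def intro!: sum.cong)
    also have "\<dots> = (A *\<^sub>v vec d x) \<bullet>c vec d x"
      by (rule eq[symmetric]) (simp_all add: psd_carrier[OF that])
    also have "0 \<le> \<dots>"
      using that by (simp add: psd_def)
    finally show ?thesis .
  qed
  then show ?thesis using eq by (auto simp: psd_def hermitian_def)
qed

text \<open>The quadratic form becomes a sum of squared moduli, one for each \<open>j\<close>. The
  index set is left free: a rank-one matrix takes \<open>{()}\<close>, a tensor product takes a
  Cartesian product.\<close>

lemma psdI_gram:
  assumes A: "A \<in> carrier_mat d d"
    and g: "\<And>r s. r < d \<Longrightarrow> s < d \<Longrightarrow> A $$ (r, s) = (\<Sum>j\<in>I. w j r * cnj (w j s))"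
  shows "psd d A"
  unfolding psd_iff_quad hermitian_iff
proof (intro conjI allI impI)
  show "A $$ (r, s) = cnj (A $$ (s, r))" if "r < d" "s < d" for r s
    using that by (simp add: g mult.commute)
  fix x
  have "quad d A x = (\<Sum>r<d. \<Sum>s<d. \<Sum>j\<in>I. (cnj (x r) * w j r) * cnj (cnj (x s) * w j s))"
    by (auto simp: quad_def g sum_distrib_left sum_distrib_right ac_simps intro!: sum.cong)
  also have "\<dots> = (\<Sum>j\<in>I. \<Sum>r<d. \<Sum>s<d. (cnj (x r) * w j r) * cnj (cnj (x s) * w j s))"
    by (subst sum.swap, subst (2) sum.swap, subst (2) sum.swap, rule sum.swap)
  also have "\<dots> = (\<Sum>j\<in>I. (\<Sum>r<d. cnj (x r) * w j r) * cnj (\<Sum>r<d. cnj (x r) * w j r))"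
    by (simp add: sum_product)
  also have "0 \<le> \<dots>"
    by (rule sum_nonneg, rule mult_cnj_nonneg)
  finally show "0 \<le> quad d A x" .
qed (fact A)

section \<open>Spectral decomposition\<close>

lemma sum_rotate:
  "(\<Sum>i\<in>A. \<Sum>j\<in>B. \<Sum>k\<in>C. f i j k) = (\<Sum>j\<in>B. \<Sum>k\<in>C. \<Sum>i\<in>A. f i j k)"
  by (subst sum.swap, intro sum.cong refl, rule sum.swap)

lemma sum_product_scaled:
  fixes c :: "'a::comm_semiring_0"
  shows "(\<Sum>i\<in>A. \<Sum>j\<in>B. c * (f i * g j)) = c * ((\<Sum>i\<in>A. f i) * (\<Sum>j\<in>B. g j))"
  by (subst sum_product) (simp only: sum_distrib_left)

definition orthonormal :: "nat \<Rightarrow> (nat \<Rightarrow> nat \<Rightarrow> complex) \<Rightarrow> bool" where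
  "orthonormal d u \<longleftrightarrow> (\<forall>j<d. \<forall>k<d. (\<Sum>r<d. u j r * cnj (u k r)) = (if j = k then 1 else 0))"

text \<open>A one-sided inverse of a square matrix is two-sided, which turns orthonormal rows into
  orthonormal columns.\<close>

lemma orthonormal_complete:
  assumes u: "orthonormal d u" and "r < d" "s < d"
  shows "(\<Sum>j<d. u j r * cnj (u j s)) = (if r = s then 1 else 0)"
proof -
  define U where "U = mat d d (\<lambda>(j, r). u j r)"
  define V where "V = mat d d (\<lambda>(r, j). cnj (u j r))"
  have "U * V = 1\<^sub>m d"
    using u by (intro eq_matI) (auto simp: U_def V_def scalar_prod_def orthonormal_def atLeast0LessThan)
  then have "V * U = 1\<^sub>m d"
    by (intro mat_mult_left_right_inverse[of U d V]) (auto simp: U_def V_def)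
  then have "(V * U) $$ (s, r) = 1\<^sub>m d $$ (s, r)" by simp
  then show ?thesis
    using assms by (auto simp: U_def V_def scalar_prod_def atLeast0LessThan mult.commute)
qed

text \<open>Complete \<open>v\<close> to a basis with \<open>v\<close> at its head. Gram-Schmidt
  keeps the head and returns orthogonal vectors that still have to be normalised, so
  \<open>c\<close> is the inverse norm of \<open>v\<close>.\<close>

lemma extend_orthonormal:
  fixes v :: "complex vec"
  assumes v: "v \<in> carrier_vec n" "v \<noteq> 0\<^sub>v n"
  shows "\<exists>w c. orthonormal n w \<and> (\<forall>r<n. w 0 r = c * v $ r)"
proof -
  interpret cof_vec_space n "TYPE(complex)" .
  define b where "b = basis_completion v"
  define ws where "ws = gram_schmidt n b"
  have n: "n \<noteq> 0" using v by (auto simp: vec_eq_iff)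
  from basis_completion[OF v, folded b_def]
  have dist_b: "distinct b" and indep: "\<not> lin_dep (set b)" and b: "set b \<subseteq> carrier_vec n"
    and hdb: "hd b = v" and len_b: "length b = n" by auto
  from hdb len_b n obtain vs where bv: "b = v # vs" by (cases b) auto
  from gram_schmidt_result[OF b dist_b indep refl, folded ws_def]
  have ws: "set ws \<subseteq> carrier_vec n" "corthogonal ws" "length ws = n"
    by (auto simp: len_b)
  have "hd ws = v"
    using gram_schmidt_hd[OF v(1), of vs, folded bv] unfolding ws_def .
  then have ws0: "ws ! 0 = v" using ws(3) n hd_conv_nth[of ws] by auto
  have wsc: "ws ! i \<in> carrier_vec n" if "i < n" for i
    using ws that by auto
  define N where "N j = (\<Sum>r<n. (cmod (ws ! j $ r))\<^sup>2)" for j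
  have inner: "ws ! i \<bullet>c ws ! j = (\<Sum>r<n. ws ! i $ r * cnj (ws ! j $ r))" if "i < n" "j < n" for i j
    using wsc[OF that(1)] wsc[OF that(2)] by (auto simp: scalar_prod_def atLeast0LessThan)
  have N: "of_real (N j) = (\<Sum>r<n. ws ! j $ r * cnj (ws ! j $ r))" for j
    unfolding N_def of_real_sum by (intro sum.cong refl complex_norm_square)
  have N0: "N j > 0" if "j < n" for j
  proof -
    have "of_real (N j) \<noteq> (0 :: complex)"
      using corthogonalD[OF ws(2), of j j] that ws(3) inner[OF that that] N[of j] by auto
    moreover have "N j \<ge> 0" unfolding N_def by (intro sum_nonneg) auto
    ultimately show ?thesis by auto
  qed
  define w where "w j r = of_real (1 / sqrt (N j)) * ws ! j $ r" for j r
  have "orthonormal n w"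
    unfolding orthonormal_def
  proof (intro allI impI)
    fix j k assume jk: "j < n" "k < n"
    have "(\<Sum>r<n. w j r * cnj (w k r))
        = of_real (1 / (sqrt (N j) * sqrt (N k))) * (\<Sum>r<n. ws ! j $ r * cnj (ws ! k $ r))"
      by (simp add: w_def sum_distrib_left mult_ac)
    also have "\<dots> = (if j = k then 1 else 0)"
    proof (cases "j = k")
      case True
      then show ?thesis using N0[OF jk(1)] N[of j, symmetric] by simp
    next
      case False
      then show ?thesis using corthogonalD[OF ws(2), of j k] jk ws(3) inner[OF jk] by auto
    qed
    finally show "(\<Sum>r<n. w j r * cnj (w k r)) = (if j = k then 1 else 0)" .
  qed
  moreover have "\<forall>r<n. w 0 r = of_real (1 / sqrt (N 0)) * v $ r"
    by (simp add: w_def ws0)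
  ultimately show ?thesis by blast
qed

lemma exists_eigenvector:
  fixes A :: "complex mat"
  assumes A: "A \<in> carrier_mat n n" and n: "n \<noteq> 0"
  obtains v e where "v \<in> carrier_vec n" "v \<noteq> 0\<^sub>v n" "A *\<^sub>v v = e \<cdot>\<^sub>v v"
proof -
  from char_poly_factorized[OF A] obtain es
    where es: "char_poly A = (\<Prod>a\<leftarrow>es. [:- a, 1:])" "length es = n" by blast
  then obtain e es' where "es = e # es'" using n by (cases es) auto
  then have "poly (char_poly A) e = 0" using es by simp
  then have "eigenvalue A e" using eigenvalue_root_char_poly[OF A] by simp
  then show thesis
    using A that unfolding eigenvalue_def eigenvector_def by auto
qed

text \<open>Deflation. In the basis \<open>w\<close>, whose first vector is an eigenvector, the
  matrix becomes \<open>B\<close>, and Hermiticity clears the first row along with the first column.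
  The remaining block is diagonalised by \<open>u'\<close>, and \<open>u\<close> carries its
  eigenvectors back to the original coordinates.\<close>

lemma spectral_step:
  fixes a :: "nat \<Rightarrow> nat \<Rightarrow> complex" and n :: nat
  defines "m \<equiv> Suc n"
  assumes w: "orthonormal m w"
    and ev: "\<And>r. r < m \<Longrightarrow> (\<Sum>s<m. a r s * w 0 s) = e * w 0 r"
    and herm: "\<And>r s. r < m \<Longrightarrow> s < m \<Longrightarrow> a r s = cnj (a s r)"
    and B_def: "\<And>j k. B j k = (\<Sum>r<m. \<Sum>s<m. cnj (w j r) * a r s * w k s)"
    and u': "orthonormal n u'"
    and spec': "\<And>j k. j < n \<Longrightarrow> k < n \<Longrightarrow>
      B (Suc j) (Suc k) = (\<Sum>i<n. of_real (l' i) * u' i j * cnj (u' i k))"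
  defines "u \<equiv> \<lambda>i r. case i of 0 \<Rightarrow> w 0 r | Suc i' \<Rightarrow> \<Sum>j<n. u' i' j * w (Suc j) r"
  defines "l \<equiv> \<lambda>i. case i of 0 \<Rightarrow> Re e | Suc i' \<Rightarrow> l' i'"
  shows "orthonormal m u"
    and "\<And>r s. r < m \<Longrightarrow> s < m \<Longrightarrow> a r s = (\<Sum>i<m. of_real (l i) * u i r * cnj (u i s))"
proof -
  have worth: "(\<Sum>r<m. w j r * cnj (w k r)) = (if j = k then 1 else 0)" if "j < m" "k < m" for j k
    using w that by (simp add: orthonormal_def)
  have Bherm: "B j k = cnj (B k j)" for j k
  proof -
    have "cnj (B k j) = (\<Sum>r<m. \<Sum>s<m. w k r * a s r * cnj (w j s))"
      unfolding B_def cnj_sum complex_cnj_mult complex_cnj_cnj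
      by (intro sum.cong refl) (simp add: herm[symmetric])
    also have "\<dots> = (\<Sum>s<m. \<Sum>r<m. w k r * a s r * cnj (w j s))"
      by (rule sum.swap)
    also have "\<dots> = B j k"
      unfolding B_def by (intro sum.cong refl) (simp only: mult_ac)
    finally show ?thesis by (rule sym)
  qed
  have m0: "0 < m" and mS: "Suc j < m" if "j < n" for j
    using that by (auto simp: m_def)
  have Bj0: "B j 0 = (if j = 0 then e else 0)" if "j < m" for j
  proof -
    have "B j 0 = (\<Sum>r<m. cnj (w j r) * (\<Sum>s<m. a r s * w 0 s))"
      unfolding B_def by (simp add: sum_distrib_left mult.assoc)
    also have "\<dots> = (\<Sum>r<m. e * (w 0 r * cnj (w j r)))"
      by (intro sum.cong refl) (simp add: ev mult_ac)
    also have "\<dots> = e * (\<Sum>r<m. w 0 r * cnj (w j r))"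
      by (simp add: sum_distrib_left)
    finally show ?thesis using worth[of 0 j] that by (simp add: m_def)
  qed
  \<comment> \<open>\<open>B 0 0\<close> is \<open>e\<close> and equals its own conjugate, so
    \<open>Re e\<close> can stand for \<open>e\<close> in \<open>l\<close>.\<close>
  have e_real: "of_real (Re e) = e"
    using Bherm[of 0 0] Bj0[of 0] by (simp add: m_def complex_eq_iff)
  have B0j: "B 0 j = (if j = 0 then e else 0)" if "j < m" for j
    using Bherm[of 0 j] Bj0[OF that] e_real by (auto simp: complex_eq_iff)
  \<comment> \<open>Change of basis back: the completeness relation of \<open>w\<close>, used on
    both sides of \<open>a\<close>, collapses the fourfold sum.\<close>
  have a_B: "a r s = (\<Sum>j<m. \<Sum>k<m. w j r * B j k * cnj (w k s))" if "r < m" "s < m" for r s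
  proof -
    have "(\<Sum>j<m. \<Sum>k<m. w j r * B j k * cnj (w k s))
        = (\<Sum>j<m. \<Sum>k<m. \<Sum>p<m. \<Sum>q<m. (w j r * cnj (w j p)) * (a p q * (w k q * cnj (w k s))))"
      by (simp add: B_def sum_distrib_left sum_distrib_right mult_ac)
    also have "\<dots> = (\<Sum>p<m. \<Sum>q<m. \<Sum>j<m. \<Sum>k<m. (w j r * cnj (w j p)) * (a p q * (w k q * cnj (w k s))))"
      by (subst sum_rotate, rule sum_rotate)
    also have "\<dots> = (\<Sum>p<m. \<Sum>q<m. (\<Sum>j<m. w j r * cnj (w j p)) * (a p q * (\<Sum>k<m. w k q * cnj (w k s))))"
      by (simp only: sum_distrib_left[symmetric] sum_distrib_right[symmetric])
    also have "\<dots> = (\<Sum>p<m. \<Sum>q<m. (if r = p then 1 else 0) * (a p q * (if q = s then 1 else 0)))"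
      using that by (intro sum.cong refl) (simp add: orthonormal_complete[OF w])
    also have "\<dots> = a r s"
      using that by (simp add: if_distrib[of "\<lambda>x. x * _"] if_distrib[of "\<lambda>x. _ * x"] sum.delta cong: if_cong)
    finally show ?thesis by simp
  qed
  show "orthonormal m u"
    unfolding orthonormal_def
  proof (intro allI impI)
    fix i k assume ik: "i < m" "k < m"
    have z: "(\<Sum>r<m. w 0 r * cnj (u (Suc i') r)) = 0" for i'
    proof -
      have "(\<Sum>r<m. w 0 r * cnj (u (Suc i') r))
          = (\<Sum>r<m. \<Sum>j<n. cnj (u' i' j) * (w 0 r * cnj (w (Suc j) r)))"
        by (simp add: u_def sum_distrib_left mult_ac)
      also have "\<dots> = (\<Sum>j<n. cnj (u' i' j) * (\<Sum>r<m. w 0 r * cnj (w (Suc j) r)))"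
        by (subst sum.swap) (simp add: sum_distrib_left)
      also have "\<dots> = 0" by (intro sum.neutral) (auto simp: worth mS m0)
      finally show ?thesis .
    qed
    have z': "(\<Sum>r<m. u (Suc i') r * cnj (w 0 r)) = 0" for i'
      using arg_cong[OF z[of i'], of cnj] by (simp add: mult.commute)
    have ss: "(\<Sum>r<m. u (Suc i') r * cnj (u (Suc k') r)) = (if i' = k' then 1 else 0)"
      if "i' < n" "k' < n" for i' k'
    proof -
      have "(\<Sum>r<m. u (Suc i') r * cnj (u (Suc k') r))
          = (\<Sum>r<m. \<Sum>j<n. \<Sum>p<n. u' i' j * cnj (u' k' p) * (w (Suc j) r * cnj (w (Suc p) r)))"
        by (simp add: u_def sum_product mult_ac)
      also have "\<dots> = (\<Sum>j<n. \<Sum>p<n. \<Sum>r<m. u' i' j * cnj (u' k' p) * (w (Suc j) r * cnj (w (Suc p) r)))"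
        by (rule sum_rotate)
      also have "\<dots> = (\<Sum>j<n. \<Sum>p<n. u' i' j * cnj (u' k' p) * (if j = p then 1 else 0))"
        by (simp only: sum_distrib_left[symmetric], intro sum.cong refl) (simp add: worth mS)
      also have "\<dots> = (\<Sum>j<n. u' i' j * cnj (u' k' j))"
        by (simp add: if_distrib[of "\<lambda>x. _ * x"] sum.delta cong: if_cong)
      also have "\<dots> = (if i' = k' then 1 else 0)"
        using u' that by (simp add: orthonormal_def)
      finally show ?thesis .
    qed
    have u0: "u 0 = w 0" by (simp add: u_def fun_eq_iff)
    show "(\<Sum>r<m. u i r * cnj (u k r)) = (if i = k then 1 else 0)"
    proof (cases i)
      case 0
      then show ?thesis using z[of "k - 1"] worth[of 0 0] by (cases k) (auto simp: u0 m_def)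
    next
      case (Suc i')
      then show ?thesis using z'[of i'] ss ik by (cases k) (auto simp: u0 m_def)
    qed
  qed
  fix r s assume rs: "r < m" "s < m"
  have "a r s = (\<Sum>j<m. \<Sum>k<m. w j r * B j k * cnj (w k s))"
    by (rule a_B[OF rs])
  also have "\<dots> = w 0 r * e * cnj (w 0 s)
      + (\<Sum>j<n. \<Sum>k<n. w (Suc j) r * B (Suc j) (Suc k) * cnj (w (Suc k) s))"
    by (simp add: m_def sum.lessThan_Suc_shift Bj0 B0j del: sum.lessThan_Suc)
  also have "(\<Sum>j<n. \<Sum>k<n. w (Suc j) r * B (Suc j) (Suc k) * cnj (w (Suc k) s))
      = (\<Sum>j<n. \<Sum>k<n. \<Sum>i<n. of_real (l' i) * ((u' i j * w (Suc j) r) * cnj (u' i k * w (Suc k) s)))"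
    by (intro sum.cong refl) (simp add: spec' sum_distrib_left sum_distrib_right mult_ac)
  also have "\<dots> = (\<Sum>i<n. \<Sum>j<n. \<Sum>k<n. of_real (l' i) * ((u' i j * w (Suc j) r) * cnj (u' i k * w (Suc k) s)))"
    by (rule sum_rotate[symmetric])
  also have "\<dots> = (\<Sum>i<n. of_real (l' i) * (u (Suc i) r * cnj (u (Suc i) s)))"
    by (simp add: u_def sum_product_scaled)
  finally show "a r s = (\<Sum>i<m. of_real (l i) * u i r * cnj (u i s))"
    by (simp add: m_def sum.lessThan_Suc_shift u_def l_def e_real mult_ac del: sum.lessThan_Suc)
qed

lemma hermitian_spectral_aux:
  assumes "\<And>r s. r < n \<Longrightarrow> s < n \<Longrightarrow> a r s = cnj (a s r)"
  shows "\<exists>(l :: nat \<Rightarrow> real) u. orthonormal n u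
    \<and> (\<forall>r<n. \<forall>s<n. a r s = (\<Sum>i<n. of_real (l i) * u i r * cnj (u i s)))"
  using assms
proof (induction n arbitrary: a)
  case 0
  then show ?case by (simp add: orthonormal_def)
next
  case (Suc n)
  define A where "A = mat (Suc n) (Suc n) (\<lambda>(r, s). a r s)"
  have A: "A \<in> carrier_mat (Suc n) (Suc n)" by (simp add: A_def)
  obtain v e where v: "v \<in> carrier_vec (Suc n)" "v \<noteq> 0\<^sub>v (Suc n)" "A *\<^sub>v v = e \<cdot>\<^sub>v v"
    using exists_eigenvector[OF A] by auto
  obtain w c where w: "orthonormal (Suc n) w" and w0: "\<forall>r<Suc n. w 0 r = c * v $ r"
    using extend_orthonormal[OF v(1,2)] by blast
  have ev: "(\<Sum>s<Suc n. a r s * w 0 s) = e * w 0 r" if r: "r < Suc n" for r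
  proof -
    have "(A *\<^sub>v v) $ r = (e \<cdot>\<^sub>v v) $ r" using v(3) by simp
    then have "(\<Sum>s<Suc n. a r s * v $ s) = e * v $ r"
      using r v(1) by (simp add: A_def scalar_prod_def atLeast0LessThan del: sum.lessThan_Suc)
    then have "c * (\<Sum>s<Suc n. a r s * v $ s) = c * (e * v $ r)" by simp
    then show ?thesis
      using r by (simp add: w0 sum_distrib_left mult_ac del: sum.lessThan_Suc)
  qed
  define B where "B j k = (\<Sum>r<Suc n. \<Sum>s<Suc n. cnj (w j r) * a r s * w k s)" for j k
  have "B j k = cnj (B k j)" for j k
  proof -
    have "cnj (B k j) = (\<Sum>r<Suc n. \<Sum>s<Suc n. w k r * a s r * cnj (w j s))"
      unfolding B_def cnj_sum complex_cnj_mult complex_cnj_cnj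
      by (intro sum.cong refl) (simp add: Suc.prems[symmetric])
    also have "\<dots> = (\<Sum>s<Suc n. \<Sum>r<Suc n. w k r * a s r * cnj (w j s))"
      by (rule sum.swap)
    also have "\<dots> = B j k"
      unfolding B_def by (intro sum.cong refl) (simp only: mult_ac)
    finally show ?thesis by (rule sym)
  qed
  from Suc.IH[of "\<lambda>j k. B (Suc j) (Suc k)", OF this] obtain l' :: "nat \<Rightarrow> real" and u'
    where u': "orthonormal n u'"
      and spec': "\<forall>j<n. \<forall>k<n. B (Suc j) (Suc k) = (\<Sum>i<n. of_real (l' i) * u' i j * cnj (u' i k))"
    by blast
  show ?case
    using spectral_step[OF w ev Suc.prems B_def u'] spec' by blast
qed

lemma hermitian_spectral:
  assumes "hermitian d A"
  shows "\<exists>(l :: nat \<Rightarrow> real) u. orthonormal d u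
    \<and> (\<forall>r<d. \<forall>s<d. A $$ (r, s) = (\<Sum>i<d. of_real (l i) * u i r * cnj (u i s)))"
  using hermitian_spectral_aux[of d "\<lambda>r s. A $$ (r, s)"] assms unfolding hermitian_iff by blast

lemma quad_eigenvector:
  fixes l :: "nat \<Rightarrow> real"
  assumes u: "orthonormal d u"
    and A: "\<And>r s. r < d \<Longrightarrow> s < d \<Longrightarrow> A $$ (r, s) = (\<Sum>i<d. of_real (l i) * u i r * cnj (u i s))"
    and j: "j < d"
  shows "quad d A (u j) = of_real (l j)"
proof -
  have "quad d A (u j)
      = (\<Sum>r<d. \<Sum>s<d. \<Sum>i<d. of_real (l i) * ((u i r * cnj (u j r)) * (u j s * cnj (u i s))))"
    by (auto simp: quad_def A sum_distrib_left sum_distrib_right mult_ac intro!: sum.cong)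
  also have "\<dots> = (\<Sum>i<d. \<Sum>r<d. \<Sum>s<d. of_real (l i) * ((u i r * cnj (u j r)) * (u j s * cnj (u i s))))"
    by (rule sum_rotate[symmetric])
  also have "\<dots> = (\<Sum>i<d. of_real (l i) * ((\<Sum>r<d. u i r * cnj (u j r)) * (\<Sum>s<d. u j s * cnj (u i s))))"
    by (simp only: sum_product_scaled)
  also have "\<dots> = (\<Sum>i<d. if i = j then of_real (l i) else 0)"
    using u j by (intro sum.cong refl) (auto simp: orthonormal_def)
  finally show ?thesis using j by simp
qed

lemma psd_quad: "psd d A \<Longrightarrow> 0 \<le> quad d A x"
  by (simp add: psd_iff_quad)

text \<open>Each eigenvector is scaled by the root of its eigenvalue. The eigenvalue is nonnegative
  because it is the value of the quadratic form at its own eigenvector.\<close>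

lemma psd_gram:
  assumes "psd d A"
  obtains w where "\<And>r s. r < d \<Longrightarrow> s < d \<Longrightarrow> A $$ (r, s) = (\<Sum>i<d. w i r * cnj (w i s))"
proof -
  from assms have "hermitian d A" by (simp add: psd_iff_quad)
  from hermitian_spectral[OF this] obtain l :: "nat \<Rightarrow> real" and u where u: "orthonormal d u"
    and A': "\<forall>r<d. \<forall>s<d. A $$ (r, s) = (\<Sum>i<d. of_real (l i) * u i r * cnj (u i s))"
    by blast
  have A: "A $$ (r, s) = (\<Sum>i<d. of_real (l i) * u i r * cnj (u i s))" if "r < d" "s < d" for r s
    using A' that by blast
  have l: "l i \<ge> 0" if "i < d" for i
  proof -
    have "0 \<le> complex_of_real (l i)"
      using psd_quad[OF assms, of "u i"] quad_eigenvector[OF u A that] by simp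
    then show ?thesis by (simp add: less_eq_complex_def)
  qed
  have "A $$ (r, s) = (\<Sum>i<d. (of_real (sqrt (l i)) * u i r) * cnj (of_real (sqrt (l i)) * u i s))"
    if "r < d" "s < d" for r s
    unfolding A[OF that]
  proof (intro sum.cong refl)
    fix i assume "i \<in> {..<d}"
    then have "(of_real (sqrt (l i)) * of_real (sqrt (l i)) :: complex) = of_real (l i)"
      using l[of i] by (simp flip: of_real_mult)
    then show "of_real (l i) * u i r * cnj (u i s)
        = (of_real (sqrt (l i)) * u i r) * cnj (of_real (sqrt (l i)) * u i s)"
      by (simp add: mult_ac)
  qed
  then show thesis by (rule that)
qed

text \<open>A Gram representation of \<open>A\<close> turns the pairing into a sum of values of the
  quadratic form of \<open>B\<close>. The Gram vectors enter conjugated because the pairing is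
  Tr(A^T B).\<close>

lemma psd_pairing_nonneg:
  assumes "psd d A" "psd d B"
  shows "0 \<le> (\<Sum>r<d. \<Sum>s<d. A $$ (r, s) * B $$ (r, s))"
proof -
  obtain w where w: "\<And>r s. r < d \<Longrightarrow> s < d \<Longrightarrow> A $$ (r, s) = (\<Sum>i<d. w i r * cnj (w i s))"
    using psd_gram[OF assms(1)] by blast
  have "(\<Sum>r<d. \<Sum>s<d. A $$ (r, s) * B $$ (r, s)) = (\<Sum>r<d. \<Sum>s<d. \<Sum>i<d. w i r * B $$ (r, s) * cnj (w i s))"
    by (intro sum.cong refl) (simp add: w sum_distrib_left mult_ac)
  also have "\<dots> = (\<Sum>i<d. \<Sum>r<d. \<Sum>s<d. w i r * B $$ (r, s) * cnj (w i s))"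
    by (rule sum_rotate[symmetric])
  also have "\<dots> = (\<Sum>i<d. quad d B (\<lambda>r. cnj (w i r)))"
    by (simp add: quad_def)
  also have "0 \<le> \<dots>"
    using assms(2) by (intro sum_nonneg) (simp add: psd_iff_quad)
  finally show ?thesis .
qed

lemma quad_spectral:
  fixes l :: "nat \<Rightarrow> real"
  assumes A: "\<And>r s. r < d \<Longrightarrow> s < d \<Longrightarrow> A $$ (r, s) = (\<Sum>i<d. of_real (l i) * u i r * cnj (u i s))"
  shows "quad d A x = of_real (\<Sum>i<d. l i * (cmod (\<Sum>r<d. cnj (x r) * u i r))\<^sup>2)"
proof -
  have "quad d A x
      = (\<Sum>r<d. \<Sum>s<d. \<Sum>i<d. of_real (l i) * ((cnj (x r) * u i r) * cnj (cnj (x s) * u i s)))"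
    by (auto simp: quad_def A sum_distrib_left sum_distrib_right mult_ac intro!: sum.cong)
  also have "\<dots> = (\<Sum>i<d. \<Sum>r<d. \<Sum>s<d. of_real (l i) * ((cnj (x r) * u i r) * cnj (cnj (x s) * u i s)))"
    by (rule sum_rotate[symmetric])
  also have "\<dots> = (\<Sum>i<d. of_real (l i) * ((\<Sum>r<d. cnj (x r) * u i r) * cnj (\<Sum>r<d. cnj (x r) * u i r)))"
    by (simp only: sum_product_scaled cnj_sum)
  also have "\<dots> = of_real (\<Sum>i<d. l i * (cmod (\<Sum>r<d. cnj (x r) * u i r))\<^sup>2)"
    unfolding of_real_sum of_real_mult by (intro sum.cong refl) (simp only: complex_norm_square)
  finally show ?thesis .
qed

section \<open>Entropy\<close>

text \<open>The order of \<open>x\<close> as a root counts the \<open>i\<close> with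
  \<open>l i = x\<close>, so exchanging two sums replaces the sum over distinct eigenvalues by one
  over \<open>i\<close>.\<close>

lemma vn_entropy_factored:
  fixes l :: "nat \<Rightarrow> real"
  assumes A: "A \<in> carrier_mat d d"
    and cp: "char_poly A = (\<Prod>i<d. [:- complex_of_real (l i), 1:])"
  shows "vn_entropy A = - (\<Sum>i<d. l i * log 2 (l i))"
proof -
  let ?f = "\<lambda>i. complex_of_real (l i)"
  have ord: "order x (\<Prod>i<n. [:- ?f i, 1:]) = (\<Sum>i<n. if ?f i = x then 1 else 0)" for x n
  proof (induction n)
    case (Suc n)
    have "(\<Prod>i<n. [:- ?f i, 1:]) * [:- ?f n, 1:] \<noteq> 0"
      by (intro no_zero_divisors) auto
    then show ?case
      unfolding prod.lessThan_Suc sum.lessThan_Suc using Suc by (subst order_mult) (auto simp: order_linear')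
  qed simp
  have ev: "{x. eigenvalue A x} = ?f ` {..<d}"
    by (auto simp: eigenvalue_root_char_poly[OF A] cp poly_prod)
  have "(\<Sum>x\<in>?f ` {..<d}. real (order x (char_poly A)) * (Re x * log 2 (Re x)))
      = (\<Sum>x\<in>?f ` {..<d}. \<Sum>i<d. if ?f i = x then l i * log 2 (l i) else 0)"
    unfolding cp ord of_nat_sum sum_distrib_right by (intro sum.cong refl) auto
  also have "\<dots> = (\<Sum>i<d. \<Sum>x\<in>?f ` {..<d}. if ?f i = x then l i * log 2 (l i) else 0)"
    by (rule sum.swap)
  also have "\<dots> = (\<Sum>i<d. l i * log 2 (l i))"
    by (intro sum.cong refl) simp
  finally show ?thesis by (simp add: vn_entropy_def ev)
qed

text \<open>The eigenvectors form the columns of \<open>P\<close>, and \<open>A = P * D * Q\<close>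
  with \<open>Q\<close> inverse to \<open>P\<close>. Similarity preserves the characteristic
  polynomial, which for the diagonal \<open>D\<close> is already factored.\<close>

lemma vn_entropy_spectral:
  fixes l :: "nat \<Rightarrow> real"
  assumes Ac: "A \<in> carrier_mat d d" and u: "orthonormal d u"
    and A: "\<And>r s. r < d \<Longrightarrow> s < d \<Longrightarrow> A $$ (r, s) = (\<Sum>i<d. of_real (l i) * u i r * cnj (u i s))"
  shows "vn_entropy A = - (\<Sum>i<d. l i * log 2 (l i))"
proof (rule vn_entropy_factored[OF Ac])
  define P where "P = mat d d (\<lambda>(r, i). u i r)"
  define Q where "Q = mat d d (\<lambda>(i, s). cnj (u i s))"
  define D where "D = mat d d (\<lambda>(i, j). if i = j then complex_of_real (l i) else 0)"
  have dims: "P \<in> carrier_mat d d" "Q \<in> carrier_mat d d" "D \<in> carrier_mat d d"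
    by (auto simp: P_def Q_def D_def)
  have PQ: "P * Q = 1\<^sub>m d"
    by (intro eq_matI)
      (auto simp: P_def Q_def scalar_prod_def atLeast0LessThan orthonormal_complete[OF u])
  then have QP: "Q * P = 1\<^sub>m d"
    by (intro mat_mult_left_right_inverse[of P d Q]) (auto simp: dims)
  have "A = P * D * Q"
  proof (rule eq_matI)
    fix r s assume "r < dim_row (P * D * Q)" "s < dim_col (P * D * Q)"
    then have rs: "r < d" "s < d" using dims by auto
    have PD: "(P * D) $$ (r, i) = u i r * of_real (l i)" if "i < d" for i
      using rs that
      by (auto simp: P_def D_def scalar_prod_def atLeast0LessThan if_distrib[of "\<lambda>x. _ * x"] sum.delta cong: if_cong)
    have "(M * Q) $$ (r, s) = (\<Sum>i<d. M $$ (r, i) * Q $$ (i, s))" if "M \<in> carrier_mat d d" for M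
      using rs dims that by (simp add: scalar_prod_def atLeast0LessThan)
    from this[of "P * D"]
    have "(P * D * Q) $$ (r, s) = (\<Sum>i<d. (P * D) $$ (r, i) * Q $$ (i, s))"
      using dims by simp
    also have "\<dots> = (\<Sum>i<d. of_real (l i) * u i r * cnj (u i s))"
      using rs by (intro sum.cong refl) (simp add: PD Q_def mult_ac)
    finally show "A $$ (r, s) = (P * D * Q) $$ (r, s)" using A[OF rs] by simp
  qed (use dims Ac in auto)
  then have "similar_mat A D"
    using PQ QP dims Ac by (intro similar_matI[of _ _ P Q d]) auto
  then have "char_poly A = char_poly D" by (rule char_poly_similar)
  also have "\<dots> = (\<Prod>a\<leftarrow>diag_mat D. [:- a, 1:])"
    by (rule char_poly_upper_triangular[OF dims(3)]) (auto simp: D_def)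
  also have "\<dots> = (\<Prod>i<d. [:- complex_of_real (l i), 1:])"
    by (auto simp: prod.list_conv_set_nth diag_mat_def D_def atLeast0LessThan intro!: prod.cong)
  finally show "char_poly A = (\<Prod>i<d. [:- complex_of_real (l i), 1:])" .
qed

lemma vn_entropy_diag:
  fixes l :: "nat \<Rightarrow> real"
  assumes "A \<in> carrier_mat d d"
    and "\<And>r s. r < d \<Longrightarrow> s < d \<Longrightarrow> A $$ (r, s) = (if r = s then of_real (l r) else 0)"
  shows "vn_entropy A = - (\<Sum>i<d. l i * log 2 (l i))"
proof (rule vn_entropy_spectral[OF assms(1)])
  show "orthonormal d (\<lambda>i r. if i = r then 1 else 0)"
    by (auto simp: orthonormal_def if_distrib[of "\<lambda>x. _ * x"] if_distrib[of cnj] sum.delta cong: if_cong)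
  fix r s assume "r < d" "s < d"
  then show "A $$ (r, s) = (\<Sum>i<d. of_real (l i) * (if i = r then 1 else 0) * cnj (if i = s then 1 else 0))"
    by (auto simp: assms(2) if_distrib[of "\<lambda>x. _ * x"] if_distrib[of cnj] sum.delta cong: if_cong)
qed

text \<open>The squared moduli form a doubly stochastic matrix, the transition probabilities between
  the eigenbasis and the standard basis. Both entropy comparisons below are weighted by
  them.\<close>

lemma orthonormal_weights:
  assumes "orthonormal d u"
  shows "j < d \<Longrightarrow> (\<Sum>i<d. (cmod (u j i))\<^sup>2) = 1"
    and "i < d \<Longrightarrow> (\<Sum>j<d. (cmod (u j i))\<^sup>2) = 1"
proof -
  have sq: "(\<Sum>k\<in>I. f k * cnj (f k)) = of_real (\<Sum>k\<in>I. (cmod (f k))\<^sup>2)" for I :: "nat set" and f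
    unfolding of_real_sum by (intro sum.cong refl) (simp only: complex_norm_square)
  show "(\<Sum>i<d. (cmod (u j i))\<^sup>2) = 1" if "j < d"
    using assms that sq[of "u j" "{..<d}"] unfolding orthonormal_def by (metis of_real_eq_1_iff)
  show "(\<Sum>j<d. (cmod (u j i))\<^sup>2) = 1" if "i < d"
    using orthonormal_complete[OF assms that that] sq[of "\<lambda>j. u j i" "{..<d}"] by (metis of_real_eq_1_iff)
qed

lemma density_spectral:
  assumes "density d \<rho>"
  obtains l :: "nat \<Rightarrow> real" and u where "orthonormal d u"
    and "\<forall>r<d. \<forall>s<d. \<rho> $$ (r, s) = (\<Sum>i<d. of_real (l i) * u i r * cnj (u i s))"
    and "\<forall>i<d. 0 \<le> l i" and "(\<Sum>i<d. l i) = 1"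
    and "\<forall>r<d. Re (\<rho> $$ (r, r)) = (\<Sum>j<d. l j * (cmod (u j r))\<^sup>2)"
    and "vn_entropy \<rho> = - (\<Sum>i<d. l i * log 2 (l i))"
proof -
  from assms have psd: "psd d \<rho>" and tr1: "tr \<rho> = 1" by (auto simp: density_def)
  from psd have "hermitian d \<rho>" by (simp add: psd_iff_quad)
  from hermitian_spectral[OF this] obtain l :: "nat \<Rightarrow> real" and u where u: "orthonormal d u"
    and A': "\<forall>r<d. \<forall>s<d. \<rho> $$ (r, s) = (\<Sum>i<d. of_real (l i) * u i r * cnj (u i s))"
    by blast
  have A: "\<rho> $$ (r, s) = (\<Sum>i<d. of_real (l i) * u i r * cnj (u i s))" if "r < d" "s < d" for r s
    using A' that by blast
  have l: "0 \<le> l i" if "i < d" for i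
    using psd_quad[OF psd, of "u i"] quad_eigenvector[OF u A that] by (simp add: less_eq_complex_def)
  have diag: "\<rho> $$ (r, r) = of_real (\<Sum>j<d. l j * (cmod (u j r))\<^sup>2)" if "r < d" for r
    unfolding A[OF that that] of_real_sum of_real_mult complex_norm_square by (simp only: mult.assoc)
  have "tr \<rho> = of_real (\<Sum>r<d. \<Sum>j<d. l j * (cmod (u j r))\<^sup>2)"
    using psd_carrier[OF psd] by (auto simp: tr_def diag)
  also have "(\<Sum>r<d. \<Sum>j<d. l j * (cmod (u j r))\<^sup>2) = (\<Sum>j<d. l j * (\<Sum>r<d. (cmod (u j r))\<^sup>2))"
    by (subst sum.swap) (simp add: sum_distrib_left)
  also have "\<dots> = (\<Sum>j<d. l j)"
    by (intro sum.cong refl) (simp add: orthonormal_weights(1)[OF u])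
  finally have "(\<Sum>j<d. l j) = 1" using tr1 by (metis of_real_eq_1_iff)
  moreover have "vn_entropy \<rho> = - (\<Sum>i<d. l i * log 2 (l i))"
    by (rule vn_entropy_spectral[OF psd_carrier[OF psd] u A])
  moreover have "\<forall>r<d. Re (\<rho> $$ (r, r)) = (\<Sum>j<d. l j * (cmod (u j r))\<^sup>2)"
    using diag by (metis Re_complex_of_real)
  moreover have "\<forall>i<d. 0 \<le> l i" using l by blast
  ultimately show thesis
    using that[of u l] u A' by blast
qed

text \<open>Klein's inequality against a diagonal matrix: \<open>ln x \<le> x - 1\<close> is applied
  to each pair of an eigenvalue \<open>l j\<close> and an entry \<open>\<sigma> i\<close>. Averaging
  with the doubly stochastic weights leaves the difference of the two traces, which is at most
  0.\<close>

lemma vn_entropy_le_cross_entropy: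
  assumes \<rho>: "density d \<rho>" and \<sigma>: "\<And>i. i < d \<Longrightarrow> 0 < \<sigma> i" "(\<Sum>i<d. \<sigma> i) \<le> 1"
  shows "vn_entropy \<rho> \<le> - (\<Sum>i<d. Re (\<rho> $$ (i, i)) * log 2 (\<sigma> i))"
proof -
  obtain l :: "nat \<Rightarrow> real" and u where u: "orthonormal d u"
    and l0: "\<forall>i<d. 0 \<le> l i" and l1: "(\<Sum>i<d. l i) = 1"
    and diag: "\<forall>r<d. Re (\<rho> $$ (r, r)) = (\<Sum>j<d. l j * (cmod (u j r))\<^sup>2)"
    and H: "vn_entropy \<rho> = - (\<Sum>i<d. l i * log 2 (l i))"
    by (rule density_spectral[OF \<rho>])
  define p where "p j i = (cmod (u j i))\<^sup>2" for j i
  have p: "\<And>j. j < d \<Longrightarrow> (\<Sum>i<d. p j i) = 1" "\<And>i. i < d \<Longrightarrow> (\<Sum>j<d. p j i) = 1" "\<And>j i. 0 \<le> p j i"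
    using orthonormal_weights[OF u] by (simp_all add: p_def)
  have pt: "l j * (ln (\<sigma> i) - ln (l j)) \<le> \<sigma> i - l j" if "j < d" "i < d" for i j
  proof (cases "l j = 0")
    case True
    then show ?thesis using \<sigma>(1)[OF that(2)] by simp
  next
    case False
    then have lj: "l j > 0" using l0 that by force
    have "ln (\<sigma> i) - ln (l j) = ln (\<sigma> i / l j)"
      using lj \<sigma>(1)[OF that(2)] by (simp add: ln_div)
    also have "\<dots> \<le> \<sigma> i / l j - 1"
      using lj \<sigma>(1)[OF that(2)] by (intro ln_le_minus_one) simp
    finally show ?thesis using lj by (simp add: field_simps)
  qed
  have "(\<Sum>i<d. Re (\<rho> $$ (i, i)) * ln (\<sigma> i)) - (\<Sum>j<d. l j * ln (l j))
      = (\<Sum>j<d. \<Sum>i<d. p j i * (l j * (ln (\<sigma> i) - ln (l j))))"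
  proof -
    have "(\<Sum>i<d. Re (\<rho> $$ (i, i)) * ln (\<sigma> i)) = (\<Sum>i<d. \<Sum>j<d. p j i * (l j * ln (\<sigma> i)))"
      using diag by (intro sum.cong refl) (simp add: p_def sum_distrib_left mult_ac)
    also have "\<dots> = (\<Sum>j<d. \<Sum>i<d. p j i * (l j * ln (\<sigma> i)))"
      by (rule sum.swap)
    moreover have "(\<Sum>j<d. l j * ln (l j)) = (\<Sum>j<d. \<Sum>i<d. p j i * (l j * ln (l j)))"
      by (intro sum.cong refl) (simp add: p(1) flip: sum_distrib_right)
    ultimately show ?thesis
      by (simp add: right_diff_distrib sum_subtractf)
  qed
  also have "\<dots> \<le> (\<Sum>j<d. \<Sum>i<d. p j i * (\<sigma> i - l j))"
    by (intro sum_mono mult_left_mono pt p(3)) auto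
  also have "\<dots> = (\<Sum>j<d. \<Sum>i<d. p j i * \<sigma> i) - (\<Sum>j<d. \<Sum>i<d. p j i * l j)"
    by (simp add: right_diff_distrib sum_subtractf)
  also have "(\<Sum>j<d. \<Sum>i<d. p j i * \<sigma> i) = (\<Sum>i<d. \<sigma> i)"
    by (subst sum.swap, intro sum.cong refl) (simp add: p(2) flip: sum_distrib_right)
  also have "(\<Sum>j<d. \<Sum>i<d. p j i * l j) = (\<Sum>j<d. l j)"
    by (intro sum.cong refl) (simp add: p(1) flip: sum_distrib_right)
  finally have "(\<Sum>i<d. Re (\<rho> $$ (i, i)) * ln (\<sigma> i)) \<le> (\<Sum>j<d. l j * ln (l j))"
    using l1 \<sigma>(2) by simp
  then have "(\<Sum>i<d. Re (\<rho> $$ (i, i)) * ln (\<sigma> i)) / ln 2 \<le> (\<Sum>j<d. l j * ln (l j)) / ln 2"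
    by (simp add: divide_right_mono)
  then show ?thesis unfolding H by (simp add: log_def sum_divide_distrib)
qed

text \<open>
  Testing \<open>\<rho> \<le> diag s\<close> on \<open>x = (diag s)\<^sup>-\<^sup>1 u\<^sub>j\<close> for an eigenvector \<open>u\<^sub>j\<close> gives \<open>l\<^sub>j t \<le> 1\<close> with
  \<open>t = \<langle>u\<^sub>j, (diag s)\<^sup>-\<^sup>1 u\<^sub>j\<rangle>\<close>.
\<close>

lemma vn_entropy_ge_cross_entropy:
  assumes \<rho>: "density d \<rho>" and s: "\<And>i. i < d \<Longrightarrow> 0 < s i"
    and dom: "\<And>x. Re (quad d \<rho> x) \<le> (\<Sum>i<d. s i * (cmod (x i))\<^sup>2)"
  shows "- (\<Sum>i<d. Re (\<rho> $$ (i, i)) * log 2 (s i)) \<le> vn_entropy \<rho>"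
proof -
  obtain l :: "nat \<Rightarrow> real" and u where u: "orthonormal d u"
    and A': "\<forall>r<d. \<forall>s<d. \<rho> $$ (r, s) = (\<Sum>i<d. of_real (l i) * u i r * cnj (u i s))"
    and l0: "\<forall>i<d. 0 \<le> l i"
    and diag: "\<forall>r<d. Re (\<rho> $$ (r, r)) = (\<Sum>j<d. l j * (cmod (u j r))\<^sup>2)"
    and H: "vn_entropy \<rho> = - (\<Sum>i<d. l i * log 2 (l i))"
    by (rule density_spectral[OF \<rho>])
  have A: "\<rho> $$ (r, s) = (\<Sum>i<d. of_real (l i) * u i r * cnj (u i s))" if "r < d" "s < d" for r s
    using A' that by blast
  define p where "p j i = (cmod (u j i))\<^sup>2" for j i
  have p: "\<And>j. j < d \<Longrightarrow> (\<Sum>i<d. p j i) = 1" "\<And>j i. 0 \<le> p j i"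
    using orthonormal_weights[OF u] by (simp_all add: p_def)
  have main: "l j * ln (l j) \<le> l j * (\<Sum>i<d. p j i * ln (s i))" if j: "j < d" for j
  proof (cases "l j = 0")
    case False
    then have lj: "l j > 0" using l0 j by force
    define t where "t = (\<Sum>i<d. p j i / s i)"
    have t0: "t \<ge> 0"
      unfolding t_def by (intro sum_nonneg divide_nonneg_pos p(2) s) auto
    define x where "x i = u j i / of_real (s i)" for i
    have "(\<Sum>r<d. cnj (x r) * u j r) = of_real t"
      unfolding t_def of_real_sum
      by (intro sum.cong refl) (simp add: x_def p_def complex_norm_square mult.commute del: of_real_power)
    then have "l j * t\<^sup>2 = l j * (cmod (\<Sum>r<d. cnj (x r) * u j r))\<^sup>2" by simp
    also have "\<dots> \<le> (\<Sum>i<d. l i * (cmod (\<Sum>r<d. cnj (x r) * u i r))\<^sup>2)"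
      using j l0 by (intro member_le_sum[of j]) auto
    also have "\<dots> = Re (quad d \<rho> x)"
      by (subst quad_spectral[OF A]) auto
    also have "\<dots> \<le> (\<Sum>i<d. s i * (cmod (x i))\<^sup>2)" by (rule dom)
    also have "\<dots> = t"
      unfolding t_def
      using s by (intro sum.cong refl) (auto simp: x_def p_def norm_divide power_divide power2_eq_square)
    finally have "l j * t * t \<le> 1 * t" by (simp add: power2_eq_square)
    then have "l j * t \<le> 1"
      using t0 by (cases "t = 0") auto
    \<comment> \<open>Concavity of \<open>ln\<close> in tangent form, applied to each ratio
      \<open>l j / s i\<close> and averaged over \<open>i\<close>. The bound just shown makes the
      right-hand side nonpositive.\<close>
    moreover have "ln (l j) - (\<Sum>i<d. p j i * ln (s i)) \<le> l j * t - 1"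
    proof -
      have "ln (l j) - (\<Sum>i<d. p j i * ln (s i)) = (\<Sum>i<d. p j i * (ln (l j) - ln (s i)))"
        using p(1)[OF j] by (simp add: right_diff_distrib sum_subtractf flip: sum_distrib_right)
      also have "\<dots> \<le> (\<Sum>i<d. p j i * (l j / s i - 1))"
      proof (intro sum_mono mult_left_mono p(2))
        fix i assume "i \<in> {..<d}"
        then have "s i > 0" using s by auto
        then show "ln (l j) - ln (s i) \<le> l j / s i - 1"
          using ln_le_minus_one[of "l j / s i"] lj by (simp add: ln_div)
      qed
      also have "\<dots> = l j * t - 1"
        using p(1)[OF j] by (simp add: right_diff_distrib sum_subtractf t_def sum_distrib_left mult_ac)
      finally show ?thesis .
    qed
    ultimately show ?thesis using lj by (intro mult_left_mono) auto
  qed simp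
  have "(\<Sum>j<d. l j * ln (l j)) \<le> (\<Sum>j<d. l j * (\<Sum>i<d. p j i * ln (s i)))"
    by (intro sum_mono main) auto
  also have "\<dots> = (\<Sum>j<d. \<Sum>i<d. l j * p j i * ln (s i))"
    by (simp add: sum_distrib_left mult_ac)
  also have "\<dots> = (\<Sum>i<d. Re (\<rho> $$ (i, i)) * ln (s i))"
    using diag by (subst sum.swap, intro sum.cong refl) (simp add: p_def sum_distrib_right)
  finally have "(\<Sum>j<d. l j * ln (l j)) / ln 2 \<le> (\<Sum>i<d. Re (\<rho> $$ (i, i)) * ln (s i)) / ln 2"
    by (simp add: divide_right_mono)
  then show ?thesis unfolding H by (simp add: log_def sum_divide_distrib)
qed

section \<open>Tensor products\<close>

lemma quad_diff:
  assumes "A \<in> carrier_mat d d" "B \<in> carrier_mat d d"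
  shows "quad d (B - A) x = quad d B x - quad d A x"
  using assms by (simp add: quad_def algebra_simps sum_subtractf)

lemma loewner_le_quad:
  assumes "loewner_le d A B"
  shows "Re (quad d A x) \<le> Re (quad d B x)"
  using assms psd_quad[of d "B - A" x] by (simp add: loewner_le_def quad_diff less_eq_complex_def)

lemma psd_half_sum:
  assumes "psd d A" "psd d B" "C \<in> carrier_mat d d"
    and C: "\<And>r s. r < d \<Longrightarrow> s < d \<Longrightarrow> C $$ (r, s) = (A $$ (r, s) + B $$ (r, s)) / 2"
  shows "psd d C"
proof -
  have quad: "quad d C x = (quad d A x + quad d B x) / 2" for x
  proof -
    have "quad d C x = (\<Sum>r<d. \<Sum>s<d. (cnj (x r) * A $$ (r, s) * x s + cnj (x r) * B $$ (r, s) * x s) / 2)"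
      unfolding quad_def by (intro sum.cong refl) (simp add: C field_simps)
    also have "\<dots> = (quad d A x + quad d B x) / 2"
      unfolding quad_def sum_divide_distrib[symmetric] sum.distrib ..
    finally show ?thesis .
  qed
  have "0 \<le> quad d C x" for x
    using psd_quad[OF assms(1), of x] psd_quad[OF assms(2), of x]
    unfolding quad less_eq_complex_def by simp
  moreover have "C $$ (r, s) = cnj (C $$ (s, r))" if "r < d" "s < d" for r s
  proof -
    have "cnj (A $$ (s, r)) = A $$ (r, s)" "cnj (B $$ (s, r)) = B $$ (r, s)"
      using assms(1,2) that unfolding psd_iff_quad hermitian_iff by metis+
    then show ?thesis by (simp add: C that)
  qed
  ultimately show ?thesis
    using assms(3) unfolding psd_iff_quad hermitian_iff by blast
qed

text \<open>Gram vectors multiply: the products \<open>w i (f r) * v j (g r)\<close> represent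
  \<open>M\<close>. The free index maps let one lemma cover a tensor product with its factors in any
  order.\<close>

lemma psd_pullback_mult:
  assumes "psd d X" "psd e Y" "M \<in> carrier_mat n n"
    and "\<And>r. r < n \<Longrightarrow> f r < d" "\<And>r. r < n \<Longrightarrow> g r < e"
    and M: "\<And>r s. r < n \<Longrightarrow> s < n \<Longrightarrow> M $$ (r, s) = X $$ (f r, f s) * Y $$ (g r, g s)"
  shows "psd n M"
proof -
  obtain w where w: "\<And>r s. r < d \<Longrightarrow> s < d \<Longrightarrow> X $$ (r, s) = (\<Sum>i<d. w i r * cnj (w i s))"
    using psd_gram[OF assms(1)] by blast
  obtain v where v: "\<And>r s. r < e \<Longrightarrow> s < e \<Longrightarrow> Y $$ (r, s) = (\<Sum>i<e. v i r * cnj (v i s))"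
    using psd_gram[OF assms(2)] by blast
  show ?thesis
  proof (rule psdI_gram[OF assms(3), where w = "\<lambda>(i, j) r. w i (f r) * v j (g r)" and I = "{..<d} \<times> {..<e}"])
    fix r s assume rs: "r < n" "s < n"
    have "M $$ (r, s) = (\<Sum>i<d. \<Sum>j<e. (w i (f r) * cnj (w i (f s))) * (v j (g r) * cnj (v j (g s))))"
      using rs assms(4,5) by (simp add: M w v sum_product)
    then show "M $$ (r, s) = (\<Sum>p\<in>{..<d} \<times> {..<e}. (case p of (i, j) \<Rightarrow> \<lambda>r. w i (f r) * v j (g r)) r
        * cnj ((case p of (i, j) \<Rightarrow> \<lambda>r. w i (f r) * v j (g r)) s))"
      by (simp add: sum.cartesian_product case_prod_unfold mult_ac)
  qed
qed

text \<open>
  This is the Kronecker product of operators on \<open>\<complex>^a \<otimes> \<complex>^b\<close> and \<open>\<complex>^a' \<otimes> \<complex>^b'\<close> with the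
  factors reordered to \<open>(\<complex>^a \<otimes> \<complex>^a') \<otimes> (\<complex>^b \<otimes> \<complex>^b')\<close>, as needed for the Choi matrix of a tensor product.
\<close>

definition bip_kron :: "nat \<Rightarrow> nat \<Rightarrow> complex mat \<Rightarrow> nat \<Rightarrow> nat \<Rightarrow> complex mat \<Rightarrow> complex mat" where
  "bip_kron a b X a' b' Y = mat (a * a' * (b * b')) (a * a' * (b * b'))
    (\<lambda>(r, s).
      X $$ (r div (b * b') div a' * b + r mod (b * b') div b', s div (b * b') div a' * b + s mod (b * b') div b')
    * Y $$ (r div (b * b') mod a' * b' + r mod (b * b') mod b', s div (b * b') mod a' * b' + s mod (b * b') mod b'))"

lemma bip_kron_carrier [simp]: "bip_kron a b X a' b' Y \<in> carrier_mat (a * a' * (b * b')) (a * a' * (b * b'))"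
  by (simp add: bip_kron_def)

lemma bip_kron_index:
  assumes "i < a" "i' < a'" "k < b" "k' < b'" "j < a" "j' < a'" "l < b" "l' < b'"
  shows "bip_kron a b X a' b' Y $$ ((i * a' + i') * (b * b') + (k * b' + k'), (j * a' + j') * (b * b') + (l * b' + l'))
    = X $$ (i * b + k, j * b + l) * Y $$ (i' * b' + k', j' * b' + l')"
proof -
  have lt: "i * a' + i' < a * a'" "j * a' + j' < a * a'" "k * b' + k' < b * b'" "l * b' + l' < b * b'"
    using assms by (simp_all add: pair_less)
  then have "(i * a' + i') * (b * b') + (k * b' + k') < a * a' * (b * b')"
    "(j * a' + j') * (b * b') + (l * b' + l') < a * a' * (b * b')"
    by (simp_all add: pair_less)
  then show ?thesis using assms lt by (simp add: bip_kron_def del: mult.assoc)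
qed

lemma bip_cases:
  fixes a a' b b' r :: nat
  assumes "r < a * a' * (b * b')"
  obtains i i' k k' where "i < a" "i' < a'" "k < b" "k' < b'" "r = (i * a' + i') * (b * b') + (k * b' + k')"
proof -
  from assms obtain p q where "p < a * a'" "q < b * b'" "r = p * (b * b') + q"
    by (rule pair_cases)
  moreover from this obtain i i' where "i < a" "i' < a'" "p = i * a' + i'" using pair_cases by blast
  moreover from calculation obtain k k' where "k < b" "k' < b'" "q = k * b' + k'" using pair_cases by blast
  ultimately show thesis using that by blast
qed

lemma bip_kron_eqI:
  assumes M: "M \<in> carrier_mat (a * a' * (b * b')) (a * a' * (b * b'))"
    and eq: "\<And>i i' k k' j j' l l'. \<lbrakk>i < a; i' < a'; k < b; k' < b'; j < a; j' < a'; l < b; l' < b'\<rbrakk> \<Longrightarrow>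
      M $$ ((i * a' + i') * (b * b') + (k * b' + k'), (j * a' + j') * (b * b') + (l * b' + l'))
      = X $$ (i * b + k, j * b + l) * Y $$ (i' * b' + k', j' * b' + l')"
  shows "M = bip_kron a b X a' b' Y"
proof (rule eq_matI)
  fix r s assume "r < dim_row (bip_kron a b X a' b' Y)" "s < dim_col (bip_kron a b X a' b' Y)"
  then have "r < a * a' * (b * b')" "s < a * a' * (b * b')" by (simp_all add: bip_kron_def)
  then show "M $$ (r, s) = bip_kron a b X a' b' Y $$ (r, s)"
    by (elim bip_cases) (simp add: eq bip_kron_index)
qed (use M in \<open>auto simp: bip_kron_def\<close>)

lemma psd_bip_kron:
  assumes "psd (a * b) X" "psd (a' * b') Y"
  shows "psd (a * a' * (b * b')) (bip_kron a b X a' b' Y)"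
proof (rule psd_pullback_mult[OF assms bip_kron_carrier])
  fix r assume "r < a * a' * (b * b')"
  then obtain i i' k k' where *: "i < a" "i' < a'" "k < b" "k' < b'"
    and r: "r = (i * a' + i') * (b * b') + (k * b' + k')" by (rule bip_cases)
  then have "k * b' + k' < b * b'" by (simp add: pair_less)
  with * show "r div (b * b') div a' * b + r mod (b * b') div b' < a * b"
    "r div (b * b') mod a' * b' + r mod (b * b') mod b' < a' * b'"
    by (simp_all add: r pair_less)
qed (simp add: bip_kron_def)

lemma ptranspose_bip_kron:
  "ptranspose (a * a') (b * b') (bip_kron a b X a' b' Y)
    = bip_kron a b (ptranspose a b X) a' b' (ptranspose a' b' Y)"
  by (rule bip_kron_eqI) (simp_all add: ptranspose_index bip_kron_index pair_less)

lemma one_kron_carrier: "S \<in> carrier_mat b b \<Longrightarrow> 1\<^sub>m a \<otimes>\<^sub>K S \<in> carrier_mat (a * b) (a * b)"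
  by simp

lemma one_kron_index:
  assumes "S \<in> carrier_mat b b" "i < a" "k < b" "j < a" "l < b"
  shows "(1\<^sub>m a \<otimes>\<^sub>K S) $$ (i * b + k, j * b + l) = (if i = j then S $$ (k, l) else 0)"
  using assms by (simp add: kron_index[OF one_carrier_mat assms(1)])

lemma one_kron_bip_kron:
  assumes "S \<in> carrier_mat b b" "S' \<in> carrier_mat b' b'"
  shows "1\<^sub>m (a * a') \<otimes>\<^sub>K (S \<otimes>\<^sub>K S') = bip_kron a b (1\<^sub>m a \<otimes>\<^sub>K S) a' b' (1\<^sub>m a' \<otimes>\<^sub>K S')"
proof (rule bip_kron_eqI)
  have SS: "S \<otimes>\<^sub>K S' \<in> carrier_mat (b * b') (b * b')" using assms by simp
  show "1\<^sub>m (a * a') \<otimes>\<^sub>K (S \<otimes>\<^sub>K S') \<in> carrier_mat (a * a' * (b * b')) (a * a' * (b * b'))"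
    by (rule one_kron_carrier[OF SS])
  fix i i' k k' j j' l l'
  assume *: "i < a" "i' < a'" "k < b" "k' < b'" "j < a" "j' < a'" "l < b" "l' < b'"
  have "i * a' + i' = j * a' + j' \<longleftrightarrow> i = j \<and> i' = j'"
  proof
    assume eq: "i * a' + i' = j * a' + j'"
    then have "(i * a' + i') div a' = (j * a' + j') div a'" "(i * a' + i') mod a' = (j * a' + j') mod a'"
      by simp_all
    then show "i = j \<and> i' = j'" using * by simp
  qed simp
  then show "(1\<^sub>m (a * a') \<otimes>\<^sub>K (S \<otimes>\<^sub>K S')) $$
      ((i * a' + i') * (b * b') + (k * b' + k'), (j * a' + j') * (b * b') + (l * b' + l'))
    = (1\<^sub>m a \<otimes>\<^sub>K S) $$ (i * b + k, j * b + l) * (1\<^sub>m a' \<otimes>\<^sub>K S') $$ (i' * b' + k', j' * b' + l')"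
    using * by (simp add: one_kron_index[OF SS] one_kron_index[OF assms(1)] one_kron_index[OF assms(2)]
        kron_index[OF assms] pair_less)
qed

text \<open>Tensor the positive matrices R + Q and R - Q with R' + Q' and R' - Q'. The two products
  with equal signs add up to 2 (R (x) R' + Q (x) Q'), the two with opposite signs to 2 (R (x) R' - Q
  (x) Q'). Each conclusion thus draws on both sides of both hypotheses, and this is where the
  two-sided form of the constraints pays off.\<close>

lemma loewner_bip_kron:
  assumes "loewner_le (a * b) (- R) Q" "loewner_le (a * b) Q R"
    and "loewner_le (a' * b') (- R') Q'" "loewner_le (a' * b') Q' R'"
  shows "loewner_le (a * a' * (b * b')) (- bip_kron a b R a' b' R') (bip_kron a b Q a' b' Q')"
    and "loewner_le (a * a' * (b * b')) (bip_kron a b Q a' b' Q') (bip_kron a b R a' b' R')"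
proof -
  let ?n = "a * a' * (b * b')"
  from assms have carr: "Q \<in> carrier_mat (a * b) (a * b)" "R \<in> carrier_mat (a * b) (a * b)"
    "Q' \<in> carrier_mat (a' * b') (a' * b')" "R' \<in> carrier_mat (a' * b') (a' * b')"
    by (auto simp: loewner_le_def)
  from assms have p: "psd (a * b) (Q - - R)" "psd (a * b) (R - Q)" "psd (a' * b') (Q' - - R')" "psd (a' * b') (R' - Q')"
    by (auto simp: loewner_le_def)
  note psds = psd_bip_kron[OF p(1) p(3)] psd_bip_kron[OF p(2) p(4)] psd_bip_kron[OF p(1) p(4)] psd_bip_kron[OF p(2) p(3)]
  have entry: "bip_kron a b (Q - - R) a' b' (Q' - - R') $$ (r, s) + bip_kron a b (R - Q) a' b' (R' - Q') $$ (r, s)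
      = 2 * (bip_kron a b Q a' b' Q' - - bip_kron a b R a' b' R') $$ (r, s)"
    "bip_kron a b (Q - - R) a' b' (R' - Q') $$ (r, s) + bip_kron a b (R - Q) a' b' (Q' - - R') $$ (r, s)
      = 2 * (bip_kron a b R a' b' R' - bip_kron a b Q a' b' Q') $$ (r, s)"
    if rs: "r < ?n" "s < ?n" for r s
  proof -
    from rs obtain i i' k k' j j' l l' where
      *: "i < a" "i' < a'" "k < b" "k' < b'" "j < a" "j' < a'" "l < b" "l' < b'"
      and r: "r = (i * a' + i') * (b * b') + (k * b' + k')"
      and s: "s = (j * a' + j') * (b * b') + (l * b' + l')"
      by (metis bip_cases)
    have idx: "bip_kron a b X a' b' Y $$ (r, s) = X $$ (i * b + k, j * b + l) * Y $$ (i' * b' + k', j' * b' + l')" for X Y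
      unfolding r s by (rule bip_kron_index) (use * in auto)
    have lt: "i * b + k < a * b" "j * b + l < a * b" "i' * b' + k' < a' * b'" "j' * b' + l' < a' * b'"
      using * by (simp_all add: pair_less)
    have dims: "dim_row (bip_kron a b X a' b' Y) = ?n" "dim_col (bip_kron a b X a' b' Y) = ?n" for X Y
      by (simp_all add: bip_kron_def)
    show "bip_kron a b (Q - - R) a' b' (Q' - - R') $$ (r, s) + bip_kron a b (R - Q) a' b' (R' - Q') $$ (r, s)
      = 2 * (bip_kron a b Q a' b' Q' - - bip_kron a b R a' b' R') $$ (r, s)"
      "bip_kron a b (Q - - R) a' b' (R' - Q') $$ (r, s) + bip_kron a b (R - Q) a' b' (Q' - - R') $$ (r, s)
      = 2 * (bip_kron a b R a' b' R' - bip_kron a b Q a' b' Q') $$ (r, s)"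
      using lt rs carr by (simp_all add: idx dims algebra_simps)
  qed
  show "loewner_le ?n (- bip_kron a b R a' b' R') (bip_kron a b Q a' b' Q')"
    unfolding loewner_le_def using entry(1)
    by (auto intro!: psd_half_sum[OF psds(1,2)] minus_carrier_mat uminus_carrier_mat)
  show "loewner_le ?n (bip_kron a b Q a' b' Q') (bip_kron a b R a' b' R')"
    unfolding loewner_le_def using entry(2)
    by (auto intro!: psd_half_sum[OF psds(3,4)] minus_carrier_mat)
qed

text \<open>The constraint set of \<open>beta\<close> with the Choi matrix as a parameter, so that
  tensor products can be treated for matrices before any map is attached to them.\<close>

definition beta_feasible :: "nat \<Rightarrow> nat \<Rightarrow> complex mat \<Rightarrow> complex mat \<Rightarrow> complex mat \<Rightarrow> bool" where
  "beta_feasible a b J S R \<longleftrightarrow> hermitian b S \<and> hermitian (a * b) R \<and>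
      loewner_le (a * b) (- R) (ptranspose a b J) \<and>
      loewner_le (a * b) (ptranspose a b J) R \<and>
      loewner_le (a * b) (- (1\<^sub>m a \<otimes>\<^sub>K S)) (ptranspose a b R) \<and>
      loewner_le (a * b) (ptranspose a b R) (1\<^sub>m a \<otimes>\<^sub>K S)"

lemma hermitian_kron:
  assumes "hermitian d A" "hermitian e B"
  shows "hermitian (d * e) (A \<otimes>\<^sub>K B)"
  unfolding hermitian_iff
proof (intro conjI allI impI)
  from assms have c: "A \<in> carrier_mat d d" "B \<in> carrier_mat e e" by (simp_all add: hermitian_def)
  then show "A \<otimes>\<^sub>K B \<in> carrier_mat (d * e) (d * e)" by simp
  fix r s assume "r < d * e" "s < d * e"
  then obtain i k j l where *: "i < d" "k < e" "j < d" "l < e" and rs: "r = i * e + k" "s = j * e + l"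
    by (metis pair_cases)
  then have "A $$ (i, j) = cnj (A $$ (j, i))" "B $$ (k, l) = cnj (B $$ (l, k))"
    using assms unfolding hermitian_iff by blast+
  then show "(A \<otimes>\<^sub>K B) $$ (r, s) = cnj ((A \<otimes>\<^sub>K B) $$ (s, r))"
    unfolding rs kron_index[OF c *] kron_index[OF c *(3,4,1,2)] by simp
qed

lemma hermitian_bip_kron:
  assumes "hermitian (a * b) X" "hermitian (a' * b') Y"
  shows "hermitian (a * a' * (b * b')) (bip_kron a b X a' b' Y)"
  unfolding hermitian_iff
proof (intro conjI allI impI)
  fix r s assume "r < a * a' * (b * b')" "s < a * a' * (b * b')"
  then obtain i i' k k' j j' l l' where
    *: "i < a" "i' < a'" "k < b" "k' < b'" "j < a" "j' < a'" "l < b" "l' < b'"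
    and rs: "r = (i * a' + i') * (b * b') + (k * b' + k')" "s = (j * a' + j') * (b * b') + (l * b' + l')"
    by (metis bip_cases)
  then have "X $$ (i * b + k, j * b + l) = cnj (X $$ (j * b + l, i * b + k))"
    "Y $$ (i' * b' + k', j' * b' + l') = cnj (Y $$ (j' * b' + l', i' * b' + k'))"
    using assms pair_less[OF *(1,3)] pair_less[OF *(5,7)] pair_less[OF *(2,4)] pair_less[OF *(6,8)]
    unfolding hermitian_iff by blast+
  then show "bip_kron a b X a' b' Y $$ (r, s) = cnj (bip_kron a b X a' b' Y $$ (s, r))"
    unfolding rs bip_kron_index[OF *] bip_kron_index[OF *(5-8) *(1-4)] by simp
qed simp

lemma beta_feasible_bip_kron:
  assumes "beta_feasible a b J S R" "beta_feasible a' b' J' S' R'"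
  shows "beta_feasible (a * a') (b * b') (bip_kron a b J a' b' J') (S \<otimes>\<^sub>K S') (bip_kron a b R a' b' R')"
proof -
  from assms have S: "S \<in> carrier_mat b b" "S' \<in> carrier_mat b' b'"
    by (auto simp: beta_feasible_def hermitian_def)
  show ?thesis
    using assms unfolding beta_feasible_def ptranspose_bip_kron one_kron_bip_kron[OF S]
    by (intro conjI hermitian_kron hermitian_bip_kron loewner_bip_kron) auto
qed

text \<open>Choi's criterion: positivity expresses complete positivity, and the trace over the
  output index expresses trace preservation.\<close>

definition channel_choi :: "nat \<Rightarrow> nat \<Rightarrow> complex mat \<Rightarrow> bool" where
  "channel_choi a b J \<longleftrightarrow> psd (a * b) J \<and>
    (\<forall>i<a. \<forall>j<a. (\<Sum>k<b. J $$ (i * b + k, j * b + k)) = (if i = j then 1 else 0))"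

lemma channel_choi_bip_kron:
  assumes "channel_choi a b J" "channel_choi a' b' J'"
  shows "channel_choi (a * a') (b * b') (bip_kron a b J a' b' J')"
  unfolding channel_choi_def
proof (intro conjI allI impI)
  show "psd (a * a' * (b * b')) (bip_kron a b J a' b' J')"
    using assms by (intro psd_bip_kron) (auto simp: channel_choi_def)
  fix p q assume "p < a * a'" "q < a * a'"
  then obtain i i' j j' where *: "i < a" "i' < a'" "j < a" "j' < a'"
    and pq: "p = i * a' + i'" "q = j * a' + j'" by (metis pair_cases)
  have "(\<Sum>k<b * b'. bip_kron a b J a' b' J' $$ (p * (b * b') + k, q * (b * b') + k))
      = (\<Sum>k<b. \<Sum>k'<b'. J $$ (i * b + k, j * b + k) * J' $$ (i' * b' + k', j' * b' + k'))"
    unfolding sum_lessThan_mult pq using * by (intro sum.cong refl) (simp add: bip_kron_index)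
  also have "\<dots> = (\<Sum>k<b. J $$ (i * b + k, j * b + k)) * (\<Sum>k'<b'. J' $$ (i' * b' + k', j' * b' + k'))"
    by (simp only: sum_product)
  also have "\<dots> = (if i = j \<and> i' = j' then 1 else 0)"
    using assms * by (simp add: channel_choi_def)
  also have "\<dots> = (if p = q then 1 else 0)"
  proof -
    have "p = q \<longleftrightarrow> i = j \<and> i' = j'"
    proof
      assume "p = q"
      then have "p div a' = q div a'" "p mod a' = q mod a'" by simp_all
      then show "i = j \<and> i' = j'" using * by (simp add: pq)
    qed (simp add: pq)
    then show ?thesis by simp
  qed
  finally show "(\<Sum>k<b * b'. bip_kron a b J a' b' J' $$ (p * (b * b') + k, q * (b * b') + k)) = (if p = q then 1 else 0)" .
qed

text \<open>Products of Kronecker deltas are written below as nested conditionals. Moving a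
  condition that is constant in the summation index outside lets the sums collapse one at a
  time.\<close>

lemma sum_if_const: "(\<Sum>x\<in>A. if P then f x else 0) = (if P then \<Sum>x\<in>A. f x else 0)"
  by simp

lemma superop_tensor_carrier [simp]: "superop_tensor a b \<N> a' b' \<M> X \<in> carrier_mat (b * b') (b * b')"
  by (simp add: superop_tensor_def sum_mat_def)

lemma superop_tensor_dims: "superop_dims c (b * b') (superop_tensor a b \<N> a' b' \<M>)"
  by (simp add: superop_dims_def)

lemma superop_tensor_index:
  assumes N: "superop_dims a b \<N>"
    and M: "superop_dims a' b' \<M>"
    and "k < b" "k' < b'" "l < b" "l' < b'"
  shows "superop_tensor a b \<N> a' b' \<M> X $$ (k * b' + k', l * b' + l')
    = (\<Sum>i<a. \<Sum>j<a. \<Sum>i'<a'. \<Sum>j'<a'. X $$ (i * a' + i', j * a' + j')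
        * (\<N> (ketbra a i j) $$ (k, l) * \<M> (ketbra a' i' j') $$ (k', l')))"
proof -
  have "superop_tensor a b \<N> a' b' \<M> X $$ (k * b' + k', l * b' + l')
      = (\<Sum>(i, j, i', j')\<in>{..<a} \<times> {..<a} \<times> {..<a'} \<times> {..<a'}.
          (X $$ (i * a' + i', j * a' + j') \<cdot>\<^sub>m (\<N> (ketbra a i j) \<otimes>\<^sub>K \<M> (ketbra a' i' j'))) $$ (k * b' + k', l * b' + l'))"
    using assms(3-6) by (auto simp: superop_tensor_def sum_mat_def pair_less intro!: sum.cong)
  also have "\<dots> = (\<Sum>(i, j, i', j')\<in>{..<a} \<times> {..<a} \<times> {..<a'} \<times> {..<a'}. X $$ (i * a' + i', j * a' + j')
        * (\<N> (ketbra a i j) $$ (k, l) * \<M> (ketbra a' i' j') $$ (k', l')))"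
  proof (intro sum.cong refl, clarify)
    fix i j i' j' assume *: "i < a" "j < a" "i' < a'" "j' < a'"
    note c = superop_dimsD[OF N *(1,2)] superop_dimsD[OF M *(3,4)]
    have "\<N> (ketbra a i j) \<otimes>\<^sub>K \<M> (ketbra a' i' j') \<in> carrier_mat (b * b') (b * b')"
      using c by simp
    then show "(X $$ (i * a' + i', j * a' + j') \<cdot>\<^sub>m (\<N> (ketbra a i j) \<otimes>\<^sub>K \<M> (ketbra a' i' j'))) $$ (k * b' + k', l * b' + l')
        = X $$ (i * a' + i', j * a' + j') * (\<N> (ketbra a i j) $$ (k, l) * \<M> (ketbra a' i' j') $$ (k', l'))"
      using assms(3-6) by (simp add: kron_index[OF c] pair_less)
  qed
  finally show ?thesis by (simp add: sum.cartesian_product)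
qed

lemma superop_tensor_ketbra_index:
  assumes N: "superop_dims a b \<N>"
    and M: "superop_dims a' b' \<M>"
    and kl: "k < b" "k' < b'" "l < b" "l' < b'"
    and ij: "i < a" "i' < a'" "j < a" "j' < a'"
  shows "superop_tensor a b \<N> a' b' \<M> (ketbra (a * a') (i * a' + i') (j * a' + j')) $$ (k * b' + k', l * b' + l')
    = \<N> (ketbra a i j) $$ (k, l) * \<M> (ketbra a' i' j') $$ (k', l')"
proof -
  have inj: "p * a' + p' = i * a' + i' \<longleftrightarrow> p = i \<and> p' = i'" if "p' < a'" "i' < a'" for p p' i i'
  proof
    assume "p * a' + p' = i * a' + i'"
    then have "(p * a' + p') div a' = (i * a' + i') div a'" "(p * a' + p') mod a' = (i * a' + i') mod a'"
      by simp_all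
    then show "p = i \<and> p' = i'" using that by simp
  qed simp
  have "superop_tensor a b \<N> a' b' \<M> (ketbra (a * a') (i * a' + i') (j * a' + j')) $$ (k * b' + k', l * b' + l')
      = (\<Sum>p<a. \<Sum>q<a. \<Sum>p'<a'. \<Sum>q'<a'. if p = i then if q = j then if p' = i' then if q' = j' then
         \<N> (ketbra a p q) $$ (k, l) * \<M> (ketbra a' p' q') $$ (k', l') else 0 else 0 else 0 else 0)"
    unfolding superop_tensor_index[OF N M kl]
    using ij by (intro sum.cong refl) (simp add: ketbra_index pair_less inj)
  also have "\<dots> = \<N> (ketbra a i j) $$ (k, l) * \<M> (ketbra a' i' j') $$ (k', l')"
    using ij by (simp add: sum_if_const)
  finally show ?thesis .
qed

lemma choi_superop_tensor:
  assumes N: "superop_dims a b \<N>"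
    and M: "superop_dims a' b' \<M>"
  shows "choi (a * a') (b * b') (superop_tensor a b \<N> a' b' \<M>) = bip_kron a b (choi a b \<N>) a' b' (choi a' b' \<M>)"
  by (rule bip_kron_eqI)
    (simp_all add: choi_index[OF superop_tensor_dims] choi_index[OF N] choi_index[OF M]
      superop_tensor_ketbra_index[OF N M] pair_less)

text \<open>Linearity on all matrices, expressed through \<open>J\<close>. A
  \<open>superop_tensor\<close> has this property by construction, since it is evaluated by
  expansion in matrix units, so the powers of a map inherit it from their form alone.\<close>

definition superop_of_choi :: "nat \<Rightarrow> nat \<Rightarrow> superop \<Rightarrow> complex mat \<Rightarrow> bool" where
  "superop_of_choi a b \<N> J \<longleftrightarrow> (\<forall>X\<in>carrier_mat a a. \<N> X \<in> carrier_mat b b \<and>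
    (\<forall>k<b. \<forall>l<b. \<N> X $$ (k, l) = (\<Sum>i<a. \<Sum>j<a. X $$ (i, j) * J $$ (i * b + k, j * b + l))))"

lemma superop_of_choi_tensor:
  assumes N: "superop_dims a b \<N>"
    and M: "superop_dims a' b' \<M>"
  shows "superop_of_choi (a * a') (b * b') (superop_tensor a b \<N> a' b' \<M>)
    (choi (a * a') (b * b') (superop_tensor a b \<N> a' b' \<M>))"
  unfolding superop_of_choi_def
proof (intro ballI conjI allI impI)
  fix X p q assume "p < b * b'" "q < b * b'"
  then obtain k k' l l' where kl: "k < b" "k' < b'" "l < b" "l' < b'"
    and pq: "p = k * b' + k'" "q = l * b' + l'" by (metis pair_cases)
  have "(\<Sum>r<a * a'. \<Sum>s<a * a'. X $$ (r, s) * choi (a * a') (b * b') (superop_tensor a b \<N> a' b' \<M>)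
        $$ (r * (b * b') + p, s * (b * b') + q))
      = (\<Sum>i<a. \<Sum>i'<a'. \<Sum>j<a. \<Sum>j'<a'. X $$ (i * a' + i', j * a' + j')
        * (\<N> (ketbra a i j) $$ (k, l) * \<M> (ketbra a' i' j') $$ (k', l')))"
    unfolding sum_lessThan_mult pq using kl
    by (intro sum.cong refl)
      (simp add: choi_index[OF superop_tensor_dims] superop_tensor_ketbra_index[OF N M] pair_less)
  also have "\<dots> = superop_tensor a b \<N> a' b' \<M> X $$ (p, q)"
    unfolding pq superop_tensor_index[OF N M kl] by (rule sum.cong[OF refl], rule sum.swap)
  finally show "superop_tensor a b \<N> a' b' \<M> X $$ (p, q) = (\<Sum>r<a * a'. \<Sum>s<a * a'. X $$ (r, s)
      * choi (a * a') (b * b') (superop_tensor a b \<N> a' b' \<M>) $$ (r * (b * b') + p, s * (b * b') + q))"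
    by simp
qed simp

section \<open>The Holevo quantity\<close>

lemma quad_prod:
  "quad (a * b) X (\<lambda>r. u (r div b) * v (r mod b))
    = (\<Sum>i<a. \<Sum>k<b. \<Sum>j<a. \<Sum>l<b. cnj (u i * v k) * X $$ (i * b + k, j * b + l) * (u j * v l))"
  unfolding quad_def sum_lessThan_mult by (intro sum.cong refl) simp

text \<open>Transposing the second factor swaps the places of \<open>v k\<close> and
  \<open>cnj (v l)\<close>, which amounts to conjugating \<open>v\<close>. The product form of the
  vector is essential: it allows the second factor to be conjugated alone.\<close>

lemma quad_ptranspose:
  "quad (a * b) (ptranspose a b X) (\<lambda>r. u (r div b) * v (r mod b))
    = quad (a * b) X (\<lambda>r. u (r div b) * cnj (v (r mod b)))"
proof -
  have "quad (a * b) (ptranspose a b X) (\<lambda>r. u (r div b) * v (r mod b))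
      = (\<Sum>i<a. \<Sum>k<b. \<Sum>j<a. \<Sum>l<b. cnj (u i * cnj (v l)) * X $$ (i * b + l, j * b + k) * (u j * cnj (v k)))"
    unfolding quad_prod by (intro sum.cong refl) (simp add: ptranspose_index mult_ac)
  also have "\<dots> = (\<Sum>i<a. \<Sum>l<b. \<Sum>j<a. \<Sum>k<b. cnj (u i * cnj (v l)) * X $$ (i * b + l, j * b + k) * (u j * cnj (v k)))"
  proof (rule sum.cong[OF refl])
    fix i
    let ?f = "\<lambda>k j l. cnj (u i * cnj (v l)) * X $$ (i * b + l, j * b + k) * (u j * cnj (v k))"
    have "(\<Sum>k<b. \<Sum>j<a. \<Sum>l<b. ?f k j l) = (\<Sum>j<a. \<Sum>l<b. \<Sum>k<b. ?f k j l)" by (rule sum_rotate)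
    also have "\<dots> = (\<Sum>l<b. \<Sum>j<a. \<Sum>k<b. ?f k j l)" by (rule sum.swap)
    finally show "(\<Sum>k<b. \<Sum>j<a. \<Sum>l<b. ?f k j l) = (\<Sum>l<b. \<Sum>j<a. \<Sum>k<b. ?f k j l)" .
  qed
  also have "\<dots> = quad (a * b) X (\<lambda>r. u (r div b) * cnj (v (r mod b)))"
    by (simp add: quad_prod[where v = "\<lambda>k. cnj (v k)"])
  finally show ?thesis .
qed

lemma quad_one_kron:
  assumes "S \<in> carrier_mat b b"
  shows "quad (a * b) (1\<^sub>m a \<otimes>\<^sub>K S) (\<lambda>r. u (r div b) * v (r mod b))
    = of_real (\<Sum>i<a. (cmod (u i))\<^sup>2) * quad b S v"
proof -
  have "quad (a * b) (1\<^sub>m a \<otimes>\<^sub>K S) (\<lambda>r. u (r div b) * v (r mod b))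
      = (\<Sum>i<a. \<Sum>k<b. \<Sum>j<a. if i = j then \<Sum>l<b. cnj (u i * v k) * S $$ (k, l) * (u j * v l) else 0)"
    unfolding quad_prod by (intro sum.cong refl) (simp add: one_kron_index[OF assms])
  also have "\<dots> = (\<Sum>i<a. \<Sum>k<b. \<Sum>l<b. (u i * cnj (u i)) * (cnj (v k) * S $$ (k, l) * v l))"
    by (simp add: mult_ac)
  also have "\<dots> = (\<Sum>i<a. u i * cnj (u i)) * quad b S v"
    unfolding quad_def by (simp only: sum_distrib_left[symmetric] sum_distrib_right[symmetric])
  also have "(\<Sum>i<a. u i * cnj (u i)) = of_real (\<Sum>i<a. (cmod (u i))\<^sup>2)"
    unfolding of_real_sum by (intro sum.cong refl) (simp only: complex_norm_square)
  finally show ?thesis .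
qed

lemma density_gram:
  assumes "density d \<rho>"
  obtains w where "\<And>r s. r < d \<Longrightarrow> s < d \<Longrightarrow> \<rho> $$ (r, s) = (\<Sum>i<d. w i r * cnj (w i s))"
    and "(\<Sum>i<d. \<Sum>r<d. (cmod (w i r))\<^sup>2) = 1"
proof -
  from assms have psd: "psd d \<rho>" and tr1: "tr \<rho> = 1" by (auto simp: density_def)
  obtain w where w: "\<And>r s. r < d \<Longrightarrow> s < d \<Longrightarrow> \<rho> $$ (r, s) = (\<Sum>i<d. w i r * cnj (w i s))"
    using psd_gram[OF psd] by blast
  have "tr \<rho> = of_real (\<Sum>r<d. \<Sum>i<d. (cmod (w i r))\<^sup>2)"
    using carrier_matD(1)[OF psd_carrier[OF psd]]
    unfolding tr_def of_real_sum by (intro sum.cong) (auto simp: w simp del: of_real_power simp flip: complex_norm_square)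
  then have "(\<Sum>r<d. \<Sum>i<d. (cmod (w i r))\<^sup>2) = 1" using tr1 by (metis of_real_eq_1_iff)
  then show thesis using that[OF w] sum.swap[of "\<lambda>r i. (cmod (w i r))\<^sup>2" "{..<d}" "{..<d}"] by simp
qed

text \<open>
  \<open>J\<^sup>T\<^sup>B\<close> is the Choi matrix of \<open>T \<circ> \<N>\<close>. So the constraints make \<open>T \<circ> (\<M> \<plusminus> \<N>)\<close> completely positive, where
  \<open>\<M>\<close> has Choi matrix \<open>R\<^sup>T\<^sup>B\<close>; hence \<open>\<N> \<rho> \<le> \<M> \<rho> \<le> S\<close>.
\<close>

lemma beta_feasible_dominates:
  assumes N: "superop_of_choi a b \<N> J" and feas: "beta_feasible a b J S R" and \<rho>: "density a \<rho>"
  shows "Re (quad b (\<N> \<rho>) x) \<le> Re (quad b S x)"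
proof -
  have S: "S \<in> carrier_mat b b" using feas by (auto simp: beta_feasible_def hermitian_def)
  obtain w where w: "\<And>r s. r < a \<Longrightarrow> s < a \<Longrightarrow> \<rho> $$ (r, s) = (\<Sum>p<a. w p r * cnj (w p s))"
    and w1: "(\<Sum>p<a. \<Sum>r<a. (cmod (w p r))\<^sup>2) = 1"
    using density_gram[OF \<rho>] by blast
  have \<rho>c: "\<rho> \<in> carrier_mat a a" using \<rho> by (simp add: density_def psd_carrier)
  \<comment> \<open>Gram vectors of the input turn this form into a sum of values of the form of
    \<open>J\<close> at the product vectors with factors \<open>cnj (w p i)\<close> and
    \<open>x k\<close>.\<close>
  have "quad b (\<N> \<rho>) x = (\<Sum>k<b. \<Sum>l<b. cnj (x k) * (\<Sum>i<a. \<Sum>j<a. \<rho> $$ (i, j) * J $$ (i * b + k, j * b + l)) * x l)"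
    unfolding quad_def using N \<rho>c by (intro sum.cong refl) (simp add: superop_of_choi_def)
  also have "\<dots> = (\<Sum>k<b. \<Sum>l<b. \<Sum>i<a. \<Sum>j<a. \<Sum>p<a.
      cnj (cnj (w p i) * x k) * J $$ (i * b + k, j * b + l) * (cnj (w p j) * x l))"
    by (intro sum.cong refl) (simp add: w sum_distrib_left sum_distrib_right mult_ac)
  also have "\<dots> = (\<Sum>i<a. \<Sum>j<a. \<Sum>p<a. \<Sum>k<b. \<Sum>l<b.
      cnj (cnj (w p i) * x k) * J $$ (i * b + k, j * b + l) * (cnj (w p j) * x l))"
    unfolding sum.cartesian_product by (rule sum.reindex_bij_witness[of _
      "\<lambda>(i, j, p, k, l). (k, l, i, j, p)" "\<lambda>(k, l, i, j, p). (i, j, p, k, l)"]) auto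
  also have "\<dots> = (\<Sum>p<a. \<Sum>i<a. \<Sum>k<b. \<Sum>j<a. \<Sum>l<b.
      cnj (cnj (w p i) * x k) * J $$ (i * b + k, j * b + l) * (cnj (w p j) * x l))"
    unfolding sum.cartesian_product by (rule sum.reindex_bij_witness[of _
      "\<lambda>(p, i, k, j, l). (i, j, p, k, l)" "\<lambda>(i, j, p, k, l). (p, i, k, j, l)"]) auto
  also have "\<dots> = (\<Sum>p<a. quad (a * b) J (\<lambda>r. cnj (w p (r div b)) * x (r mod b)))"
    by (simp add: quad_prod[where u = "\<lambda>i. cnj (w _ i)"])
  finally have eq: "quad b (\<N> \<rho>) x = (\<Sum>p<a. quad (a * b) J (\<lambda>r. cnj (w p (r div b)) * x (r mod b)))" .
  \<comment> \<open>The conjugations cancel: J^T_B at u (x) cnj x has the value of J at u (x) x.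
    After the bound by \<open>R\<close>, the second partial transpose returns to u (x) x, where 1
    (x) S contributes the squared norm of \<open>u\<close> times the form of
    \<open>S\<close>.\<close>
  have le: "Re (quad (a * b) J (\<lambda>r. u (r div b) * x (r mod b)))
      \<le> (\<Sum>i<a. (cmod (u i))\<^sup>2) * Re (quad b S x)" for u
  proof -
    have J: "quad (a * b) (ptranspose a b J) (\<lambda>r. u (r div b) * cnj (x (r mod b)))
        = quad (a * b) J (\<lambda>r. u (r div b) * x (r mod b))"
      using quad_ptranspose[where v = "\<lambda>k. cnj (x k)"] by simp
    have "Re (quad (a * b) (ptranspose a b J) (\<lambda>r. u (r div b) * cnj (x (r mod b))))
        \<le> Re (quad (a * b) R (\<lambda>r. u (r div b) * cnj (x (r mod b))))"
      using feas by (intro loewner_le_quad) (simp add: beta_feasible_def)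
    also have "\<dots> = Re (quad (a * b) (ptranspose a b R) (\<lambda>r. u (r div b) * x (r mod b)))"
      by (simp add: quad_ptranspose)
    also have "\<dots> \<le> Re (quad (a * b) (1\<^sub>m a \<otimes>\<^sub>K S) (\<lambda>r. u (r div b) * x (r mod b)))"
      using feas by (intro loewner_le_quad) (simp add: beta_feasible_def)
    also have "\<dots> = (\<Sum>i<a. (cmod (u i))\<^sup>2) * Re (quad b S x)"
      unfolding quad_one_kron[OF S] by (simp del: of_real_sum)
    finally show ?thesis unfolding J .
  qed
  have "Re (quad b (\<N> \<rho>) x) = (\<Sum>p<a. Re (quad (a * b) J (\<lambda>r. cnj (w p (r div b)) * x (r mod b))))"
    by (simp add: eq)
  also have "\<dots> \<le> (\<Sum>p<a. (\<Sum>i<a. (cmod (cnj (w p i)))\<^sup>2) * Re (quad b S x))"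
    by (intro sum_mono le)
  also have "\<dots> = Re (quad b S x)"
    using w1 by (simp flip: sum_distrib_right)
  finally show ?thesis .
qed

text \<open>Contracting the Gram vectors of the input with those of \<open>J\<close> over the input
  index gives Gram vectors of the output. The trace condition on \<open>J\<close> reduces the output
  trace to the input trace.\<close>

lemma density_superop:
  assumes N: "superop_of_choi a b \<N> J" and J: "channel_choi a b J" and \<rho>: "density a \<rho>"
  shows "density b (\<N> \<rho>)"
  unfolding density_def
proof
  have \<rho>c: "\<rho> \<in> carrier_mat a a" and \<rho>1: "tr \<rho> = 1" using \<rho> by (simp_all add: density_def psd_carrier)
  have Ni: "\<N> \<rho> $$ (k, l) = (\<Sum>i<a. \<Sum>j<a. \<rho> $$ (i, j) * J $$ (i * b + k, j * b + l))" if "k < b" "l < b" for k l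
    using N \<rho>c that by (auto simp: superop_of_choi_def)
  have Nc: "\<N> \<rho> \<in> carrier_mat b b"
    using N \<rho>c by (auto simp: superop_of_choi_def)
  obtain w where w: "\<And>r s. r < a \<Longrightarrow> s < a \<Longrightarrow> \<rho> $$ (r, s) = (\<Sum>p<a. w p r * cnj (w p s))"
    using density_gram[OF \<rho>] by blast
  from J have psdJ: "psd (a * b) J" by (simp add: channel_choi_def)
  obtain v where v: "\<And>r s. r < a * b \<Longrightarrow> s < a * b \<Longrightarrow> J $$ (r, s) = (\<Sum>q<a * b. v q r * cnj (v q s))"
    by (rule psd_gram[OF psdJ]) (rule that)
  show "psd b (\<N> \<rho>)"
  proof (rule psdI_gram[OF Nc, where w = "\<lambda>(p, q) k. \<Sum>i<a. w p i * v q (i * b + k)" and I = "{..<a} \<times> {..<a * b}"])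
    fix k l assume kl: "k < b" "l < b"
    have "\<N> \<rho> $$ (k, l) = (\<Sum>i<a. \<Sum>j<a. \<Sum>p<a. \<Sum>q<a * b. (w p i * v q (i * b + k)) * cnj (w p j * v q (j * b + l)))"
      unfolding Ni[OF kl] using kl
      by (intro sum.cong refl) (simp add: w v pair_less sum_product mult_ac)
    also have "\<dots> = (\<Sum>p<a. \<Sum>q<a * b. \<Sum>i<a. \<Sum>j<a. (w p i * v q (i * b + k)) * cnj (w p j * v q (j * b + l)))"
      by (subst sum_rotate, rule sum_rotate)
    also have "\<dots> = (\<Sum>p<a. \<Sum>q<a * b. (\<Sum>i<a. w p i * v q (i * b + k)) * cnj (\<Sum>j<a. w p j * v q (j * b + l)))"
      by (simp only: sum_product cnj_sum)
    finally show "\<N> \<rho> $$ (k, l) = (\<Sum>pq\<in>{..<a} \<times> {..<a * b}.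
        (case pq of (p, q) \<Rightarrow> \<lambda>k. \<Sum>i<a. w p i * v q (i * b + k)) k
        * cnj ((case pq of (p, q) \<Rightarrow> \<lambda>k. \<Sum>i<a. w p i * v q (i * b + k)) l))"
      by (simp only: sum.cartesian_product case_prod_unfold)
  qed
  have "tr (\<N> \<rho>) = (\<Sum>k<b. \<Sum>i<a. \<Sum>j<a. \<rho> $$ (i, j) * J $$ (i * b + k, j * b + k))"
    using Nc by (simp add: tr_def Ni)
  also have "\<dots> = (\<Sum>i<a. \<Sum>j<a. \<rho> $$ (i, j) * (\<Sum>k<b. J $$ (i * b + k, j * b + k)))"
    by (subst sum_rotate) (simp only: sum_distrib_left)
  also have "\<dots> = (\<Sum>i<a. \<Sum>j<a. if i = j then \<rho> $$ (i, j) else 0)"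
    using J by (intro sum.cong refl) (simp add: channel_choi_def)
  also have "\<dots> = tr \<rho>" using \<rho>c by (simp add: tr_def)
  finally show "tr (\<N> \<rho>) = 1" using \<rho>1 by simp
qed

lemma density_mixture:
  assumes \<rho>: "\<And>i. i < k \<Longrightarrow> density d (\<rho> i)" and p: "\<And>i. i < k \<Longrightarrow> 0 \<le> p i" "(\<Sum>i<k. p i) = 1"
  shows "density d (sum_mat d (\<lambda>i. complex_of_real (p i) \<cdot>\<^sub>m \<rho> i) {..<k})" (is "density d ?M")
proof -
  have c: "\<rho> i \<in> carrier_mat d d" if "i < k" for i
    using \<rho>[OF that] by (simp add: density_def psd_carrier)
  have idx: "?M $$ (r, s) = (\<Sum>i<k. of_real (p i) * \<rho> i $$ (r, s))" if "r < d" "s < d" for r s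
    using that carrier_matD[OF c] by (auto simp: sum_mat_def intro!: sum.cong)
  have Mc: "?M \<in> carrier_mat d d" by (simp add: sum_mat_def)
  have "?M $$ (r, s) = cnj (?M $$ (s, r))" if "r < d" "s < d" for r s
  proof -
    have "\<rho> i $$ (r, s) = cnj (\<rho> i $$ (s, r))" if "i < k" for i
      using \<rho>[OF that] \<open>r < d\<close> \<open>s < d\<close> unfolding density_def psd_iff_quad hermitian_iff by blast
    then have "of_real (p i) * \<rho> i $$ (r, s) = cnj (of_real (p i) * \<rho> i $$ (s, r))" if "i < k" for i
      using that by (metis complex_cnj_complex_of_real complex_cnj_mult)
    then show ?thesis unfolding idx[OF that] idx[OF that(2,1)] cnj_sum by (intro sum.cong) auto
  qed
  moreover have "0 \<le> quad d ?M x" for x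
  proof -
    have "quad d ?M x = (\<Sum>r<d. \<Sum>s<d. \<Sum>i<k. of_real (p i) * (cnj (x r) * \<rho> i $$ (r, s) * x s))"
      unfolding quad_def by (intro sum.cong refl) (simp add: idx sum_distrib_left sum_distrib_right mult_ac)
    also have "\<dots> = (\<Sum>i<k. of_real (p i) * quad d (\<rho> i) x)"
      unfolding sum_rotate[symmetric, where A = "{..<k}"] quad_def by (simp only: sum_distrib_left)
    also have "0 \<le> \<dots>"
      using \<rho> p(1) by (intro sum_nonneg mult_nonneg_nonneg psd_quad) (auto simp: density_def less_eq_complex_def)
    finally show ?thesis .
  qed
  ultimately have "psd d ?M" using Mc unfolding psd_iff_quad hermitian_iff by blast
  moreover have "tr ?M = 1"
  proof -
    have "tr ?M = (\<Sum>r<d. \<Sum>i<k. of_real (p i) * \<rho> i $$ (r, r))"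
      unfolding tr_def carrier_matD(1)[OF Mc] by (intro sum.cong refl) (simp add: idx)
    also have "\<dots> = (\<Sum>i<k. of_real (p i) * (\<Sum>r<d. \<rho> i $$ (r, r)))"
      by (subst sum.swap) (simp only: sum_distrib_left)
    also have "\<dots> = (\<Sum>i<k. of_real (p i))"
    proof (intro sum.cong refl)
      fix i assume "i \<in> {..<k}"
      then have "(\<Sum>r<d. \<rho> i $$ (r, r)) = 1"
        using \<rho>[of i] carrier_matD(1)[OF c] by (simp add: density_def tr_def)
      then show "complex_of_real (p i) * (\<Sum>r<d. \<rho> i $$ (r, r)) = of_real (p i)" by simp
    qed
    finally show ?thesis using p(2) by (metis of_real_1 of_real_sum)
  qed
  ultimately show ?thesis by (simp add: density_def)
qed

definition real_diag :: "nat \<Rightarrow> (nat \<Rightarrow> real) \<Rightarrow> complex mat" where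
  "real_diag d s = mat d d (\<lambda>(i, j). if i = j then of_real (s i) else 0)"

lemma quad_real_diag: "Re (quad d (real_diag d s) x) = (\<Sum>i<d. s i * (cmod (x i))\<^sup>2)"
proof -
  have "quad d (real_diag d s) x = (\<Sum>r<d. \<Sum>t<d. if r = t then of_real (s r) * (x r * cnj (x r)) else 0)"
    unfolding quad_def by (intro sum.cong refl) (simp add: real_diag_def mult_ac)
  also have "\<dots> = of_real (\<Sum>i<d. s i * (cmod (x i))\<^sup>2)"
    unfolding of_real_sum of_real_mult complex_norm_square by simp
  finally show ?thesis by (simp del: of_real_sum)
qed

text \<open>
  With \<open>\<sigma> = S / t\<close>, every output satisfies \<open>D(\<N> \<rho> \<parallel> \<sigma>) \<le> log t\<close>, since \<open>\<N> \<rho> \<le> t \<sigma>\<close>; the two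
  cross entropies relative to \<open>\<sigma>\<close> differ by \<open>log t\<close>.
\<close>

lemma holevo_term_le:
  fixes k :: nat
  assumes N: "superop_of_choi a b \<N> J" and J: "channel_choi a b J"
    and feas: "beta_feasible a b J (real_diag b s) R"
    and s: "\<And>i. i < b \<Longrightarrow> 0 < s i" and t: "0 < t" "(\<Sum>i<b. s i) \<le> t"
    and \<rho>: "\<And>i. i < k \<Longrightarrow> density a (\<rho> i)" and p: "\<And>i. i < k \<Longrightarrow> 0 \<le> p i" "(\<Sum>i<k. p i) = 1"
  shows "vn_entropy (sum_mat b (\<lambda>i. complex_of_real (p i) \<cdot>\<^sub>m \<N> (\<rho> i)) {..<k})
    - (\<Sum>i<k. p i * vn_entropy (\<N> (\<rho> i))) \<le> log 2 t"
proof -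
  let ?M = "sum_mat b (\<lambda>i. complex_of_real (p i) \<cdot>\<^sub>m \<N> (\<rho> i)) {..<k}"
  have dens: "density b (\<N> (\<rho> i))" if "i < k" for i
    using density_superop[OF N J \<rho>[OF that]] .
  have M: "density b ?M" by (rule density_mixture[OF dens p])
  have diag: "Re (?M $$ (j, j)) = (\<Sum>i<k. p i * Re (\<N> (\<rho> i) $$ (j, j)))" if "j < b" for j
  proof -
    have "(complex_of_real (p i) \<cdot>\<^sub>m \<N> (\<rho> i)) $$ (j, j) = of_real (p i) * \<N> (\<rho> i) $$ (j, j)" if "i < k" for i
      using psd_carrier[of b "\<N> (\<rho> i)"] dens[OF that] \<open>j < b\<close> by (simp add: density_def)
    then show ?thesis using that by (simp add: sum_mat_def)
  qed
  have tr1: "(\<Sum>j<b. Re (?M $$ (j, j))) = 1"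
  proof -
    have "tr ?M = (\<Sum>j<b. ?M $$ (j, j))" by (simp add: tr_def sum_mat_def)
    then show ?thesis using M by (metis Re_sum density_def one_complex.sel(1))
  qed
  have "vn_entropy ?M \<le> - (\<Sum>j<b. Re (?M $$ (j, j)) * log 2 (s j / t))"
    using s t by (intro vn_entropy_le_cross_entropy[OF M]) (auto simp flip: sum_divide_distrib)
  also have "\<dots> = log 2 t - (\<Sum>j<b. Re (?M $$ (j, j)) * log 2 (s j))"
  proof -
    have "(\<Sum>j<b. Re (?M $$ (j, j)) * log 2 (s j / t))
        = (\<Sum>j<b. Re (?M $$ (j, j)) * log 2 (s j) - Re (?M $$ (j, j)) * log 2 t)"
      using s t(1) by (intro sum.cong refl) (simp add: log_divide less_imp_neq[symmetric] right_diff_distrib)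
    also have "\<dots> = (\<Sum>j<b. Re (?M $$ (j, j)) * log 2 (s j)) - log 2 t"
      by (simp add: sum_subtractf tr1 flip: sum_distrib_right)
    finally show ?thesis by simp
  qed
  \<comment> \<open>Cross entropy is linear in the state, so that of the mixture is the average over
    the ensemble and cancels against the lower bounds for the single outputs.\<close>
  also have "(\<Sum>j<b. Re (?M $$ (j, j)) * log 2 (s j))
      = (\<Sum>i<k. p i * (\<Sum>j<b. Re (\<N> (\<rho> i) $$ (j, j)) * log 2 (s j)))"
  proof -
    have "(\<Sum>j<b. Re (?M $$ (j, j)) * log 2 (s j))
        = (\<Sum>j<b. \<Sum>i<k. p i * (Re (\<N> (\<rho> i) $$ (j, j)) * log 2 (s j)))"
      by (intro sum.cong refl) (simp add: diag sum_distrib_right mult.assoc)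
    then show ?thesis by (subst (asm) sum.swap) (simp add: sum_distrib_left)
  qed
  finally have 1: "vn_entropy ?M \<le> log 2 t - (\<Sum>i<k. p i * (\<Sum>j<b. Re (\<N> (\<rho> i) $$ (j, j)) * log 2 (s j)))" .
  have "- (\<Sum>j<b. Re (\<N> (\<rho> i) $$ (j, j)) * log 2 (s j)) \<le> vn_entropy (\<N> (\<rho> i))" if "i < k" for i
  proof (rule vn_entropy_ge_cross_entropy[OF dens[OF that] s])
    show "Re (quad b (\<N> (\<rho> i)) x) \<le> (\<Sum>i<b. s i * (cmod (x i))\<^sup>2)" for x
      using beta_feasible_dominates[OF N feas \<rho>[OF that], of x] by (simp add: quad_real_diag)
  qed
  then have "(\<Sum>i<k. p i * - (\<Sum>j<b. Re (\<N> (\<rho> i) $$ (j, j)) * log 2 (s j))) \<le> (\<Sum>i<k. p i * vn_entropy (\<N> (\<rho> i)))"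
    using p(1) by (intro sum_mono mult_left_mono) auto
  then show ?thesis using 1 by (simp add: sum_negf)
qed

section \<open>Codes\<close>

text \<open>The pairing is \<open>Tr (X\<^sup>T Y)\<close>, without conjugation, as in the definition of the code channel.\<close>

definition pairing :: "nat \<Rightarrow> complex mat \<Rightarrow> complex mat \<Rightarrow> complex" where
  "pairing d X Y = (\<Sum>r<d. \<Sum>s<d. X $$ (r, s) * Y $$ (r, s))"

section \<open>Pairings and the converse for codes\<close>

lemma pairing_ptranspose:
  "pairing (a * b) (ptranspose a b X) (ptranspose a b Y) = pairing (a * b) X Y"
proof -
  have "pairing (a * b) (ptranspose a b X) (ptranspose a b Y)
      = (\<Sum>i<a. \<Sum>k<b. \<Sum>j<a. \<Sum>l<b. X $$ (i * b + l, j * b + k) * Y $$ (i * b + l, j * b + k))"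
    unfolding pairing_def sum_lessThan_mult by (intro sum.cong refl) (simp add: ptranspose_index)
  also have "\<dots> = (\<Sum>i<a. \<Sum>l<b. \<Sum>j<a. \<Sum>k<b. X $$ (i * b + l, j * b + k) * Y $$ (i * b + l, j * b + k))"
    by (rule sum.cong[OF refl], subst sum_rotate, rule sum.swap)
  finally show ?thesis unfolding pairing_def sum_lessThan_mult .
qed

lemma ptranspose_ptranspose:
  assumes "X \<in> carrier_mat (a * b) (a * b)"
  shows "ptranspose a b (ptranspose a b X) = X"
proof (rule eq_matI)
  fix r s assume "r < dim_row X" "s < dim_col X"
  then have "r < a * b" "s < a * b" using assms by auto
  then show "ptranspose a b (ptranspose a b X) $$ (r, s) = X $$ (r, s)"
    by (elim pair_cases) (simp add: ptranspose_index)
qed (use assms in \<open>auto simp: ptranspose_def\<close>)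

lemma pairing_mono:
  assumes "loewner_le d A B" "psd d Z"
  shows "Re (pairing d A Z) \<le> Re (pairing d B Z)"
proof -
  from assms(1) have c: "A \<in> carrier_mat d d" "B \<in> carrier_mat d d" and p: "psd d (B - A)"
    by (auto simp: loewner_le_def)
  have "0 \<le> pairing d (B - A) Z"
    unfolding pairing_def by (rule psd_pairing_nonneg[OF p assms(2)])
  also have "pairing d (B - A) Z = pairing d B Z - pairing d A Z"
    using c by (simp add: pairing_def algebra_simps sum_subtractf)
  finally show ?thesis by (simp add: less_eq_complex_def)
qed

lemma pairing_one_kron:
  assumes "S \<in> carrier_mat b b"
  shows "pairing (a * b) (1\<^sub>m a \<otimes>\<^sub>K S) Z = (\<Sum>k<b. \<Sum>l<b. S $$ (k, l) * (\<Sum>i<a. Z $$ (i * b + k, i * b + l)))"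
proof -
  have "pairing (a * b) (1\<^sub>m a \<otimes>\<^sub>K S) Z
      = (\<Sum>i<a. \<Sum>k<b. \<Sum>j<a. if i = j then \<Sum>l<b. S $$ (k, l) * Z $$ (i * b + k, j * b + l) else 0)"
    unfolding pairing_def sum_lessThan_mult by (intro sum.cong refl) (simp add: one_kron_index[OF assms])
  also have "\<dots> = (\<Sum>i<a. \<Sum>k<b. \<Sum>l<b. S $$ (k, l) * Z $$ (i * b + k, i * b + l))"
    by simp
  also have "\<dots> = (\<Sum>k<b. \<Sum>l<b. S $$ (k, l) * (\<Sum>i<a. Z $$ (i * b + k, i * b + l)))"
    by (subst sum_rotate) (simp only: sum_distrib_left)
  finally show ?thesis .
qed

lemma psd_pullback:
  assumes X: "psd d X" and M: "M \<in> carrier_mat n n" and f: "\<And>r. r < n \<Longrightarrow> f r < d"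
    and eq: "\<And>r s. r < n \<Longrightarrow> s < n \<Longrightarrow> M $$ (r, s) = X $$ (f r, f s)"
  shows "psd n M"
proof -
  obtain w where w: "\<And>r s. r < d \<Longrightarrow> s < d \<Longrightarrow> X $$ (r, s) = (\<Sum>i<d. w i r * cnj (w i s))"
    using psd_gram[OF X] by blast
  show ?thesis
    by (rule psdI_gram[OF M, where w = "\<lambda>i r. w i (f r)" and I = "{..<d}"]) (simp add: eq w f)
qed

lemma mat_mult_index:
  assumes "A \<in> carrier_mat n p" "B \<in> carrier_mat p q" "i < n" "j < q"
  shows "(A * B) $$ (i, j) = (\<Sum>t<p. A $$ (i, t) * B $$ (t, j))"
  using assms by (simp add: scalar_prod_def atLeast0LessThan)

lemma tr_mult_ketbra:
  assumes "M \<in> carrier_mat m m" "k < m"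
  shows "tr (M * ketbra m k k) = M $$ (k, k)"
proof -
  have "tr (M * ketbra m k k) = (\<Sum>i<m. \<Sum>j<m. if j = k then if i = k then M $$ (i, j) else 0 else 0)"
    using assms unfolding tr_def
    by (intro sum.cong) (auto simp: mat_mult_index[OF assms(1) ketbra_carrier] ketbra_index if_distrib[of "(*) _"] cong: if_cong)
  then show ?thesis using assms by simp
qed

lemma of_choi_ketbra_index:
  assumes X: "X \<in> carrier_mat (a * b) (a * b)" and k: "k < a" and l: "l < b"
  shows "of_choi a b X (ketbra a k k) $$ (l, l) = X $$ (k * b + l, k * b + l)"
proof -
  let ?K = "(ketbra a k k)\<^sup>T"
  have K: "?K \<in> carrier_mat a a" by simp
  have Ki: "?K $$ (t, i) = (if t = k \<and> i = k then 1 else 0)" if "t < a" "i < a" for t i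
    using that by (simp add: ketbra_def)
  have KI: "?K \<otimes>\<^sub>K 1\<^sub>m b \<in> carrier_mat (a * b) (a * b)" using kron_carrier[OF K one_carrier_mat] .
  have "of_choi a b X (ketbra a k k) $$ (0 * b + l, 0 * b + l)
      = (\<Sum>t<a. ((?K \<otimes>\<^sub>K 1\<^sub>m b) * X) $$ ((0 * a + t) * b + l, (0 * a + t) * b + l))"
    unfolding of_choi_def by (rule ptrace_index) (use l in auto)
  also have "\<dots> = (\<Sum>t<a. \<Sum>i<a. \<Sum>j<b. (?K \<otimes>\<^sub>K 1\<^sub>m b) $$ (t * b + l, i * b + j) * X $$ (i * b + j, t * b + l))"
    using l by (intro sum.cong refl) (simp add: mat_mult_index[OF KI X] pair_less sum_lessThan_mult)
  also have "\<dots> = (\<Sum>t<a. \<Sum>i<a. \<Sum>j<b. if j = l then if i = k then if t = k then X $$ (i * b + j, t * b + l) else 0 else 0 else 0)"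
    using k l by (intro sum.cong refl) (auto simp: kron_index[OF K one_carrier_mat] Ki)
  also have "\<dots> = X $$ (k * b + l, k * b + l)"
    using k l by simp
  finally show ?thesis by simp
qed

text \<open>The block of \<open>Z\<close> in which both the message and the decoded value are \<open>k\<close>.\<close>

definition code_block :: "nat \<Rightarrow> nat \<Rightarrow> nat \<Rightarrow> complex mat \<Rightarrow> nat \<Rightarrow> complex mat" where
  "code_block a b m Z k = mat (a * b) (a * b)
    (\<lambda>(p, q). Z $$ (k * (a * b * m) + (p * m + k), k * (a * b * m) + (q * m + k)))"

lemma code_block_carrier [simp]: "code_block a b m Z k \<in> carrier_mat (a * b) (a * b)"
  by (simp add: code_block_def)

lemma code_block_index:
  assumes "x < a" "y < b" "x' < a" "y' < b"
  shows "code_block a b m Z k $$ (x * b + y, x' * b + y')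
    = Z $$ (((k * a + x) * b + y) * m + k, ((k * a + x') * b + y') * m + k)"
proof -
  have "k * (a * b * m) + ((u * b + v) * m + k) = ((k * a + u) * b + v) * m + k" for u v
    by (simp add: algebra_simps)
  moreover have "code_block a b m Z k $$ (x * b + y, x' * b + y')
      = Z $$ (k * (a * b * m) + ((x * b + y) * m + k), k * (a * b * m) + ((x' * b + y') * m + k))"
    using assms by (simp add: code_block_def pair_less)
  ultimately show ?thesis by (simp only:)
qed

text \<open>Feeding in |k><k| and reading the entry (k, k) fixes message and decoded value. The
  transpose on the Choi matrix in \<open>code_channel\<close> makes the remaining trace an
  unconjugated pairing, whose two arguments can be partially transposed together.\<close>

lemma code_channel_success:
  assumes Z: "Z \<in> carrier_mat (m * a * b * m) (m * a * b * m)" and k: "k < m"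
  shows "tr (code_channel a b \<N> m Z (ketbra m k k) * ketbra m k k)
    = pairing (a * b) (choi a b \<N>) (code_block a b m Z k)"
proof -
  let ?J = "(choi a b \<N>)\<^sup>T"
  let ?W = "1\<^sub>m m \<otimes>\<^sub>K ?J \<otimes>\<^sub>K 1\<^sub>m m"
  have J: "?J \<in> carrier_mat (a * b) (a * b)" by simp
  have J1: "?J \<otimes>\<^sub>K 1\<^sub>m m \<in> carrier_mat (a * b * m) (a * b * m)" by (rule kron_carrier[OF J one_carrier_mat])
  have W: "?W \<in> carrier_mat (m * (a * b * m)) (m * (a * b * m))" by (rule kron_carrier[OF one_carrier_mat J1])
  have Z': "Z \<in> carrier_mat (m * (a * b * m)) (m * (a * b * m))" using Z by (simp add: mult.assoc)
  have lt: "p * m + k < a * b * m" if "p < a * b" for p using that k by (rule pair_less)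
  have "tr (code_channel a b \<N> m Z (ketbra m k k) * ketbra m k k) = code_channel a b \<N> m Z (ketbra m k k) $$ (k, k)"
    by (rule tr_mult_ketbra[OF _ k]) (simp add: code_channel_def of_choi_def ptrace_def)
  also have "\<dots> = ptrace m (a * b) m (?W * Z) $$ (k * m + k, k * m + k)"
    unfolding code_channel_def by (rule of_choi_ketbra_index[OF ptrace_carrier k k])
  also have "\<dots> = (\<Sum>t<a * b. (?W * Z) $$ ((k * (a * b) + t) * m + k, (k * (a * b) + t) * m + k))"
    by (rule ptrace_index[OF k k k k])
  also have "\<dots> = (\<Sum>t<a * b. (?W * Z) $$ (k * (a * b * m) + (t * m + k), k * (a * b * m) + (t * m + k)))"
    by (simp add: algebra_simps)
  also have "\<dots> = (\<Sum>t<a * b. \<Sum>i<m. \<Sum>p<a * b. \<Sum>j<m. ?W $$ (k * (a * b * m) + (t * m + k), i * (a * b * m) + (p * m + j))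
      * Z $$ (i * (a * b * m) + (p * m + j), k * (a * b * m) + (t * m + k)))"
  proof (rule sum.cong[OF refl])
    fix t assume "t \<in> {..<a * b}"
    then have "k * (a * b * m) + (t * m + k) < m * (a * b * m)"
      by (intro pair_less[OF k] lt) simp
    from mat_mult_index[OF W Z' this this]
    show "(?W * Z) $$ (k * (a * b * m) + (t * m + k), k * (a * b * m) + (t * m + k))
      = (\<Sum>i<m. \<Sum>p<a * b. \<Sum>j<m. ?W $$ (k * (a * b * m) + (t * m + k), i * (a * b * m) + (p * m + j))
      * Z $$ (i * (a * b * m) + (p * m + j), k * (a * b * m) + (t * m + k)))"
      unfolding sum_lessThan_mult[of _ m "a * b * m"] sum_lessThan_mult[of _ "a * b" m] .
  qed
  also have "\<dots> = (\<Sum>t<a * b. \<Sum>i<m. \<Sum>p<a * b. \<Sum>j<m. if i = k then if j = k then choi a b \<N> $$ (p, t)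
      * code_block a b m Z k $$ (p, t) else 0 else 0)"
  proof (intro sum.cong refl)
    fix t i p j assume *: "t \<in> {..<a * b}" "i \<in> {..<m}" "p \<in> {..<a * b}" "j \<in> {..<m}"
    then have "?W $$ (k * (a * b * m) + (t * m + k), i * (a * b * m) + (p * m + j))
        = (if k = i then 1 else 0) * (?J $$ (t, p) * (if k = j then 1 else 0))"
      using k by (simp add: kron_index[OF one_carrier_mat J1] kron_index[OF J one_carrier_mat] pair_less)
    then show "?W $$ (k * (a * b * m) + (t * m + k), i * (a * b * m) + (p * m + j))
        * Z $$ (i * (a * b * m) + (p * m + j), k * (a * b * m) + (t * m + k))
      = (if i = k then if j = k then choi a b \<N> $$ (p, t) * code_block a b m Z k $$ (p, t) else 0 else 0)"
      using * carrier_matD[OF choi_carrier[of a b \<N>]] by (auto simp: code_block_def)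
  qed
  also have "\<dots> = (\<Sum>t<a * b. \<Sum>p<a * b. choi a b \<N> $$ (p, t) * code_block a b m Z k $$ (p, t))"
    using k by (simp add: sum_if_const)
  also have "\<dots> = pairing (a * b) (choi a b \<N>) (code_block a b m Z k)"
    unfolding pairing_def by (rule sum.swap)
  finally show ?thesis .
qed

lemma psd_code_block:
  assumes "psd (m * a * b * m) Z" "k < m"
  shows "psd (a * b) (code_block a b m Z k)"
proof (rule psd_pullback[OF assms(1) code_block_carrier])
  fix p assume "p < a * b"
  then have "k * (a * b * m) + (p * m + k) < m * (a * b * m)"
    using assms(2) by (simp add: pair_less)
  then show "k * (a * b * m) + (p * m + k) < m * a * b * m" by (simp add: mult.assoc)
qed (simp add: code_block_def)

text \<open>A block has the indices of \<open>A_i\<close> and \<open>B_o\<close> equal to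
  \<open>k\<close> on both sides, so transposing \<open>B_i\<close> and \<open>B_o\<close> acts on
  it as the transpose of \<open>B_i\<close> alone. The PPT condition on the code thus passes to the
  block.\<close>

lemma psd_ptranspose_code_block:
  assumes Z: "psd (m * a * b * m) (ptranspose (m * a) (b * m) Z)" and k: "k < m"
  shows "psd (a * b) (ptranspose a b (code_block a b m Z k))"
proof (rule psd_pullback[OF Z ptranspose_carrier])
  let ?f = "\<lambda>p. (k * a + p div b) * (b * m) + (p mod b * m + k)"
  have lt: "k * a + x < m * a" "y * m + k < b * m" if "x < a" "y < b" for x y
    by (rule pair_less[OF k that(1)], rule pair_less[OF that(2) k])
  fix p assume "p < a * b"
  then obtain x y where xy: "x < a" "y < b" and p: "p = x * b + y" by (rule pair_cases)
  have "(k * a + x) * (b * m) + (y * m + k) < m * a * (b * m)"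
    by (intro pair_less k xy)
  then show "?f p < m * a * b * m" using xy by (simp add: p mult.assoc)
  fix q assume "q < a * b"
  then obtain x' y' where xy': "x' < a" "y' < b" and q: "q = x' * b + y'" by (rule pair_cases)
  have "ptranspose (m * a) (b * m) Z $$ (?f p, ?f q)
      = Z $$ ((k * a + x) * (b * m) + (y' * m + k), (k * a + x') * (b * m) + (y * m + k))"
    using xy xy' by (simp add: p q ptranspose_index[OF lt[OF xy] lt[OF xy']])
  also have "\<dots> = code_block a b m Z k $$ (x * b + y', x' * b + y)"
    using xy xy' by (subst code_block_index) (simp_all add: algebra_simps)
  finally show "ptranspose a b (code_block a b m Z k) $$ (p, q) = ptranspose (m * a) (b * m) Z $$ (?f p, ?f q)"
    using xy xy' by (simp add: p q ptranspose_index)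
qed

lemma ptrace_index_right:
  assumes "r < a" "s < a"
  shows "ptrace a b 1 X $$ (r, s) = (\<Sum>t<b. X $$ (r * b + t, s * b + t))"
  using ptrace_index[of r a 0 1 s 0 b X] assms by simp

lemma ptrace_index_left:
  assumes "k < c" "l < c"
  shows "ptrace 1 b c X $$ (k, l) = (\<Sum>t<b. X $$ (t * c + k, t * c + l))"
  using ptrace_index[of 0 1 k c 0 l b X] assms by simp

text \<open>No signalling from A to B makes the marginal on \<open>A_i B_i B_o\<close> independent
  of the message, so its block at message \<open>k\<close> may be replaced by the average over all
  messages. Summing over \<open>k\<close> then traces out \<open>B_o\<close> completely, and the
  normalisation \<open>Z_AiBi = 1\<close> leaves the identity on \<open>B_i\<close>.\<close>

lemma sum_code_block_marginal:
  assumes code: "ns_ppt_code a b m Z" and m: "0 < m" and yz: "y < b" "y' < b"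
  shows "(\<Sum>k<m. \<Sum>x<a. code_block a b m Z k $$ (x * b + y, x * b + y')) = (if y = y' then 1 else 0)"
proof -
  define E where "E = ptrace (m * a * b) m 1 Z"
  define F where "F = ptrace m a (b * m) Z"
  define G where "G = ptrace 1 m (b * m) F"
  from code have EI: "ptrace m a b E = 1\<^sub>m (m * b)"
    and FG: "F = ((1 / of_nat m) \<cdot>\<^sub>m 1\<^sub>m m) \<otimes>\<^sub>K G"
    unfolding ns_ppt_code_def Let_def E_def F_def G_def by blast+
  have lt: "y * m + k < b * m" "y' * m + k < b * m" if "k < m" for k
    using that yz by (simp_all add: pair_less)
  have F: "F $$ (i * (b * m) + (y * m + k), i * (b * m) + (y' * m + k))
      = (\<Sum>x<a. Z $$ ((i * a + x) * (b * m) + (y * m + k), (i * a + x) * (b * m) + (y' * m + k)))"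
    if "i < m" "k < m" for i k
    unfolding F_def by (rule ptrace_index) (use that lt in auto)
  have block: "(\<Sum>x<a. code_block a b m Z k $$ (x * b + y, x * b + y'))
      = F $$ (k * (b * m) + (y * m + k), k * (b * m) + (y' * m + k))" if "k < m" for k
    unfolding F[OF that that] using yz by (intro sum.cong refl) (subst code_block_index, simp_all add: algebra_simps)
  have G: "G \<in> carrier_mat (b * m) (b * m)" unfolding G_def using ptrace_carrier[of 1 m "b * m"] by simp
  have FG': "F $$ (k * (b * m) + (y * m + k), k * (b * m) + (y' * m + k)) = (1 / of_nat m) * G $$ (y * m + k, y' * m + k)"
    if "k < m" for k
  proof -
    have sm: "(1 / of_nat m) \<cdot>\<^sub>m 1\<^sub>m m \<in> carrier_mat m m" by simp
    show ?thesis unfolding FG kron_index[OF sm G that lt(1)[OF that] that lt(2)[OF that]] using that by simp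
  qed
  have "(\<Sum>k<m. G $$ (y * m + k, y' * m + k))
      = (\<Sum>k<m. \<Sum>i<m. F $$ (i * (b * m) + (y * m + k), i * (b * m) + (y' * m + k)))"
    unfolding G_def by (intro sum.cong refl ptrace_index_left) (use lt in auto)
  also have "\<dots> = (\<Sum>k<m. \<Sum>i<m. \<Sum>x<a. Z $$ ((i * a + x) * (b * m) + (y * m + k), (i * a + x) * (b * m) + (y' * m + k)))"
    by (intro sum.cong refl F) auto
  also have "\<dots> = (\<Sum>i<m. \<Sum>x<a. \<Sum>k<m. Z $$ ((i * a + x) * (b * m) + (y * m + k), (i * a + x) * (b * m) + (y' * m + k)))"
    by (rule sum_rotate)
  also have "\<dots> = (\<Sum>i<m. \<Sum>x<a. E $$ ((i * a + x) * b + y, (i * a + x) * b + y'))"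
  proof (intro sum.cong refl)
    fix i x assume "i \<in> {..<m}" "x \<in> {..<a}"
    then have "(i * a + x) * b + y < m * a * b" "(i * a + x) * b + y' < m * a * b"
      using yz by (simp_all add: pair_less)
    then show "(\<Sum>k<m. Z $$ ((i * a + x) * (b * m) + (y * m + k), (i * a + x) * (b * m) + (y' * m + k)))
        = E $$ ((i * a + x) * b + y, (i * a + x) * b + y')"
      unfolding E_def by (subst ptrace_index_right) (simp_all add: algebra_simps)
  qed
  also have "\<dots> = (\<Sum>i<m. ptrace m a b E $$ (i * b + y, i * b + y'))"
    using yz by (intro sum.cong refl ptrace_index[symmetric]) auto
  also have "\<dots> = of_nat m * (if y = y' then 1 else 0)"
    unfolding EI using yz by (simp add: pair_less)
  finally have "(\<Sum>k<m. G $$ (y * m + k, y' * m + k)) = of_nat m * (if y = y' then 1 else 0)" .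
  moreover have "(\<Sum>k<m. \<Sum>x<a. code_block a b m Z k $$ (x * b + y, x * b + y'))
      = (\<Sum>k<m. (1 / of_nat m) * G $$ (y * m + k, y' * m + k))"
    by (intro sum.cong refl) (simp add: block FG')
  ultimately show ?thesis using m by (simp flip: sum_divide_distrib)
qed

text \<open>For each block, J^T_B <= R is paired with the positive partial transpose of the block.
  Both arguments are then transposed, and R^T_B <= 1 (x) S is paired with the block itself. Summed
  over the messages, the blocks have marginal identity on \<open>B_i\<close>, so the bound becomes
  the trace of \<open>S\<close>.\<close>

lemma ns_ppt_code_converse:
  assumes code: "ns_ppt_code a b m Z" and feas: "beta_feasible a b (choi a b \<N>) S R" and m: "0 < m"
  shows "(\<Sum>k<m. Re (tr (code_channel a b \<N> m Z (ketbra m k k) * ketbra m k k))) \<le> Re (tr S)"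
proof -
  let ?J = "choi a b \<N>" and ?Z = "code_block a b m Z"
  from code have Z: "psd (m * a * b * m) Z" and ZT: "psd (m * a * b * m) (ptranspose (m * a) (b * m) Z)"
    unfolding ns_ppt_code_def Let_def by blast+
  from feas have S: "S \<in> carrier_mat b b" by (simp add: beta_feasible_def hermitian_def)
  have "Re (tr (code_channel a b \<N> m Z (ketbra m k k) * ketbra m k k))
      \<le> Re (pairing (a * b) (1\<^sub>m a \<otimes>\<^sub>K S) (?Z k))" if k: "k < m" for k
  proof -
    have "Re (tr (code_channel a b \<N> m Z (ketbra m k k) * ketbra m k k))
        = Re (pairing (a * b) (ptranspose a b ?J) (ptranspose a b (?Z k)))"
      by (simp add: code_channel_success[OF psd_carrier[OF Z] k] pairing_ptranspose)
    also have "\<dots> \<le> Re (pairing (a * b) R (ptranspose a b (?Z k)))"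
      using feas by (intro pairing_mono psd_ptranspose_code_block[OF ZT k]) (simp add: beta_feasible_def)
    also have "pairing (a * b) R (ptranspose a b (?Z k)) = pairing (a * b) (ptranspose a b R) (?Z k)"
      using pairing_ptranspose[of a b R "ptranspose a b (?Z k)"] by (simp add: ptranspose_ptranspose)
    also have "Re \<dots> \<le> Re (pairing (a * b) (1\<^sub>m a \<otimes>\<^sub>K S) (?Z k))"
      using feas by (intro pairing_mono psd_code_block[OF Z k]) (simp add: beta_feasible_def)
    finally show ?thesis .
  qed
  then have "(\<Sum>k<m. Re (tr (code_channel a b \<N> m Z (ketbra m k k) * ketbra m k k)))
      \<le> (\<Sum>k<m. Re (pairing (a * b) (1\<^sub>m a \<otimes>\<^sub>K S) (?Z k)))"
    by (intro sum_mono) auto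
  also have "\<dots> = Re (\<Sum>k<m. \<Sum>y<b. \<Sum>y'<b. S $$ (y, y') * (\<Sum>x<a. ?Z k $$ (x * b + y, x * b + y')))"
    by (simp only: Re_sum pairing_one_kron[OF S])
  also have "(\<Sum>k<m. \<Sum>y<b. \<Sum>y'<b. S $$ (y, y') * (\<Sum>x<a. ?Z k $$ (x * b + y, x * b + y')))
      = (\<Sum>y<b. \<Sum>y'<b. S $$ (y, y') * (\<Sum>k<m. \<Sum>x<a. ?Z k $$ (x * b + y, x * b + y')))"
    by (subst sum_rotate) (simp only: sum_distrib_left)
  also have "\<dots> = (\<Sum>y<b. \<Sum>y'<b. if y = y' then S $$ (y, y') else 0)"
    by (intro sum.cong refl) (simp add: sum_code_block_marginal[OF code m])
  also have "\<dots> = tr S" using S by (simp add: tr_def)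
  finally show ?thesis .
qed

section \<open>Zero-error classical codes\<close>

text \<open>
  The diagonal matrix \<open>\<Sum>\<^sub>i\<^sub>,\<^sub>y |i\<rangle>\<langle>i| \<otimes> |enc i\<rangle>\<langle>enc i| \<otimes> |y\<rangle>\<langle>y| \<otimes> |dec y\<rangle>\<langle>dec y|\<close>: prepare the basis state \<open>enc i\<close>,
  measure in the basis, and output \<open>dec y\<close>.
\<close>

definition classical_code :: "nat \<Rightarrow> nat \<Rightarrow> nat \<Rightarrow> (nat \<Rightarrow> nat) \<Rightarrow> (nat \<Rightarrow> nat) \<Rightarrow> complex mat" where
  "classical_code a b m enc dec = mat (m * a * b * m) (m * a * b * m)
    (\<lambda>(r, s). if r = s \<and> r div m div b mod a = enc (r div m div b div a) \<and> r mod m = dec (r div m mod b)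
      then 1 else 0)"

lemma quadruple_eq_iff:
  fixes i x y z :: nat
  assumes "x < a" "x' < a" "y < b" "y' < b" "z < c" "z' < c"
  shows "((i * a + x) * b + y) * c + z = ((i' * a + x') * b + y') * c + z' \<longleftrightarrow> i = i' \<and> x = x' \<and> y = y' \<and> z = z'"
proof -
  have pair: "p * n + q = p' * n + q' \<longleftrightarrow> p = p' \<and> q = q'" if "q < n" "q' < n" for p q p' q' n :: nat
  proof
    assume "p * n + q = p' * n + q'"
    then have "(p * n + q) div n = (p' * n + q') div n" "(p * n + q) mod n = (p' * n + q') mod n" by simp_all
    then show "p = p' \<and> q = q'" using that by simp
  qed simp
  show ?thesis using assms by (simp add: pair)
qed

lemma classical_code_index:
  assumes "i < m" "x < a" "y < b" "z < m" "i' < m" "x' < a" "y' < b" "z' < m"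
  shows "classical_code a b m enc dec $$ (((i * a + x) * b + y) * m + z, ((i' * a + x') * b + y') * m + z')
    = (if i = i' \<and> x = x' \<and> y = y' \<and> z = z' \<and> x = enc i \<and> z = dec y then 1 else 0)"
  using assms quadruple_eq_iff[of x a x' y b y' z m z' i i'] by (simp add: classical_code_def pair_less)

lemma quadruple_cases:
  fixes m a b r :: nat
  assumes "r < m * a * b * c"
  obtains i x y z where "i < m" "x < a" "y < b" "z < c" "r = ((i * a + x) * b + y) * c + z"
  using assms by (metis pair_cases)

text \<open>A diagonal 0/1 matrix is positive and equal to its partial transpose. In every marginal
  a sum over an output index meets exactly one admissible value, since \<open>enc\<close> and
  \<open>dec\<close> are functions with values in range.\<close>

lemma ns_ppt_classical_code:
  assumes enc: "\<And>i. i < m \<Longrightarrow> enc i < a" and dec: "\<And>y. y < b \<Longrightarrow> dec y < m" and m: "0 < m"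
  shows "ns_ppt_code a b m (classical_code a b m enc dec)"
proof -
  let ?Z = "classical_code a b m enc dec"
  define good where "good r \<longleftrightarrow> r div m div b mod a = enc (r div m div b div a) \<and> r mod m = dec (r div m mod b)" for r
  have Zc: "?Z \<in> carrier_mat (m * a * b * m) (m * a * b * m)" by (simp add: classical_code_def)
  have psd: "psd (m * a * b * m) ?Z"
  proof (rule psdI_gram[OF Zc, where w = "\<lambda>j r. if r = j \<and> good r then 1 else 0" and I = "{..<m * a * b * m}"])
    fix r s assume rs: "r < m * a * b * m" "s < m * a * b * m"
    have "(\<Sum>j<m * a * b * m. (if r = j \<and> good r then 1 else 0) * cnj (if s = j \<and> good s then 1 else 0))
        = (\<Sum>j<m * a * b * m. if j = r then if r = s \<and> good r then 1 else 0 else (0 :: complex))"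
      by (intro sum.cong refl) auto
    also have "\<dots> = (if r = s \<and> good r then 1 else 0)" using rs(1) by simp
    finally show "?Z $$ (r, s)
        = (\<Sum>j<m * a * b * m. (if r = j \<and> good r then 1 else 0) * cnj (if s = j \<and> good s then 1 else 0))"
      using rs by (simp add: classical_code_def good_def)
  qed
  have pt: "ptranspose (m * a) (b * m) ?Z = ?Z"
  proof (rule eq_matI)
    fix r s assume "r < dim_row ?Z" "s < dim_col ?Z"
    then have "r < m * a * b * m" "s < m * a * b * m" by (simp_all add: classical_code_def)
    then obtain i x y z i' x' y' z' where *: "i < m" "x < a" "y < b" "z < m" "i' < m" "x' < a" "y' < b" "z' < m"
      and rs: "r = ((i * a + x) * b + y) * m + z" "s = ((i' * a + x') * b + y') * m + z'"
      by (metis quadruple_cases)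
    have r': "r = (i * a + x) * (b * m) + (y * m + z)" and s': "s = (i' * a + x') * (b * m) + (y' * m + z')"
      by (simp_all add: rs algebra_simps)
    have "ptranspose (m * a) (b * m) ?Z $$ (r, s)
        = ?Z $$ ((i * a + x) * (b * m) + (y' * m + z'), (i' * a + x') * (b * m) + (y * m + z))"
      unfolding r' s' by (rule ptranspose_index) (use * in \<open>simp_all add: pair_less\<close>)
    also have "\<dots> = ?Z $$ (((i * a + x) * b + y') * m + z', ((i' * a + x') * b + y) * m + z)"
      by (simp add: algebra_simps)
    also have "\<dots> = ?Z $$ (r, s)"
      unfolding rs using * by (auto simp: classical_code_index)
    finally show "ptranspose (m * a) (b * m) ?Z $$ (r, s) = ?Z $$ (r, s)" .
  qed (simp_all add: classical_code_def ptranspose_def)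
  define E where "E = ptrace (m * a * b) m 1 ?Z"
  define F where "F = ptrace m a (b * m) ?Z"
  define G where "G = ptrace 1 m (b * m) F"
  define H where "H = ptrace (m * a) b 1 E"
  have Eidx: "E $$ ((i * a + x) * b + y, (i' * a + x') * b + y')
      = (if i = i' \<and> x = x' \<and> y = y' \<and> x = enc i then 1 else 0)"
    if "i < m" "x < a" "y < b" "i' < m" "x' < a" "y' < b" for i x y i' x' y'
  proof -
    have "E $$ ((i * a + x) * b + y, (i' * a + x') * b + y')
        = (\<Sum>z<m. ?Z $$ (((i * a + x) * b + y) * m + z, ((i' * a + x') * b + y') * m + z))"
      unfolding E_def by (rule ptrace_index_right) (use that in \<open>simp_all add: pair_less\<close>)
    also have "\<dots> = (\<Sum>z<m. if z = dec y then if i = i' \<and> x = x' \<and> y = y' \<and> x = enc i then 1 else 0 else 0)"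
      using that by (intro sum.cong refl) (simp add: classical_code_index)
    finally show ?thesis using dec[OF that(3)] by simp
  qed
  have EI: "ptrace m a b E = 1\<^sub>m (m * b)"
  proof (rule eq_matI)
    fix r s assume "r < dim_row (1\<^sub>m (m * b) :: complex mat)" "s < dim_col (1\<^sub>m (m * b) :: complex mat)"
    then obtain i y i' y' where *: "i < m" "y < b" "i' < m" "y' < b" and rs: "r = i * b + y" "s = i' * b + y'"
      by (metis pair_cases index_one_mat(2,3))
    have "ptrace m a b E $$ (r, s) = (\<Sum>x<a. E $$ ((i * a + x) * b + y, (i' * a + x) * b + y'))"
      unfolding rs by (rule ptrace_index) (use * in auto)
    also have "\<dots> = (\<Sum>x<a. if x = enc i then if i = i' \<and> y = y' then 1 else 0 else 0)"
      using * by (intro sum.cong refl) (simp add: Eidx)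
    also have "\<dots> = (if i = i' \<and> y = y' then 1 else 0)" using enc[OF *(1)] by simp
    also have "\<dots> = (if r = s then 1 else 0)"
      \<comment> \<open>Factors of dimension 1 pad the pair of indices to a quadruple.\<close>
      using quadruple_eq_iff[of 0 1 0 y b y' 0 1 0 i i'] * by (simp add: rs)
    finally show "ptrace m a b E $$ (r, s) = 1\<^sub>m (m * b) $$ (r, s)"
      using * by (simp add: rs pair_less)
  qed (simp_all add: ptrace_def)
  have Fidx: "F $$ (i * (b * m) + (y * m + z), i' * (b * m) + (y' * m + z'))
      = (if i = i' \<and> y = y' \<and> z = z' \<and> z = dec y then 1 else 0)"
    if "i < m" "y < b" "z < m" "i' < m" "y' < b" "z' < m" for i y z i' y' z'
  proof -
    have "F $$ (i * (b * m) + (y * m + z), i' * (b * m) + (y' * m + z'))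
        = (\<Sum>x<a. ?Z $$ ((i * a + x) * (b * m) + (y * m + z), (i' * a + x) * (b * m) + (y' * m + z')))"
      unfolding F_def by (rule ptrace_index) (use that in \<open>simp_all add: pair_less\<close>)
    also have "\<dots> = (\<Sum>x<a. ?Z $$ (((i * a + x) * b + y) * m + z, ((i' * a + x) * b + y') * m + z'))"
      by (simp add: algebra_simps)
    also have "\<dots> = (\<Sum>x<a. if x = enc i then if i = i' \<and> y = y' \<and> z = z' \<and> z = dec y then 1 else 0 else 0)"
      using that by (intro sum.cong refl) (simp add: classical_code_index)
    finally show ?thesis using enc[OF that(1)] by simp
  qed
  have Gidx: "G $$ (y * m + z, y' * m + z') = (if y = y' \<and> z = z' \<and> z = dec y then of_nat m else 0)"
    if "y < b" "z < m" "y' < b" "z' < m" for y z y' z'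
  proof -
    have "G $$ (y * m + z, y' * m + z') = (\<Sum>i<m. F $$ (i * (b * m) + (y * m + z), i * (b * m) + (y' * m + z')))"
      unfolding G_def by (rule ptrace_index_left) (use that in \<open>simp_all add: pair_less\<close>)
    also have "\<dots> = (\<Sum>i<m. if y = y' \<and> z = z' \<and> z = dec y then 1 else 0)"
      using that by (intro sum.cong refl) (simp add: Fidx)
    finally show ?thesis by auto
  qed
  have Gc: "G \<in> carrier_mat (b * m) (b * m)" unfolding G_def using ptrace_carrier[of 1 m "b * m"] by simp
  have sm: "(1 / of_nat n) \<cdot>\<^sub>m 1\<^sub>m n \<in> carrier_mat n n" for n by simp
  have FG: "F = ((1 / of_nat m) \<cdot>\<^sub>m 1\<^sub>m m) \<otimes>\<^sub>K G"
  proof (rule eq_matI)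
    have c: "((1 / of_nat m) \<cdot>\<^sub>m 1\<^sub>m m) \<otimes>\<^sub>K G \<in> carrier_mat (m * (b * m)) (m * (b * m))"
      by (rule kron_carrier[OF sm Gc])
    show "dim_row F = dim_row (((1 / of_nat m) \<cdot>\<^sub>m 1\<^sub>m m) \<otimes>\<^sub>K G)"
      "dim_col F = dim_col (((1 / of_nat m) \<cdot>\<^sub>m 1\<^sub>m m) \<otimes>\<^sub>K G)"
      using carrier_matD[OF c] by (simp_all add: F_def ptrace_def)
    fix r s assume "r < dim_row (((1 / of_nat m) \<cdot>\<^sub>m 1\<^sub>m m) \<otimes>\<^sub>K G)" "s < dim_col (((1 / of_nat m) \<cdot>\<^sub>m 1\<^sub>m m) \<otimes>\<^sub>K G)"
    then have "r < m * (b * m)" "s < m * (b * m)" using carrier_matD[OF c] by simp_all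
    then obtain i y z i' y' z' where *: "i < m" "y < b" "z < m" "i' < m" "y' < b" "z' < m"
      and rs: "r = i * (b * m) + (y * m + z)" "s = i' * (b * m) + (y' * m + z')"
      by (metis pair_cases)
    have lt: "y * m + z < b * m" "y' * m + z' < b * m" using * by (simp_all add: pair_less)
    show "F $$ (r, s) = (((1 / of_nat m) \<cdot>\<^sub>m 1\<^sub>m m) \<otimes>\<^sub>K G) $$ (r, s)"
      unfolding rs kron_index[OF sm Gc *(1) lt(1) *(4) lt(2)] Fidx[OF *] Gidx[OF *(2,3,5,6)]
      using * m by auto
  qed
  have Hidx: "H $$ (i * a + x, i' * a + x') = (if i = i' \<and> x = x' \<and> x = enc i then of_nat b else 0)"
    if "i < m" "x < a" "i' < m" "x' < a" for i x i' x'
  proof -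
    have "H $$ (i * a + x, i' * a + x') = (\<Sum>y<b. E $$ ((i * a + x) * b + y, (i' * a + x') * b + y))"
      unfolding H_def by (rule ptrace_index_right) (use that in \<open>simp_all add: pair_less\<close>)
    also have "\<dots> = (\<Sum>y<b. if i = i' \<and> x = x' \<and> x = enc i then 1 else 0)"
      using that by (intro sum.cong refl) (simp add: Eidx)
    finally show ?thesis by auto
  qed
  have Hc: "H \<in> carrier_mat (m * a) (m * a)" unfolding H_def using ptrace_carrier[of "m * a" b 1] by simp
  have EH: "E = H \<otimes>\<^sub>K ((1 / of_nat b) \<cdot>\<^sub>m 1\<^sub>m b)"
  proof (rule eq_matI)
    have c: "H \<otimes>\<^sub>K ((1 / of_nat b) \<cdot>\<^sub>m 1\<^sub>m b) \<in> carrier_mat (m * a * b) (m * a * b)"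
      by (rule kron_carrier[OF Hc sm])
    show "dim_row E = dim_row (H \<otimes>\<^sub>K ((1 / of_nat b) \<cdot>\<^sub>m 1\<^sub>m b))"
      "dim_col E = dim_col (H \<otimes>\<^sub>K ((1 / of_nat b) \<cdot>\<^sub>m 1\<^sub>m b))"
      using carrier_matD[OF c] by (simp_all add: E_def ptrace_def)
    fix r s assume "r < dim_row (H \<otimes>\<^sub>K ((1 / of_nat b) \<cdot>\<^sub>m 1\<^sub>m b))" "s < dim_col (H \<otimes>\<^sub>K ((1 / of_nat b) \<cdot>\<^sub>m 1\<^sub>m b))"
    then have "r < m * a * b" "s < m * a * b" using carrier_matD[OF c] by simp_all
    then obtain i x y i' x' y' where *: "i < m" "x < a" "y < b" "i' < m" "x' < a" "y' < b"
      and rs: "r = (i * a + x) * b + y" "s = (i' * a + x') * b + y'"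
      by (metis pair_cases)
    have lt: "i * a + x < m * a" "i' * a + x' < m * a" using * by (simp_all add: pair_less)
    show "E $$ (r, s) = (H \<otimes>\<^sub>K ((1 / of_nat b) \<cdot>\<^sub>m 1\<^sub>m b)) $$ (r, s)"
      unfolding rs kron_index[OF Hc sm lt(1) *(3) lt(2) *(6)] Eidx[OF *] Hidx[OF *(1,2,4,5)]
      using * by auto
  qed
  show ?thesis
    unfolding ns_ppt_code_def Let_def pt E_def[symmetric] F_def[symmetric] G_def[symmetric] H_def[symmetric]
    using psd EI FG EH by blast
qed

text \<open>The pairing sums the probabilities of the outcomes that decode to \<open>k\<close>. All
  other outcomes have probability 0, so the sum may run over every outcome and equals 1 by trace
  preservation.\<close>

lemma classical_code_success:
  assumes J: "channel_choi a b (choi a b \<N>)"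
    and enc: "\<And>i. i < m \<Longrightarrow> enc i < a" and dec: "\<And>y. y < b \<Longrightarrow> dec y < m"
    and disj: "\<And>k y. k < m \<Longrightarrow> y < b \<Longrightarrow> dec y \<noteq> k \<Longrightarrow> choi a b \<N> $$ (enc k * b + y, enc k * b + y) = 0"
  shows "(\<Sum>k<m. Re (tr (code_channel a b \<N> m (classical_code a b m enc dec) (ketbra m k k) * ketbra m k k))) = m"
proof -
  let ?Z = "classical_code a b m enc dec"
  have Zc: "?Z \<in> carrier_mat (m * a * b * m) (m * a * b * m)" by (simp add: classical_code_def)
  have "tr (code_channel a b \<N> m ?Z (ketbra m k k) * ketbra m k k) = 1" if k: "k < m" for k
  proof -
    have block: "code_block a b m ?Z k $$ (x * b + y, x' * b + y')
        = (if x = x' then if y = y' then if x = enc k \<and> k = dec y then 1 else 0 else 0 else 0)"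
      if "x < a" "y < b" "x' < a" "y' < b" for x y x' y'
    proof -
      have "code_block a b m ?Z k $$ (x * b + y, x' * b + y')
          = ?Z $$ (((k * a + x) * b + y) * m + k, ((k * a + x') * b + y') * m + k)"
        using that by (rule code_block_index)
      then show ?thesis using that k by (auto simp: classical_code_index)
    qed
    have "tr (code_channel a b \<N> m ?Z (ketbra m k k) * ketbra m k k)
        = (\<Sum>x<a. \<Sum>y<b. \<Sum>x'<a. \<Sum>y'<b. choi a b \<N> $$ (x * b + y, x' * b + y')
          * (if x = x' then if y = y' then if x = enc k \<and> k = dec y then 1 else 0 else 0 else 0))"
      unfolding code_channel_success[OF Zc k] pairing_def sum_lessThan_mult
      by (intro sum.cong refl) (simp add: block)
    also have "\<dots> = (\<Sum>x<a. \<Sum>y<b. \<Sum>x'<a. \<Sum>y'<b. if x = x' then if y = y' then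
        if x = enc k then if k = dec y then choi a b \<N> $$ (x * b + y, x * b + y) else 0 else 0 else 0 else 0)"
      by (intro sum.cong refl) auto
    also have "\<dots> = (\<Sum>x<a. \<Sum>y<b. if x = enc k then if k = dec y then choi a b \<N> $$ (x * b + y, x * b + y) else 0 else 0)"
      by (simp add: sum_if_const)
    also have "\<dots> = (\<Sum>y<b. if k = dec y then choi a b \<N> $$ (enc k * b + y, enc k * b + y) else 0)"
      using enc[OF k] by (simp add: sum_if_const)
    also have "\<dots> = (\<Sum>y<b. choi a b \<N> $$ (enc k * b + y, enc k * b + y))"
      using disj[OF k] by (intro sum.cong refl) auto
    also have "\<dots> = 1" using J enc[OF k] by (simp add: channel_choi_def)
    finally show ?thesis .
  qed
  then show ?thesis by simp
qed

lemma f_ns_ppt_le: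
  assumes feas: "beta_feasible a b (choi a b \<N>) S R" and a: "0 < a" and m: "0 < m"
  shows "f_ns_ppt a b \<N> m \<le> Re (tr S) / real m"
  unfolding f_ns_ppt_def
proof (rule cSup_least)
  \<comment> \<open>A least upper bound argument needs a nonempty set; the constant encoder and
    decoder provide a code.\<close>
  have "ns_ppt_code a b m (classical_code a b m (\<lambda>_. 0) (\<lambda>_. 0))"
    using a m by (intro ns_ppt_classical_code) auto
  then show "{1 / real m * (\<Sum>k<m. Re (tr (code_channel a b \<N> m Z (ketbra m k k) * ketbra m k k))) | Z. ns_ppt_code a b m Z} \<noteq> {}"
    by blast
  fix x assume "x \<in> {1 / real m * (\<Sum>k<m. Re (tr (code_channel a b \<N> m Z (ketbra m k k) * ketbra m k k))) | Z. ns_ppt_code a b m Z}"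
  then obtain Z where "ns_ppt_code a b m Z"
    and x: "x = 1 / real m * (\<Sum>k<m. Re (tr (code_channel a b \<N> m Z (ketbra m k k) * ketbra m k k)))" by blast
  from ns_ppt_code_converse[OF this(1) feas m] show "x \<le> Re (tr S) / real m"
    unfolding x using m by (simp add: divide_right_mono)
qed

section \<open>Tensor powers\<close>

text \<open>For a Choi matrix \<open>J\<close>, the diagonal entry is the probability of outcome
  \<open>y\<close> on input \<open>enc k\<close>. The last condition says that \<open>dec\<close>
  never errs.\<close>

definition disjoint_code ::
  "nat \<Rightarrow> nat \<Rightarrow> nat \<Rightarrow> complex mat \<Rightarrow> (nat \<Rightarrow> nat) \<Rightarrow> (nat \<Rightarrow> nat) \<Rightarrow> bool" where
  "disjoint_code a b m J enc dec \<longleftrightarrow> (\<forall>k<m. enc k < a) \<and> (\<forall>y<b. dec y < m) \<and>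
    (\<forall>k<m. \<forall>y<b. dec y \<noteq> k \<longrightarrow> J $$ (enc k * b + y, enc k * b + y) = 0)"

text \<open>The zero-error code is a member of the set with value 1. The feasible pair supplies the
  upper bound that lets \<open>Sup\<close> dominate its members.\<close>

lemma f_ns_ppt_ge_1:
  assumes feas: "beta_feasible a b (choi a b \<N>) S R" and J: "channel_choi a b (choi a b \<N>)"
    and code: "disjoint_code a b m (choi a b \<N>) enc dec" and m: "0 < m"
  shows "1 \<le> f_ns_ppt a b \<N> m"
  unfolding f_ns_ppt_def
proof (rule cSup_upper)
  let ?Z = "classical_code a b m enc dec"
  have "ns_ppt_code a b m ?Z"
    using code m by (intro ns_ppt_classical_code) (auto simp: disjoint_code_def)
  moreover have "(\<Sum>k<m. Re (tr (code_channel a b \<N> m ?Z (ketbra m k k) * ketbra m k k))) = m"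
    using code by (intro classical_code_success[OF J]) (auto simp: disjoint_code_def)
  then have "1 = 1 / real m * (\<Sum>k<m. Re (tr (code_channel a b \<N> m ?Z (ketbra m k k) * ketbra m k k)))"
    using m by simp
  ultimately show "1 \<in> {1 / real m * (\<Sum>k<m. Re (tr (code_channel a b \<N> m Z (ketbra m k k) * ketbra m k k))) | Z. ns_ppt_code a b m Z}"
    by blast
  show "bdd_above {1 / real m * (\<Sum>k<m. Re (tr (code_channel a b \<N> m Z (ketbra m k k) * ketbra m k k))) | Z. ns_ppt_code a b m Z}"
  proof (rule bdd_aboveI)
    fix x assume "x \<in> {1 / real m * (\<Sum>k<m. Re (tr (code_channel a b \<N> m Z (ketbra m k k) * ketbra m k k))) | Z. ns_ppt_code a b m Z}"
    then obtain Z where "ns_ppt_code a b m Z"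
      and x: "x = 1 / real m * (\<Sum>k<m. Re (tr (code_channel a b \<N> m Z (ketbra m k k) * ketbra m k k)))" by blast
    from ns_ppt_code_converse[OF this(1) feas m] show "x \<le> Re (tr S) / real m"
      unfolding x using m by (simp add: divide_right_mono)
  qed
qed

text \<open>Message, input and outcome pairs are coded digit by digit. A wrong joint decoding has a
  wrong digit, and that factor of the diagonal entry vanishes.\<close>

lemma disjoint_code_bip_kron:
  assumes "disjoint_code a b m J enc dec" "disjoint_code a' b' m' J' enc' dec'"
  shows "disjoint_code (a * a') (b * b') (m * m') (bip_kron a b J a' b' J')
    (\<lambda>k. enc (k div m') * a' + enc' (k mod m')) (\<lambda>y. dec (y div b') * m' + dec' (y mod b'))"
  unfolding disjoint_code_def
proof (intro conjI allI impI)
  fix k assume "k < m * m'"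
  then obtain i i' where ii: "i < m" "i' < m'" and k: "k = i * m' + i'" by (rule pair_cases)
  then have enc: "enc i < a" "enc' i' < a'" using assms by (simp_all add: disjoint_code_def)
  then show "enc (k div m') * a' + enc' (k mod m') < a * a'"
    using ii by (simp add: k pair_less)
  fix y assume "y < b * b'" and ne: "dec (y div b') * m' + dec' (y mod b') \<noteq> k"
  then obtain z z' where zz: "z < b" "z' < b'" and y: "y = z * b' + z'" by (metis pair_cases)
  have "dec z \<noteq> i \<or> dec' z' \<noteq> i'" using ne ii zz by (auto simp: k y)
  then have "J $$ (enc i * b + z, enc i * b + z) = 0 \<or> J' $$ (enc' i' * b' + z', enc' i' * b' + z') = 0"
    using assms ii zz by (auto simp: disjoint_code_def)
  then show "bip_kron a b J a' b' J' $$ ((enc (k div m') * a' + enc' (k mod m')) * (b * b') + y,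
      (enc (k div m') * a' + enc' (k mod m')) * (b * b') + y) = 0"
    using ii zz enc by (auto simp: k y bip_kron_index)
next
  fix y assume "y < b * b'"
  then obtain z z' where zz: "z < b" "z' < b'" and y: "y = z * b' + z'" by (rule pair_cases)
  then have "dec z < m" "dec' z' < m'" using assms by (simp_all add: disjoint_code_def)
  then show "dec (y div b') * m' + dec' (y mod b') < m * m'"
    using zz by (simp add: y pair_less)
qed

lemma superop_power_dims: "superop_dims (a ^ n) (b ^ n) (superop_power a b \<N> n)"
proof (cases n)
  case 0
  then show ?thesis by (simp add: superop_dims_def)
next
  case (Suc n')
  then show ?thesis using superop_tensor_dims by simp
qed

lemma choi_superop_power_0: "choi (a ^ 0) (b ^ 0) (superop_power a b \<N> 0) = 1\<^sub>m 1"
proof (rule eq_matI)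
  have "choi 1 1 (\<lambda>X. X) $$ (0 * 1 + 0, 0 * 1 + 0) = ketbra 1 0 0 $$ (0, 0)"
    by (rule choi_index) (auto simp: superop_dims_def)
  then show "choi (a ^ 0) (b ^ 0) (superop_power a b \<N> 0) $$ (i, j) = 1\<^sub>m 1 $$ (i, j)"
    if "i < dim_row (1\<^sub>m 1 :: complex mat)" "j < dim_col (1\<^sub>m 1 :: complex mat)" for i j
    using that by (simp add: ketbra_index)
qed (simp_all add: choi_def sum_mat_def)

lemma choi_superop_power_Suc:
  assumes "superop_dims a b \<N>"
  shows "choi (a * a ^ n) (b * b ^ n) (superop_power a b \<N> (Suc n))
    = bip_kron a b (choi a b \<N>) (a ^ n) (b ^ n) (choi (a ^ n) (b ^ n) (superop_power a b \<N> n))"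
  using choi_superop_tensor[OF assms superop_power_dims] by simp

lemma superop_of_choi_superop_power:
  assumes "superop_dims a b \<N>" "n \<ge> 1"
  shows "superop_of_choi (a ^ n) (b ^ n) (superop_power a b \<N> n) (choi (a ^ n) (b ^ n) (superop_power a b \<N> n))"
proof -
  obtain n' where "n = Suc n'" using assms(2) by (cases n) auto
  then show ?thesis using superop_of_choi_tensor[OF assms(1) superop_power_dims] by simp
qed

lemma channel_choi_superop_power:
  assumes "superop_dims a b \<N>" "channel_choi a b (choi a b \<N>)"
  shows "channel_choi (a ^ n) (b ^ n) (choi (a ^ n) (b ^ n) (superop_power a b \<N> n))"
proof (induction n)
  case 0
  have "psd (1 * 1) (1\<^sub>m 1)"
    by (rule psdI_gram[where w = "\<lambda>_ _. 1" and I = "{()}"]) auto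
  then show ?case unfolding choi_superop_power_0 by (simp add: channel_choi_def)
next
  case (Suc n)
  then show ?case
    unfolding power_Suc choi_superop_power_Suc[OF assms(1)] by (rule channel_choi_bip_kron[OF assms(2)])
qed

lemma disjoint_code_superop_power:
  assumes "superop_dims a b \<N>" "disjoint_code a b m (choi a b \<N>) enc dec"
  shows "\<exists>enc dec. disjoint_code (a ^ n) (b ^ n) (m ^ n) (choi (a ^ n) (b ^ n) (superop_power a b \<N> n)) enc dec"
proof (induction n)
  case 0
  show ?case unfolding choi_superop_power_0
    by (intro exI[of _ "\<lambda>_. 0"]) (simp add: disjoint_code_def)
next
  case (Suc n)
  then show ?case
    unfolding power_Suc choi_superop_power_Suc[OF assms(1)] using disjoint_code_bip_kron[OF assms(2)] by blast
qed

lemma real_diag_kron: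
  "real_diag d f \<otimes>\<^sub>K real_diag e g = real_diag (d * e) (\<lambda>i. f (i div e) * g (i mod e))"
proof (rule eq_matI)
  have c: "real_diag d f \<in> carrier_mat d d" "real_diag e g \<in> carrier_mat e e" by (simp_all add: real_diag_def)
  fix r s assume "r < dim_row (real_diag (d * e) (\<lambda>i. f (i div e) * g (i mod e)))"
    "s < dim_col (real_diag (d * e) (\<lambda>i. f (i div e) * g (i mod e)))"
  then have "r < d * e" "s < d * e" by (simp_all add: real_diag_def)
  then obtain i k j l where *: "i < d" "k < e" "j < d" "l < e" and rs: "r = i * e + k" "s = j * e + l"
    by (metis pair_cases)
  show "(real_diag d f \<otimes>\<^sub>K real_diag e g) $$ (r, s) = real_diag (d * e) (\<lambda>i. f (i div e) * g (i mod e)) $$ (r, s)"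
    using * quadruple_eq_iff[of 0 1 0 k e l 0 1 0 i j]
    unfolding rs kron_index[OF c *] by (auto simp: real_diag_def pair_less)
qed (simp_all add: kron_def real_diag_def)

text \<open>Besides feasibility, the induction keeps \<open>S\<close> diagonal with positive
  entries, as the entropy bounds require, and tracks its trace, which is multiplicative.\<close>

lemma beta_feasible_superop_power:
  assumes N: "superop_dims a b \<N>" and feas: "beta_feasible a b (choi a b \<N>) (real_diag b s) R"
    and s: "\<And>i. i < b \<Longrightarrow> 0 < s i"
  shows "\<exists>s' R'. (\<forall>i<b ^ n. 0 < s' i) \<and> (\<Sum>i<b ^ n. s' i) = (\<Sum>i<b. s i) ^ n \<and>
    beta_feasible (a ^ n) (b ^ n) (choi (a ^ n) (b ^ n) (superop_power a b \<N> n)) (real_diag (b ^ n) s') R'"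
proof (induction n)
  case 0
  have one: "real_diag 1 (\<lambda>_. 1) = 1\<^sub>m 1" "ptranspose 1 1 (1\<^sub>m 1) = 1\<^sub>m 1" "1\<^sub>m 1 \<otimes>\<^sub>K 1\<^sub>m 1 = (1\<^sub>m 1 :: complex mat)"
    by (auto intro!: eq_matI simp: real_diag_def ptranspose_def kron_def)
  \<comment> \<open>The zeroth power has J = R = S = 1 in dimension 1. The entry here is 2, hence
    the Gram vector with entry \<open>sqrt 2\<close>.\<close>
  have "psd 1 (1\<^sub>m 1 - - 1\<^sub>m 1)"
    by (rule psdI_gram[where w = "\<lambda>_ _. of_real (sqrt 2)" and I = "{()}"]) (auto simp flip: of_real_mult)
  moreover have "psd 1 (1\<^sub>m 1 - 1\<^sub>m 1)"
    by (rule psdI_gram[where w = "\<lambda>_ _. 0" and I = "{()}"]) auto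
  ultimately have "loewner_le 1 (- 1\<^sub>m 1) (1\<^sub>m 1)" "loewner_le 1 (1\<^sub>m 1) (1\<^sub>m 1)"
    unfolding loewner_le_def by auto
  moreover have "hermitian 1 (1\<^sub>m 1)" by (simp add: hermitian_iff)
  ultimately have "beta_feasible 1 1 (1\<^sub>m 1) (real_diag 1 (\<lambda>_. 1)) (1\<^sub>m 1)"
    unfolding beta_feasible_def mult_1 one by blast
  then show ?case unfolding choi_superop_power_0
    by (intro exI[of _ "\<lambda>_. 1"] exI[of _ "1\<^sub>m 1"]) simp
next
  case (Suc n)
  then obtain s' R' where s': "\<forall>i<b ^ n. 0 < s' i" and tr: "(\<Sum>i<b ^ n. s' i) = (\<Sum>i<b. s i) ^ n"
    and feas': "beta_feasible (a ^ n) (b ^ n) (choi (a ^ n) (b ^ n) (superop_power a b \<N> n)) (real_diag (b ^ n) s') R'"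
    by blast
  let ?s = "\<lambda>i. s (i div b ^ n) * s' (i mod b ^ n)"
  have "beta_feasible (a ^ Suc n) (b ^ Suc n) (choi (a ^ Suc n) (b ^ Suc n) (superop_power a b \<N> (Suc n)))
      (real_diag (b ^ Suc n) ?s) (bip_kron a b R (a ^ n) (b ^ n) R')"
    using beta_feasible_bip_kron[OF feas feas'] unfolding power_Suc choi_superop_power_Suc[OF N] real_diag_kron .
  moreover have "\<forall>i<b ^ Suc n. 0 < ?s i"
  proof (intro allI impI)
    fix i assume "i < b ^ Suc n"
    then have "i < b * b ^ n" by simp
    then obtain j k where "j < b" "k < b ^ n" "i = j * b ^ n + k" by (rule pair_cases)
    then show "0 < ?s i" using s s' by simp
  qed
  moreover have "(\<Sum>i<b ^ Suc n. ?s i) = (\<Sum>i<b. s i) ^ Suc n"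
    unfolding power_Suc sum_lessThan_mult tr[symmetric] sum_product by (intro sum.cong refl) simp
  ultimately show ?case by (intro exI[of _ ?s] exI conjI)
qed

lemma density_ketbra:
  assumes "i < d"
  shows "density d (ketbra d i i)"
  unfolding density_def
proof
  show "psd d (ketbra d i i)"
    by (rule psdI_gram[where w = "\<lambda>_ r. if r = i then 1 else 0" and I = "{()}"]) (auto simp: ketbra_index)
  show "tr (ketbra d i i) = 1"
    using assms by (simp add: tr_def ketbra_def)
qed

text \<open>The feasible pair serves both claims: it bounds every ensemble uniformly, and this
  boundedness is what places each ensemble below the supremum.\<close>

lemma holevo_bounds:
  fixes k :: nat
  assumes N: "superop_of_choi a b \<N> J" and J: "channel_choi a b J"
    and feas: "beta_feasible a b J (real_diag b s) R"
    and s: "\<And>i. i < b \<Longrightarrow> 0 < s i" and t: "0 < t" "(\<Sum>i<b. s i) \<le> t" and a: "0 < a"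
  shows "holevo a b \<N> \<le> log 2 t"
    and "\<lbrakk>\<And>i. i < k \<Longrightarrow> density a (\<rho> i); \<And>i. i < k \<Longrightarrow> 0 \<le> p i; (\<Sum>i<k. p i) = 1\<rbrakk> \<Longrightarrow>
      vn_entropy (sum_mat b (\<lambda>i. complex_of_real (p i) \<cdot>\<^sub>m \<N> (\<rho> i)) {..<k})
        - (\<Sum>i<k. p i * vn_entropy (\<N> (\<rho> i))) \<le> holevo a b \<N>"
proof -
  let ?A = "{vn_entropy (sum_mat b (\<lambda>i. complex_of_real (p i) \<cdot>\<^sub>m \<N> (\<rho> i)) {..<k})
        - (\<Sum>i<k. p i * vn_entropy (\<N> (\<rho> i))) | (k :: nat) (p :: nat \<Rightarrow> real) (\<rho> :: nat \<Rightarrow> complex mat).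
      (\<forall>i<k. 0 \<le> p i \<and> density a (\<rho> i)) \<and> (\<Sum>i<k. p i) = 1}"
  have le: "x \<le> log 2 t" if "x \<in> ?A" for x
    using that holevo_term_le[OF N J feas s t] by blast
  have mem: "vn_entropy (sum_mat b (\<lambda>i. complex_of_real (p i) \<cdot>\<^sub>m \<N> (\<rho> i)) {..<k})
        - (\<Sum>i<k. p i * vn_entropy (\<N> (\<rho> i))) \<in> ?A"
    if "\<And>i. i < k \<Longrightarrow> density a (\<rho> i)" "\<And>i. i < k \<Longrightarrow> 0 \<le> p i" "(\<Sum>i<k. p i) = 1"
    for k :: nat and p :: "nat \<Rightarrow> real" and \<rho> :: "nat \<Rightarrow> complex mat"
    using that by blast
  have "?A \<noteq> {}"
    using mem[of 1 "\<lambda>_. ketbra a 0 0" "\<lambda>_. 1"] density_ketbra[OF a] by force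
  then show "holevo a b \<N> \<le> log 2 t"
    unfolding holevo_def by (rule cSup_least) (rule le)
  show "vn_entropy (sum_mat b (\<lambda>i. complex_of_real (p i) \<cdot>\<^sub>m \<N> (\<rho> i)) {..<k})
        - (\<Sum>i<k. p i * vn_entropy (\<N> (\<rho> i))) \<le> holevo a b \<N>"
    if "\<And>i. i < k \<Longrightarrow> density a (\<rho> i)" "\<And>i. i < k \<Longrightarrow> 0 \<le> p i" "(\<Sum>i<k. p i) = 1"
  proof -
    have "bdd_above ?A" using le by (rule bdd_aboveI)
    moreover have "vn_entropy (sum_mat b (\<lambda>i. complex_of_real (p i) \<cdot>\<^sub>m \<N> (\<rho> i)) {..<k})
        - (\<Sum>i<k. p i * vn_entropy (\<N> (\<rho> i))) \<in> ?A"
      using that by blast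
    ultimately show ?thesis unfolding holevo_def by (intro cSup_upper)
  qed
qed

text \<open>The certificate format for the four matrix inequalities of the channel. Gram vector
  \<open>d\<close> is \<open>v\<close>, and vector \<open>j < d\<close> carries the root of
  \<open>g j\<close> at position \<open>j\<close>.\<close>

lemma psd_rank_one_plus_diag:
  fixes v g :: "nat \<Rightarrow> real"
  assumes "M \<in> carrier_mat d d"
    and M: "\<And>r t. r < d \<Longrightarrow> t < d \<Longrightarrow> M $$ (r, t) = of_real (v r * v t + (if r = t then g r else 0))"
    and g: "\<And>r. r < d \<Longrightarrow> 0 \<le> g r"
  shows "psd d M"
proof (rule psdI_gram[OF assms(1), where I = "{..d}"
      and w = "\<lambda>j r. of_real (if j = d then v r else if j = r then sqrt (g r) else 0)"])
  fix r t assume rt: "r < d" "t < d"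
  have "(\<Sum>j\<le>d. of_real (if j = d then v r else if j = r then sqrt (g r) else 0)
        * cnj (of_real (if j = d then v t else if j = t then sqrt (g t) else 0)))
      = of_real (\<Sum>j<Suc d. (if j = d then v r else if j = r then sqrt (g r) else 0)
        * (if j = d then v t else if j = t then sqrt (g t) else 0))"
    by (simp add: lessThan_Suc_atMost del: sum.lessThan_Suc)
  also have "(\<Sum>j<Suc d. (if j = d then v r else if j = r then sqrt (g r) else 0)
        * (if j = d then v t else if j = t then sqrt (g t) else 0))
      = (\<Sum>j<d. if j = r then if r = t then g r else 0 else 0) + v r * v t"
    unfolding sum.lessThan_Suc using g rt by (intro arg_cong2[where f = "(+)"] sum.cong refl) auto
  also have "\<dots> = v r * v t + (if r = t then g r else 0)" using rt by (simp add: add.commute)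
  finally show "M $$ (r, t) = (\<Sum>j\<le>d. of_real (if j = d then v r else if j = r then sqrt (g r) else 0)
        * cnj (of_real (if j = d then v t else if j = t then sqrt (g t) else 0)))"
    using M[OF rt] by simp
qed

lemma loewner_le_diag:
  assumes "loewner_le d A B" "r < d"
  shows "Re (A $$ (r, r)) \<le> Re (B $$ (r, r))"
proof -
  have "quad d X (\<lambda>i. if i = r then 1 else 0) = X $$ (r, r)" for X
  proof -
    have "quad d X (\<lambda>i. if i = r then 1 else 0) = (\<Sum>i<d. \<Sum>j<d. if i = r then if j = r then X $$ (i, j) else 0 else 0)"
      unfolding quad_def by (intro sum.cong refl) simp
    then show ?thesis using assms(2) by (simp add: sum_if_const)
  qed
  then show ?thesis using loewner_le_quad[OF assms(1), of "\<lambda>i. if i = r then 1 else 0"] by simp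
qed

text \<open>A partial transpose fixes diagonal entries, so the constraints on \<open>J\<close> and
  on \<open>R\<close> can be chained there.\<close>

lemma beta_feasible_diag_le:
  assumes "beta_feasible a b J S R" "i < a" "k < b"
  shows "Re (J $$ (i * b + k, i * b + k)) \<le> Re (S $$ (k, k))"
proof -
  have lt: "i * b + k < a * b" using assms(2,3) by (rule pair_less)
  have S: "S \<in> carrier_mat b b" using assms(1) by (simp add: beta_feasible_def hermitian_def)
  have "Re (ptranspose a b J $$ (i * b + k, i * b + k)) \<le> Re (R $$ (i * b + k, i * b + k))"
    using assms(1) lt by (intro loewner_le_diag) (auto simp: beta_feasible_def)
  moreover have "Re (ptranspose a b R $$ (i * b + k, i * b + k)) \<le> Re ((1\<^sub>m a \<otimes>\<^sub>K S) $$ (i * b + k, i * b + k))"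
    using assms(1) lt by (intro loewner_le_diag) (auto simp: beta_feasible_def)
  ultimately show ?thesis
    using assms(2,3) by (simp add: ptranspose_index one_kron_index[OF S])
qed

section \<open>The channel\<close>

definition kraus0 :: "real \<Rightarrow> nat \<Rightarrow> nat \<Rightarrow> real" where
  "kraus0 s k i = (if k = 0 \<and> i = 1 then s else if k = 1 \<and> i = 2 then 1 else 0)"

definition kraus1 :: "real \<Rightarrow> nat \<Rightarrow> nat \<Rightarrow> real" where
  "kraus1 c k i = (if k = 2 \<and> i = 1 then c else if k = 1 \<and> i = 0 then 1 else 0)"

lemma E_carrier [simp]: "E0 \<alpha> \<in> carrier_mat 3 3" "E1 \<alpha> \<in> carrier_mat 3 3"
  by (simp_all add: E0_def E1_def ketbra_def)

lemma E_index:
  assumes "k < 3" "i < 3"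
  shows "E0 \<alpha> $$ (k, i) = of_real (kraus0 (sin \<alpha>) k i)" "E1 \<alpha> $$ (k, i) = of_real (kraus1 (cos \<alpha>) k i)"
  using assms by (auto simp: E0_def E1_def ketbra_def kraus0_def kraus1_def)

lemma conj_ketbra_index:
  assumes E: "E \<in> carrier_mat d d" and "i < d" "j < d" "k < d" "l < d"
  shows "(E * ketbra d i j * mat_adjoint E) $$ (k, l) = E $$ (k, i) * cnj (E $$ (l, j))"
proof -
  have EK: "E * ketbra d i j \<in> carrier_mat d d" using E by simp
  have "(E * ketbra d i j * mat_adjoint E) $$ (k, l)
      = (\<Sum>t<d. (\<Sum>u<d. E $$ (k, u) * ketbra d i j $$ (u, t)) * cnj (E $$ (l, t)))"
    using assms mat_mult_index[OF EK mat_adjoint_carrier[OF E]]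
    by (simp add: mat_mult_index[OF E ketbra_carrier] mat_adjoint_index[OF E])
  also have "\<dots> = (\<Sum>t<d. if t = j then \<Sum>u<d. if u = i then E $$ (k, u) * cnj (E $$ (l, t)) else 0 else 0)"
    unfolding sum_distrib_right by (intro sum.cong refl) (auto simp: ketbra_index if_distrib[of "(*) _"] if_distrib[of "\<lambda>x. x * _"] cong: if_cong)
  also have "\<dots> = E $$ (k, i) * cnj (E $$ (l, j))" using assms by simp
  finally show ?thesis .
qed

lemma N_chan_ketbra_index:
  assumes "i < 3" "j < 3" "k < 3" "l < 3"
  shows "N_chan \<alpha> (ketbra 3 i j) $$ (k, l) = of_real
    (kraus0 (sin \<alpha>) k i * kraus0 (sin \<alpha>) l j + kraus1 (cos \<alpha>) k i * kraus1 (cos \<alpha>) l j)"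
proof -
  have c: "E * ketbra 3 i j * mat_adjoint E \<in> carrier_mat 3 3" if "E \<in> carrier_mat 3 3" for E
    using that mult_carrier_mat[OF mult_carrier_mat[OF that ketbra_carrier] mat_adjoint_carrier[OF that]] by simp
  have "N_chan \<alpha> (ketbra 3 i j) $$ (k, l) = (E0 \<alpha> * ketbra 3 i j * mat_adjoint (E0 \<alpha>)) $$ (k, l)
      + (E1 \<alpha> * ketbra 3 i j * mat_adjoint (E1 \<alpha>)) $$ (k, l)"
    unfolding N_chan_def
    by (rule index_add_mat(1)) (use assms carrier_matD[OF c[OF E_carrier(2)]] in simp_all)
  then show ?thesis
    unfolding conj_ketbra_index[OF E_carrier(1) assms] conj_ketbra_index[OF E_carrier(2) assms]
    using assms by (simp add: E_index)
qed

lemma N_chan_dims: "superop_dims 3 3 (N_chan \<alpha>)"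
proof -
  have "E * ketbra 3 i j * mat_adjoint E \<in> carrier_mat 3 3" if "E \<in> carrier_mat 3 3" for E i j
    using mult_carrier_mat[OF mult_carrier_mat[OF that ketbra_carrier] mat_adjoint_carrier[OF that]] .
  then show ?thesis by (auto simp: superop_dims_def N_chan_def)
qed

text \<open>The sum of the rank-one matrices of the two vectorised Kraus operators; index
  \<open>r\<close> has input \<open>r div 3\<close> and output \<open>r mod 3\<close>. Taking
  \<open>s\<close> and \<open>c\<close> as parameters makes the 81 entries polynomials that can be
  compared one by one.\<close>

definition choi_entry :: "real \<Rightarrow> real \<Rightarrow> nat \<Rightarrow> nat \<Rightarrow> real" where
  "choi_entry s c r t = kraus0 s (r mod 3) (r div 3) * kraus0 s (t mod 3) (t div 3)
    + kraus1 c (r mod 3) (r div 3) * kraus1 c (t mod 3) (t div 3)"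

lemma choi_N_chan_index:
  assumes "r < 9" "t < 9"
  shows "choi 3 3 (N_chan \<alpha>) $$ (r, t) = of_real (choi_entry (sin \<alpha>) (cos \<alpha>) r t)"
proof -
  from assms have "r < 3 * 3" "t < 3 * 3" by simp_all
  then obtain i k j l where *: "i < 3" "k < 3" "j < 3" "l < 3" and rt: "r = i * 3 + k" "t = j * 3 + l"
    by (metis pair_cases)
  show ?thesis
    unfolding rt choi_index[OF N_chan_dims *] N_chan_ketbra_index[OF *(1,3,2,4)] using *
    by (simp add: choi_entry_def)
qed

lemma all_less_3: "(\<forall>r<3::nat. P r) \<longleftrightarrow> P 0 \<and> P 1 \<and> P 2"
  by (auto simp: numeral_3_eq_3 numeral_2_eq_2 less_Suc_eq)

lemma all_less_9:
  "(\<forall>r<9::nat. P r) \<longleftrightarrow> P 0 \<and> P 1 \<and> P 2 \<and> P 3 \<and> P 4 \<and> P 5 \<and> P 6 \<and> P 7 \<and> P 8"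
proof
  assume *: "P 0 \<and> P 1 \<and> P 2 \<and> P 3 \<and> P 4 \<and> P 5 \<and> P 6 \<and> P 7 \<and> P 8"
  show "\<forall>r<9. P r"
  proof (intro allI impI)
    fix r :: nat assume "r < 9"
    then have "r = 0 \<or> r = 1 \<or> r = 2 \<or> r = 3 \<or> r = 4 \<or> r = 5 \<or> r = 6 \<or> r = 7 \<or> r = 8" by arith
    with * show "P r" by blast
  qed
qed auto

lemma sum_less_3: "(\<Sum>i<3. f i) = f 0 + f 1 + f (2::nat)"
  by (simp add: numeral_3_eq_3 numeral_2_eq_2)

lemma channel_choi_N_chan: "channel_choi 3 3 (choi 3 3 (N_chan \<alpha>))"
  unfolding channel_choi_def
proof
  let ?w = "\<lambda>e r. if e = (0::nat) then complex_of_real (kraus0 (sin \<alpha>) (r mod 3) (r div 3))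
    else of_real (kraus1 (cos \<alpha>) (r mod 3) (r div 3))"
  have "choi 3 3 (N_chan \<alpha>) $$ (r, t) = (\<Sum>e\<in>{0, 1}. ?w e r * cnj (?w e t))" if "r < 9" "t < 9" for r t
    using that by (simp add: choi_N_chan_index choi_entry_def)
  then show "psd (3 * 3) (choi 3 3 (N_chan \<alpha>))"
    by (intro psdI_gram[OF choi_carrier, where w = ?w and I = "{0, 1}"]) simp
  have "\<forall>i<3. \<forall>j<3. (\<Sum>k<3. choi_entry (sin \<alpha>) (cos \<alpha>) (i * 3 + k) (j * 3 + k)) = (if i = j then 1 else 0)"
    using sin_cos_squared_add[of \<alpha>]
    by (simp add: all_less_3 sum_less_3 choi_entry_def kraus0_def kraus1_def power2_eq_square)
  then have *: "(\<Sum>k<3. choi_entry (sin \<alpha>) (cos \<alpha>) (i * 3 + k) (j * 3 + k)) = (if i = j then 1 else 0)"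
    if "i < 3" "j < 3" for i j using that by blast
  show "\<forall>i<3. \<forall>j<3. (\<Sum>k<3. choi 3 3 (N_chan \<alpha>) $$ (i * 3 + k, j * 3 + k)) = (if i = j then 1 else 0)"
  proof (intro allI impI)
    fix i j :: nat assume ij: "i < 3" "j < 3"
    have "(\<Sum>k<3. choi 3 3 (N_chan \<alpha>) $$ (i * 3 + k, j * 3 + k))
        = of_real (\<Sum>k<3. choi_entry (sin \<alpha>) (cos \<alpha>) (i * 3 + k) (j * 3 + k))"
      unfolding of_real_sum using ij by (intro sum.cong refl choi_N_chan_index) auto
    then show "(\<Sum>k<3. choi 3 3 (N_chan \<alpha>) $$ (i * 3 + k, j * 3 + k)) = (if i = j then 1 else 0)"
      unfolding *[OF ij] by simp
  qed
qed

text \<open>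
  The optimal \<open>S\<close> is \<open>diag(s\<^sup>2, 1, c\<^sup>2)\<close> with \<open>s = sin \<alpha>\<close>, \<open>c = cos \<alpha>\<close>, and the optimal \<open>R\<close> is
  \<open>|J\<^sup>T\<^sup>B|\<close>: it is diagonal except for the block of \<open>|02\<rangle>\<close> and \<open>|20\<rangle>\<close>.
\<close>

definition S_diag :: "real \<Rightarrow> real \<Rightarrow> nat \<Rightarrow> real" where
  "S_diag s c i = [s * s, 1, c * c] ! i"

definition R_entry :: "real \<Rightarrow> real \<Rightarrow> nat \<Rightarrow> nat \<Rightarrow> real" where
  "R_entry s c r t = (if r = t then [0, 1, c * c, s * s, 1, c * c, s * s, 1, 0] ! r
    else if r = 2 \<and> t = 6 \<or> r = 6 \<and> t = 2 then s * c else 0)"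

definition R_mat :: "real \<Rightarrow> real \<Rightarrow> complex mat" where
  "R_mat s c = mat 9 9 (\<lambda>(r, t). of_real (R_entry s c r t))"

lemma beta_feasible_N_chan:
  "beta_feasible 3 3 (choi 3 3 (N_chan \<alpha>)) (real_diag 3 (S_diag (sin \<alpha>) (cos \<alpha>))) (R_mat (sin \<alpha>) (cos \<alpha>))"
proof -
  define s c where "s = sin \<alpha>" and "c = cos \<alpha>"
  let ?J = "ptranspose 3 3 (choi 3 3 (N_chan \<alpha>))" and ?R = "R_mat s c"
    and ?S = "1\<^sub>m 3 \<otimes>\<^sub>K real_diag 3 (S_diag s c)"
  have carr: "?J \<in> carrier_mat 9 9" "?R \<in> carrier_mat 9 9" "ptranspose 3 3 ?R \<in> carrier_mat 9 9" "?S \<in> carrier_mat 9 9"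
    by (simp_all add: ptranspose_def R_mat_def kron_def real_diag_def)
  define jt where "jt r t = choi_entry s c (r div 3 * 3 + t mod 3) (t div 3 * 3 + r mod 3)" for r t
  define rt where "rt r t = R_entry s c (r div 3 * 3 + t mod 3) (t div 3 * 3 + r mod 3)" for r t
  define sd where "sd r t = (if r = t then S_diag s c (r mod 3) else 0)" for r t
  have lt: "r div 3 * 3 + t mod 3 < 9" if "r < 9" for r t :: nat
    using that by presburger
  have J: "?J $$ (r, t) = of_real (jt r t)" if "r < 9" "t < 9" for r t
    using that lt by (simp add: ptranspose_def jt_def s_def c_def choi_N_chan_index)
  have R: "?R $$ (r, t) = of_real (R_entry s c r t)" if "r < 9" "t < 9" for r t
    using that by (simp add: R_mat_def)
  have RT: "ptranspose 3 3 ?R $$ (r, t) = of_real (rt r t)" if "r < 9" "t < 9" for r t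
    using that lt by (simp add: ptranspose_def rt_def R)
  have S: "?S $$ (r, t) = of_real (sd r t)" if "r < 9" "t < 9" for r t
  proof -
    from that have "r < 3 * 3" "t < 3 * 3" by simp_all
    then obtain i k j l where *: "i < 3" "k < 3" "j < 3" "l < 3" and eq: "r = i * 3 + k" "t = j * 3 + l"
      by (metis pair_cases)
    have "real_diag 3 (S_diag s c) \<in> carrier_mat 3 3" by (simp add: real_diag_def)
    from one_kron_index[OF this *] show ?thesis
      using quadruple_eq_iff[of 0 1 0 k 3 l 0 1 0 i j] * by (auto simp: eq sd_def real_diag_def)
  qed
  \<comment> \<open>On the span of |02>, |11>, |20> (indices 2, 4, 6) the matrix J^T_B is |11><u| +
    |u><11| with the unit vector u = c |02> + s |20>. Its absolute value is |11><11| + |u><u|, so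
    adding or subtracting gives rank one with vector |11> + u or |11> - u. Elsewhere J^T_B is
    diagonal and nonnegative, and is doubled here and cancelled in the difference below.\<close>
  have "\<forall>r<9. \<forall>t<9. jt r t + R_entry s c r t
      = [0, 0, c, 0, 1, 0, s, 0, 0] ! r * [0, 0, c, 0, 1, 0, s, 0, 0] ! t
        + (if r = t then [0, 2, 0, 2 * (s * s), 0, 2 * (c * c), 0, 2, 0] ! r else 0)"
    by (simp add: all_less_9 jt_def choi_entry_def R_entry_def kraus0_def kraus1_def)
  moreover have "\<forall>r<9. 0 \<le> [0, 2, 0, 2 * (s * s), 0, 2 * (c * c), 0, 2, 0] ! r"
    by (simp add: all_less_9)
  ultimately have 1: "psd 9 (?J - - ?R)"
    using carr
    by (intro psd_rank_one_plus_diag[where v = "\<lambda>r. [0, 0, c, 0, 1, 0, s, 0, 0] ! r"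
          and g = "\<lambda>r. [0, 2, 0, 2 * (s * s), 0, 2 * (c * c), 0, 2, 0] ! r"])
      (auto simp: J R minus_carrier_mat simp flip: of_real_add of_real_mult)
  have "\<forall>r<9. \<forall>t<9. R_entry s c r t - jt r t
      = [0, 0, - c, 0, 1, 0, - s, 0, 0] ! r * [0, 0, - c, 0, 1, 0, - s, 0, 0] ! t"
    by (simp add: all_less_9 jt_def choi_entry_def R_entry_def kraus0_def kraus1_def)
  then have 2: "psd 9 (?R - ?J)"
    using carr
    by (intro psd_rank_one_plus_diag[where v = "\<lambda>r. [0, 0, - c, 0, 1, 0, - s, 0, 0] ! r" and g = "\<lambda>_. 0"])
      (auto simp: J R minus_carrier_mat simp flip: of_real_diff of_real_mult)
  have "\<forall>r<9. \<forall>t<9. rt r t + sd r t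
      = [s, 0, 0, 0, 0, 0, 0, 0, c] ! r * [s, 0, 0, 0, 0, 0, 0, 0, c] ! t
        + (if r = t then [0, 2, 2 * (c * c), 2 * (s * s), 2, 2 * (c * c), 2 * (s * s), 2, 0] ! r else 0)"
    by (simp add: all_less_9 rt_def sd_def R_entry_def S_diag_def)
  moreover have "\<forall>r<9. 0 \<le> [0, 2, 2 * (c * c), 2 * (s * s), 2, 2 * (c * c), 2 * (s * s), 2, 0] ! r"
    by (simp add: all_less_9)
  ultimately have 3: "psd 9 (ptranspose 3 3 ?R - - ?S)"
    using carr
    by (intro psd_rank_one_plus_diag[where v = "\<lambda>r. [s, 0, 0, 0, 0, 0, 0, 0, c] ! r"
          and g = "\<lambda>r. [0, 2, 2 * (c * c), 2 * (s * s), 2, 2 * (c * c), 2 * (s * s), 2, 0] ! r"])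
      (auto simp: RT S minus_carrier_mat simp flip: of_real_add of_real_mult)
  \<comment> \<open>The partial transpose moves the off-diagonal entry s c of \<open>R\<close> from
    |02><20| to |00><22| (indices 0 and 8), where \<open>R\<close> has zero diagonal. There 1 (x) S
    supplies s^2 and c^2, just enough for rank one; all other diagonal entries agree.\<close>
  have "\<forall>r<9. \<forall>t<9. sd r t - rt r t
      = [s, 0, 0, 0, 0, 0, 0, 0, - c] ! r * [s, 0, 0, 0, 0, 0, 0, 0, - c] ! t"
    by (simp add: all_less_9 rt_def sd_def R_entry_def S_diag_def)
  then have 4: "psd 9 (?S - ptranspose 3 3 ?R)"
    using carr
    by (intro psd_rank_one_plus_diag[where v = "\<lambda>r. [s, 0, 0, 0, 0, 0, 0, 0, - c] ! r" and g = "\<lambda>_. 0"])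
      (auto simp: RT S minus_carrier_mat simp flip: of_real_diff of_real_mult)
  have "hermitian 9 ?R"
    unfolding hermitian_iff using carr by (auto simp: R R_entry_def)
  moreover have "hermitian 3 (real_diag 3 (S_diag s c))"
    unfolding hermitian_iff by (auto simp: real_diag_def)
  ultimately show ?thesis
    using 1 2 3 4 carr by (simp add: beta_feasible_def loewner_le_def s_def[symmetric] c_def[symmetric])
qed

lemma S_diag_sum: "(\<Sum>i<3. S_diag (sin \<alpha>) (cos \<alpha>) i) = 2"
  using sin_cos_squared_add[of \<alpha>] by (simp add: sum_less_3 S_diag_def power2_eq_square)

lemma S_diag_pos: "0 < s \<Longrightarrow> 0 < c \<Longrightarrow> i < 3 \<Longrightarrow> 0 < S_diag s c i"
  using all_less_3[of "\<lambda>i. 0 < S_diag s c i"] by (simp add: S_diag_def)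

lemma tr_real_diag: "Re (tr (real_diag d f)) = (\<Sum>i<d. f i)"
  by (simp add: tr_def real_diag_def)

lemma beta_N_chan: "beta 3 3 (N_chan \<alpha>) = 2"
proof -
  have "beta 3 3 (N_chan \<alpha>) = Inf {Re (tr S) | S R. beta_feasible 3 3 (choi 3 3 (N_chan \<alpha>)) S R}"
    by (simp add: beta_def beta_feasible_def)
  also have "\<dots> = 2"
  proof (rule cInf_eq_minimum)
    show "2 \<in> {Re (tr S) | S R. beta_feasible 3 3 (choi 3 3 (N_chan \<alpha>)) S R}"
      using beta_feasible_N_chan[of \<alpha>] tr_real_diag[of 3] S_diag_sum[of \<alpha>] by (metis (mono_tags, lifting) mem_Collect_eq)
    fix x assume "x \<in> {Re (tr S) | S R. beta_feasible 3 3 (choi 3 3 (N_chan \<alpha>)) S R}"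
    then obtain S R where x: "x = Re (tr S)" and feas: "beta_feasible 3 3 (choi 3 3 (N_chan \<alpha>)) S R" by blast
    have S: "S \<in> carrier_mat 3 3" using feas by (simp add: beta_feasible_def hermitian_def)
    \<comment> \<open>Indices 1, 3 and 5 are |01>, |10> and |12>: the outcomes of the inputs |0> and
      |1>, with values 1, s^2 and c^2. Together they bound all three diagonal entries of
      \<open>S\<close>.\<close>
    have "choi_entry (sin \<alpha>) (cos \<alpha>) 1 1 \<le> Re (S $$ (1, 1))"
      "choi_entry (sin \<alpha>) (cos \<alpha>) 3 3 \<le> Re (S $$ (0, 0))"
      "choi_entry (sin \<alpha>) (cos \<alpha>) 5 5 \<le> Re (S $$ (2, 2))"
      using beta_feasible_diag_le[OF feas, of 0 1] beta_feasible_diag_le[OF feas, of 1 0]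
        beta_feasible_diag_le[OF feas, of 1 2] by (simp_all add: choi_N_chan_index)
    then show "2 \<le> x"
      using sin_cos_squared_add[of \<alpha>] S unfolding x tr_def
      by (simp add: sum_less_3 choi_entry_def kraus0_def kraus1_def power2_eq_square)
  qed
  finally show ?thesis .
qed

text \<open>Input |0> always produces outcome 1, while input |1> produces only 0 or 2.\<close>

lemma disjoint_code_N_chan:
  "disjoint_code 3 3 2 (choi 3 3 (N_chan \<alpha>)) (\<lambda>k. k) (\<lambda>y. if y = 1 then 0 else 1)"
proof -
  have *: "\<forall>y<3. (if y = 1 then 0 else 1) \<noteq> k \<longrightarrow> choi_entry (sin \<alpha>) (cos \<alpha>) (k * 3 + y) (k * 3 + y) = 0"
    if "k = 0 \<or> k = 1" for k
    using that by (auto simp: all_less_3 choi_entry_def kraus0_def kraus1_def)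
  have "choi_entry (sin \<alpha>) (cos \<alpha>) (k * 3 + y) (k * 3 + y) = 0"
    if "k < 2" "y < 3" "(if y = 1 then 0 else 1) \<noteq> k" for k y
    using *[of k] that less_2_cases_iff[of k] unfolding One_nat_def by blast
  then show ?thesis
    by (auto simp: disjoint_code_def choi_N_chan_index)
qed

text \<open>With 2^n messages the success is exactly 1 for every \<open>n\<close>, so rate 1 is
  achieved. At a rate \<open>r > 1\<close> the bound 2^n / m forces the success to decay
  exponentially, a strong converse.\<close>

lemma C_ns_ppt_N_chan:
  assumes pos: "0 < sin \<alpha>" "0 < cos \<alpha>"
  shows "C_ns_ppt 3 3 (N_chan \<alpha>) = 1"
proof -
  let ?N = "\<lambda>n. superop_power 3 3 (N_chan \<alpha>) n"
  let ?f = "\<lambda>n m. f_ns_ppt (3 ^ n) (3 ^ n) (?N n) m"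
  have feas: "\<exists>S R. Re (tr S) = 2 ^ n \<and> beta_feasible (3 ^ n) (3 ^ n) (choi (3 ^ n) (3 ^ n) (?N n)) S R" for n
    using beta_feasible_superop_power[OF N_chan_dims beta_feasible_N_chan S_diag_pos[OF pos], of n]
    unfolding S_diag_sum using tr_real_diag by metis
  have upper: "?f n m \<le> 2 ^ n / real m" if "0 < m" for n m
    using feas[of n] f_ns_ppt_le[of "3 ^ n" "3 ^ n" "?N n" _ _ m] that by force
  have one: "?f n (2 ^ n) = 1" for n
  proof (rule antisym)
    show "?f n (2 ^ n) \<le> 1" using upper[of "2 ^ n" n] by simp
    obtain enc dec where "disjoint_code (3 ^ n) (3 ^ n) (2 ^ n) (choi (3 ^ n) (3 ^ n) (?N n)) enc dec"
      using disjoint_code_superop_power[OF N_chan_dims disjoint_code_N_chan] by blast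
    then show "1 \<le> ?f n (2 ^ n)"
      using feas[of n] f_ns_ppt_ge_1 channel_choi_superop_power[OF N_chan_dims channel_choi_N_chan]
      by (metis zero_less_numeral zero_less_power)
  qed
  show ?thesis
    unfolding C_ns_ppt_def
  proof (rule cSup_eq_maximum)
    have "nat \<lfloor>2 powr (1 * real n)\<rfloor> = 2 ^ n" for n
    proof -
      have "2 powr (1 * real n) = real_of_int (2 ^ n)" by (simp add: powr_realpow)
      then show ?thesis by (simp only: floor_of_int) (simp add: nat_power_eq)
    qed
    then show "1 \<in> {r. 0 \<le> r \<and> (\<lambda>n. ?f n (nat \<lfloor>2 powr (r * real n)\<rfloor>)) \<longlonglongrightarrow> 1}"
      by (simp add: one nat_power_eq)
    fix r assume "r \<in> {r. 0 \<le> r \<and> (\<lambda>n. ?f n (nat \<lfloor>2 powr (r * real n)\<rfloor>)) \<longlonglongrightarrow> 1}"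
    then have r0: "0 \<le> r" and lim: "(\<lambda>n. ?f n (nat \<lfloor>2 powr (r * real n)\<rfloor>)) \<longlonglongrightarrow> 1" by auto
    show "r \<le> 1"
    proof (rule ccontr)
      assume "\<not> r \<le> 1"
      then have r1: "r > 1" by simp
      have bound: "?f n (nat \<lfloor>2 powr (r * real n)\<rfloor>) \<le> 2 * (2 powr (1 - r)) ^ n" for n
      proof -
        let ?x = "2 powr (r * real n)"
        have x1: "?x \<ge> 1" using r0 by (intro ge_one_powr_ge_zero) auto
        then have fl1: "\<lfloor>?x\<rfloor> \<ge> 1" by simp
        \<comment> \<open>The floor is at least 1 and exceeds \<open>?x - 1\<close>; the mean of
          these two bounds is \<open>?x / 2\<close>.\<close>
        have half: "real (nat \<lfloor>?x\<rfloor>) \<ge> ?x / 2"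
          using fl1 real_of_int_floor_gt_diff_one[of ?x] by linarith
        have "?f n (nat \<lfloor>?x\<rfloor>) \<le> 2 ^ n / real (nat \<lfloor>?x\<rfloor>)"
          using fl1 by (intro upper) simp
        also have "\<dots> \<le> 2 ^ n / (?x / 2)"
          using half x1 by (intro divide_left_mono) auto
        also have "\<dots> = 2 * (2 powr (1 - r)) ^ n"
        proof -
          have "(2 powr (1 - r)) ^ n = 2 powr ((1 - r) * real n)"
            by (simp add: powr_realpow[symmetric] powr_powr)
          also have "\<dots> = 2 ^ n / ?x"
            by (simp add: left_diff_distrib powr_diff powr_realpow)
          finally show ?thesis by simp
        qed
        finally show ?thesis .
      qed
      have "2 powr (1 - r) < 2 powr 0" using r1 by (intro powr_less_mono) auto
      then have "(\<lambda>n. 2 * (2 powr (1 - r)) ^ n) \<longlonglongrightarrow> 2 * 0"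
        by (intro tendsto_mult tendsto_const LIMSEQ_realpow_zero) auto
      with lim have "1 \<le> (2 * 0 :: real)"
        by (rule LIMSEQ_le) (use bound in blast)
      then show False by simp
    qed
  qed
qed

lemma holevo_superop_power_N_chan_le:
  assumes pos: "0 < sin \<alpha>" "0 < cos \<alpha>" and n: "n \<ge> 1"
  shows "holevo (3 ^ n) (3 ^ n) (superop_power 3 3 (N_chan \<alpha>) n) \<le> real n"
proof -
  obtain s R where s: "\<forall>i<3 ^ n. 0 < s i" "(\<Sum>i<3 ^ n. s i) = 2 ^ n"
    and feas: "beta_feasible (3 ^ n) (3 ^ n) (choi (3 ^ n) (3 ^ n) (superop_power 3 3 (N_chan \<alpha>) n)) (real_diag (3 ^ n) s) R"
    using beta_feasible_superop_power[OF N_chan_dims beta_feasible_N_chan S_diag_pos[OF pos], of n]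
    unfolding S_diag_sum by blast
  have "holevo (3 ^ n) (3 ^ n) (superop_power 3 3 (N_chan \<alpha>) n) \<le> log 2 (2 ^ n)"
    by (rule holevo_bounds(1)[OF superop_of_choi_superop_power[OF N_chan_dims n]
          channel_choi_superop_power[OF N_chan_dims channel_choi_N_chan] feas])
      (use s in auto)
  then show ?thesis by (simp add: log_nat_power)
qed

text \<open>The first power is a tensor product with the identity on a one-dimensional space, hence
  the trivial factors in the proof.\<close>

lemma superop_power_1_N_chan_index:
  assumes "i < 3" "k < 3" "l < 3"
  shows "superop_power 3 3 (N_chan \<alpha>) 1 (ketbra 3 i i) $$ (k, l)
    = of_real (choi_entry (sin \<alpha>) (cos \<alpha>) (i * 3 + k) (i * 3 + l))"
proof -
  have id: "superop_dims 1 1 (\<lambda>X. X)" by (simp add: superop_dims_def)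
  have "superop_tensor 3 3 (N_chan \<alpha>) 1 1 (\<lambda>X. X) (ketbra (3 * 1) (i * 1 + 0) (i * 1 + 0)) $$ (k * 1 + 0, l * 1 + 0)
      = N_chan \<alpha> (ketbra 3 i i) $$ (k, l) * ketbra 1 0 0 $$ (0, 0)"
    by (rule superop_tensor_ketbra_index[OF N_chan_dims id]) (use assms in auto)
  then show ?thesis
    using assms by (simp add: ketbra_index N_chan_ketbra_index choi_entry_def)
qed

text \<open>For the uniform ensemble on |0> and |1>, whose outputs have disjoint diagonal supports,
  the entropy of the average exceeds the average entropy by exactly one bit.\<close>

lemma holevo_N_chan_ge:
  assumes pos: "0 < sin \<alpha>" "0 < cos \<alpha>"
  shows "1 \<le> holevo (3 ^ 1) (3 ^ 1) (superop_power 3 3 (N_chan \<alpha>) 1)"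
proof -
  define s c where "s = sin \<alpha>" and "c = cos \<alpha>"
  have sc: "s * s + c * c = 1" using sin_cos_squared_add[of \<alpha>] by (simp add: s_def c_def power2_eq_square)
  have spos: "0 < s" "0 < c" using pos by (simp_all add: s_def c_def)
  let ?M = "superop_power 3 3 (N_chan \<alpha>) 1"
  let ?\<rho> = "\<lambda>i. ketbra (3 ^ 1) i i" and ?p = "\<lambda>_::nat. 1 / 2 :: real"
  let ?A = "sum_mat (3 ^ 1) (\<lambda>i. complex_of_real (?p i) \<cdot>\<^sub>m ?M (?\<rho> i)) {..<2}"
  have Mc: "?M X \<in> carrier_mat 3 3" for X
    using superop_tensor_carrier[of 3 3 "N_chan \<alpha>" 1 1] by simp
  have Mi: "?M (?\<rho> i) $$ (k, l) = of_real (choi_entry s c (i * 3 + k) (i * 3 + l))" if "i < 3" "k < 3" "l < 3" for i k l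
    using superop_power_1_N_chan_index[OF that, of \<alpha>] by (simp add: s_def c_def)
  have d0: "\<forall>k<3. \<forall>l<3. choi_entry s c k l = (if k = l then [0, 1, 0] ! k else 0)"
    by (simp add: all_less_3 choi_entry_def kraus0_def kraus1_def)
  have d1: "\<forall>k<3. \<forall>l<3. choi_entry s c (3 + k) (3 + l) = (if k = l then [s * s, 0, c * c] ! k else 0)"
    by (simp add: all_less_3 choi_entry_def kraus0_def kraus1_def)
  have H0: "vn_entropy (?M (?\<rho> 0)) = 0"
  proof -
    have "vn_entropy (?M (?\<rho> 0)) = - (\<Sum>i<3. [0, 1, 0] ! i * log 2 ([0, 1, 0] ! i))"
      by (rule vn_entropy_diag[OF Mc]) (use Mi[of 0] d0 in auto)
    then show ?thesis by (simp add: sum_less_3)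
  qed
  have H1: "vn_entropy (?M (?\<rho> 1)) = - (s * s * log 2 (s * s) + c * c * log 2 (c * c))"
  proof -
    have "vn_entropy (?M (?\<rho> 1)) = - (\<Sum>i<3. [s * s, 0, c * c] ! i * log 2 ([s * s, 0, c * c] ! i))"
      by (rule vn_entropy_diag[OF Mc]) (use Mi[of 1] d1 in auto)
    then show ?thesis by (simp add: sum_less_3)
  qed
  have HA: "vn_entropy ?A = - (s * s / 2 * log 2 (s * s / 2) + 1 / 2 * log 2 (1 / 2) + c * c / 2 * log 2 (c * c / 2))"
  proof -
    have "vn_entropy ?A = - (\<Sum>i<3. [s * s / 2, 1 / 2, c * c / 2] ! i * log 2 ([s * s / 2, 1 / 2, c * c / 2] ! i))"
    proof (rule vn_entropy_diag)
      show "?A \<in> carrier_mat 3 3" by (simp add: sum_mat_def)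
      fix k l :: nat assume kl: "k < 3" "l < 3"
      have "?A $$ (k, l) = (\<Sum>i<2. (complex_of_real (1 / 2) \<cdot>\<^sub>m ?M (?\<rho> i)) $$ (k, l))"
        using kl by (simp add: sum_mat_def)
      also have "\<dots> = (\<Sum>i<2. complex_of_real (1 / 2 * choi_entry s c (i * 3 + k) (i * 3 + l)))"
      proof (intro sum.cong refl)
        fix i :: nat assume "i \<in> {..<2}"
        then show "(complex_of_real (1 / 2) \<cdot>\<^sub>m ?M (?\<rho> i)) $$ (k, l)
            = complex_of_real (1 / 2 * choi_entry s c (i * 3 + k) (i * 3 + l))"
          using kl carrier_matD[OF Mc[of "?\<rho> i"]] Mi[of i k l] by simp
      qed
      also have "\<dots> = of_real ((choi_entry s c k l + choi_entry s c (3 + k) (3 + l)) / 2)"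
        by (simp add: numeral_2_eq_2 add_divide_distrib)
      also have "(choi_entry s c k l + choi_entry s c (3 + k) (3 + l)) / 2
          = (if k = l then [s * s / 2, 1 / 2, c * c / 2] ! k else 0)"
      proof -
        have "\<forall>k<3. ([0, 1, 0] ! k + [s * s, 0, c * c] ! k) / 2 = [s * s / 2, 1 / 2, c * c / 2] ! k"
          by (simp add: all_less_3)
        then show ?thesis using d0 d1 kl by simp
      qed
      finally show "?A $$ (k, l) = (if k = l then of_real ([s * s / 2, 1 / 2, c * c / 2] ! k) else 0)" by simp
    qed
    then show ?thesis by (simp add: sum_less_3)
  qed
  obtain t R where t: "\<forall>i<3 ^ 1. 0 < t i" "(\<Sum>i<3 ^ 1. t i) = 2 ^ 1"
    and feas: "beta_feasible (3 ^ 1) (3 ^ 1) (choi (3 ^ 1) (3 ^ 1) ?M) (real_diag (3 ^ 1) t) R"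
    using beta_feasible_superop_power[OF N_chan_dims beta_feasible_N_chan S_diag_pos[OF pos], of 1]
    unfolding S_diag_sum by blast
  have "vn_entropy ?A - (\<Sum>i<2. ?p i * vn_entropy (?M (?\<rho> i))) \<le> holevo (3 ^ 1) (3 ^ 1) ?M"
  proof (rule holevo_bounds(2)[OF superop_of_choi_superop_power[OF N_chan_dims order_refl]
          channel_choi_superop_power[OF N_chan_dims channel_choi_N_chan] feas, of "2 ^ 1"])
    show "density (3 ^ 1) (?\<rho> i)" if "i < 2" for i
      using that by (intro density_ketbra) simp
  qed (use t in auto)
  also have "vn_entropy ?A - (\<Sum>i<2. ?p i * vn_entropy (?M (?\<rho> i))) = 1"
  proof -
    have avg: "(\<Sum>i<2. ?p i * vn_entropy (?M (?\<rho> i))) = (vn_entropy (?M (?\<rho> 0)) + vn_entropy (?M (?\<rho> 1))) / 2"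
      by (simp add: numeral_2_eq_2 add_divide_distrib)
    have logs: "log 2 (s * s / 2) = log 2 (s * s) - 1" "log 2 (c * c / 2) = log 2 (c * c) - 1"
      "log 2 (1 / 2) = (- 1 :: real)"
      using spos by (simp_all add: log_divide)
    \<comment> \<open>Halving an eigenvalue lowers its logarithm by 1. The terms with
      \<open>log 2 (s * s)\<close> and \<open>log 2 (c * c)\<close> cancel against the averaged
      entropies, and only half the total trace remains.\<close>
    have "vn_entropy ?A - (\<Sum>i<2. ?p i * vn_entropy (?M (?\<rho> i))) = (s * s + c * c) / 2 + 1 / 2"
      unfolding avg HA H0 H1 logs by (simp add: field_simps)
    then show ?thesis by (simp add: sc)
  qed
  finally show ?thesis .
qed

text \<open>The Holevo quantity of the n-th power is at most \<open>n\<close>, so the regularised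
  supremum is already attained at \<open>n = 1\<close>.\<close>

lemma classical_capacity_N_chan:
  assumes pos: "0 < sin \<alpha>" "0 < cos \<alpha>"
  shows "classical_capacity 3 3 (N_chan \<alpha>) = 1"
  unfolding classical_capacity_def
proof (rule cSup_eq_maximum)
  let ?h = "\<lambda>n. holevo (3 ^ n) (3 ^ n) (superop_power 3 3 (N_chan \<alpha>) n)"
  have "?h 1 = 1"
    using holevo_superop_power_N_chan_le[OF pos, of 1] holevo_N_chan_ge[OF pos] by linarith
  then show "1 \<in> {?h n / real n | n. n \<ge> 1}" by force
  fix x assume "x \<in> {?h n / real n | n. n \<ge> 1}"
  then obtain n where "n \<ge> 1" "x = ?h n / real n" by blast
  then show "x \<le> 1"
    using holevo_superop_power_N_chan_le[OF pos, of n] by (simp add: divide_le_eq)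
qed

theorem proposition15:
  fixes \<alpha> :: real
  assumes "0 < \<alpha>" and "\<alpha> \<le> pi / 4"
  shows "classical_capacity 3 3 (N_chan \<alpha>) = C_ns_ppt 3 3 (N_chan \<alpha>)
       \<and> C_ns_ppt 3 3 (N_chan \<alpha>) = C_beta 3 3 (N_chan \<alpha>)
       \<and> C_beta 3 3 (N_chan \<alpha>) = 1"
proof -
  \<comment> \<open>Strict positivity makes every entry of \<open>S_diag\<close> positive, as needed
    for dividing by these entries and taking their logarithms.\<close>
  have "0 < sin \<alpha>" "0 < cos \<alpha>"
    using assms pi_gt_zero by (intro sin_gt_zero cos_gt_zero; linarith)+
  then show ?thesis
    by (simp add: classical_capacity_N_chan C_ns_ppt_N_chan C_beta_def beta_N_chan)
qed

end
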